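(* Let $B$ be a bouquet with edge set $[n]=\{1,\dots,n\}$ and let $\sigma$ be a signed rotation of $B$. Let $\mathbf{A}^s_\sigma$ be the symbolic skew-adjacency matrix of $B$ with respect to $\sigma$, let $f$ be the reduction map, and let $I_n$ be the $n\times n$ identity matrix. Then \[ f\bigl(\det(I_n+\mathbf{A}^s_\sigma)\bigr) \bmod 2=\sum_X x_X , \] where the sum is over all edge sets $X\subseteq[n]$ of spanning quasi-trees of $B$. Consequently, the number $\tau(B)$ of spanning quasi-trees of $B$ is \[ \tau(B)=\Bigl(f\bigl(\det(I_n+\mathbf{A}^s_\sigma)\bigr) \bmod 2\Bigr)\Big|_{x_X=1}, \] i.e. the integer obtained by setting $x_X=1$ for all $X\subseteq[n]$ in the polynomial whose coefficients have been reduced modulo 2 to values in $\{0,1\}$.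
   Context: Ribbon graphs. A ribbon graph $G=(V(G),E(G))$ is a (possibly non-orientable) surface with boundary, represented as the union of a set $V(G)$ of topological discs (vertices) and a set $E(G)$ of topological discs (edges) such that: vertices and edges intersect in disjoint line segments; each such line segment lies on the boundary of precisely one vertex and precisely one edge; every edge contains exactly two such line segments. A bouquet is a ribbon graph with exactly one vertex, so each of its edges is a loop. A loop is non-orientable if its ribbon together with the vertex forms a Möbius band, and orientable otherwise. A ribbon graph is a quasi-tree if it has exactly one boundary component. For $X\subseteq E(G)$, $X$ is the edge set of a spanning quasi-tree of $G$ if the spanning ribbon subgraph $(V(G),X)$ (all vertices kept, edges outside $X$ deleted) is a quasi-tree. $\tau(G)$ is the number of spanning quasi-trees of a connected ribbon graph $G$. Signed rotation. A signed rotation $\sigma$ of a bouquet $B$ with edge set $[n]$ is a cyclic sequence of length $2n$ encoding the order of the half-edges around the vertex. Each loop $i\in[n]$ appears twice, one occurrence labelled $i^a$ and the other $i^b$, and each occurrence carries a sign: $i^a$ and $i^b$ have identical signs if the loop $i$ is orientable, and opposite signs if it is non-orientable. (The starting point, the direction of traversal and the choice of which occurrence is labelled $a$ or $b$ are arbitrary.) Symbolic skew-adjacency matrix. $\mathbf{A}^s_\sigma$ is the $n\times n$ matrix over the polynomial ring $\mathbb{Z}[x_{ij}: i,j\in[n]]$ in commuting indeterminates, with entries: diagonal entry $(i,i)$ equal to $x_{ii}$ if the signs of $i^a$ and $i^b$ in $\sigma$ are opposite, and $0$ if they are the same; for $i<j$, the $(i,j)$ entry is $x_{ij}$ if the relative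 cyclic order in $\sigma$ (ignoring signs) is $i^a,j^a,i^b,j^b$, it is $-x_{ij}$ if the relative cyclic order is $i^a,j^b,i^b,j^a$, and $0$ otherwise; for $i>j$, the $(i,j)$ entry is minus the $(j,i)$ entry. Reduction map. Let $\mathbb{Z}[x_A:A\subseteq[n]]$ denote the commutative ring of $\mathbb{Z}$-linear combinations of the symbols $x_A$ ($A\subseteq[n]$), with multiplication $x_A\cdot x_B=x_{A\cup B}$ and unit $x_\emptyset=1$. The reduction map $f:\mathbb{Z}[x_{ij}]\to\mathbb{Z}[x_A:A\subseteq[n]]$ is the $\mathbb{Z}$-linear map sending a monomial $m=\prod_{r=1}^k x_{i_rj_r}^{e_r}$ (with $e_r\ge1$) to $x_A$, where $A=\bigcup_{r=1}^k\{i_r,j_r\}$ (so $f(1)=x_\emptyset$). Reduction modulo 2. For $P\in\mathbb{Z}[x_A:A\subseteq[n]]$, $P\bmod 2$ is obtained by reducing each coefficient of $P$ (in the basis $x_A$) modulo 2, with values taken in $\{0,1\}$. *)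

theory Defs
  imports
    "HOL-Analysis.Analysis"
    "HOL-Library.Poly_Mapping"
    "Jordan_Normal_Form.Determinant"
begin

section \<open>Ribbon graphs\<close>

text \<open>
  Manifold boundary of a two-dimensional surface: the points without a neighbourhood (relative to
  the surface) that is homeomorphic to an open disc.
\<close>

definition surface_boundary :: "'a::topological_space set \<Rightarrow> 'a set" where
  "surface_boundary S =
     {x \<in> S. \<not> (\<exists>U. openin (top_of_set S) U \<and> x \<in> U \<and> U homeomorphic ball (0::complex) 1)}"

definition is_disc :: "'a::topological_space set \<Rightarrow> bool" where
  "is_disc D \<longleftrightarrow> D homeomorphic cball (0::complex) 1"

definition line_segment :: "'a::topological_space set \<Rightarrow> bool" where
  "line_segment s \<longleftrightarrow> (\<exists>g. arc g \<and> path_image g = s)"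

text \<open>
  The vertices are subsets of an ambient space; the edges are labelled, the disc of the
  edge labelled \<open>e\<close> being \<open>ribbon G e\<close>.
\<close>

record ('e, 'a) ribbon_graph =
  verts :: "'a set set"
  edges :: "'e set"
  ribbon :: "'e \<Rightarrow> 'a set"

definition surface :: "('e, 'a::topological_space) ribbon_graph \<Rightarrow> 'a set" where
  "surface G = \<Union> (verts G) \<union> \<Union> (ribbon G ` edges G)"

definition segments :: "('e, 'a::topological_space) ribbon_graph \<Rightarrow> 'a set set" where
  "segments G = components (\<Union> (verts G) \<inter> \<Union> (ribbon G ` edges G))"

definition edge_segments :: "('e, 'a::topological_space) ribbon_graph \<Rightarrow> 'e \<Rightarrow> 'a set set" where
  "edge_segments G e = {s \<in> segments G. s \<subseteq> ribbon G e}"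

text \<open>
  In a Hausdorff space the subspace topology on the union of finitely many compact discs is the one
  obtained by gluing the discs along their intersections, so \<open>surface G\<close> is automatically a compact
  surface with boundary.
\<close>

definition ribbon_graph :: "('e, 'a::t2_space) ribbon_graph \<Rightarrow> bool" where
  "ribbon_graph G \<longleftrightarrow>
     finite (verts G) \<and> finite (edges G) \<and>
     (\<forall>v \<in> verts G. is_disc v) \<and> (\<forall>e \<in> edges G. is_disc (ribbon G e)) \<and>
     disjoint (verts G) \<and> disjoint_family_on (ribbon G) (edges G) \<and>
     (\<forall>s \<in> segments G. line_segment s \<and>
        (\<exists>!v. v \<in> verts G \<and> s \<subseteq> surface_boundary v) \<and>
        (\<exists>!e. e \<in> edges G \<and> s \<subseteq> surface_boundary (ribbon G e))) \<and>
     (\<forall>e \<in> edges G. card (edge_segments G e) = 2)"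

definition bouquet :: "('e, 'a::t2_space) ribbon_graph \<Rightarrow> bool" where
  "bouquet G \<longleftrightarrow> ribbon_graph G \<and> card (verts G) = 1"

definition boundary_components :: "('e, 'a::topological_space) ribbon_graph \<Rightarrow> 'a set set" where
  "boundary_components G = components (surface_boundary (surface G))"

definition quasi_tree :: "('e, 'a::topological_space) ribbon_graph \<Rightarrow> bool" where
  "quasi_tree G \<longleftrightarrow> card (boundary_components G) = 1"

definition spanning_subgraph ::
  "('e, 'a::topological_space) ribbon_graph \<Rightarrow> 'e set \<Rightarrow> ('e, 'a) ribbon_graph" where
  "spanning_subgraph G X = G\<lparr>edges := X\<rparr>"

definition spanning_quasi_trees :: "('e, 'a::topological_space) ribbon_graph \<Rightarrow> 'e set set" where
  "spanning_quasi_trees G = {X. X \<subseteq> edges G \<and> quasi_tree (spanning_subgraph G X)}"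

definition tau :: "('e, 'a::topological_space) ribbon_graph \<Rightarrow> nat" where
  "tau G = card (spanning_quasi_trees G)"

text \<open>
  A Moebius band is the unit square with \<open>(0, y)\<close> glued to \<open>(1, 1 - y)\<close>. As the square is compact,
  a continuous map \<open>q\<close> onto a subset of a Hausdorff space is automatically a quotient map.
\<close>

definition moebius_band :: "'a::t2_space set \<Rightarrow> bool" where
  "moebius_band M \<longleftrightarrow>
     (\<exists>q :: real \<times> real \<Rightarrow> 'a.
        continuous_on ({0..1} \<times> {0..1}) q \<and> q ` ({0..1} \<times> {0..1}) = M \<and>
        (\<forall>x\<in>{0..1}. \<forall>y\<in>{0..1}. \<forall>x'\<in>{0..1}. \<forall>y'\<in>{0..1}.
           q (x, y) = q (x', y') \<longleftrightarrow>
             (x = x' \<and> y = y') \<or> (x = 0 \<and> x' = 1 \<and> y' = 1 - y) \<or> (x = 1 \<and> x' = 0 \<and> y' = 1 - y)))"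

text \<open>Used for bouquets only, where \<open>\<Union> (verts G)\<close> is the unique vertex.\<close>

definition nonorientable_loop :: "('e, 'a::t2_space) ribbon_graph \<Rightarrow> 'e \<Rightarrow> bool" where
  "nonorientable_loop G e \<longleftrightarrow> moebius_band (\<Union> (verts G) \<union> ribbon G e)"


section \<open>Signed rotations\<close>

datatype occurrence = Occ_a | Occ_b

datatype sign = Plus | Minus

text \<open>
  A cyclic sequence is represented by a list starting at an arbitrary element; the entry
  \<open>(i, Occ_a, s)\<close> is the occurrence \<open>i\<^sup>a\<close> carrying the sign \<open>s\<close>.
\<close>

type_synonym 'e signed_cyclic_seq = "('e \<times> occurrence \<times> sign) list"

definition unsigned :: "'e signed_cyclic_seq \<Rightarrow> ('e \<times> occurrence) list" where
  "unsigned \<sigma> = map (\<lambda>(i, c, s). (i, c)) \<sigma>"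

definition opposite_signs :: "'e signed_cyclic_seq \<Rightarrow> 'e \<Rightarrow> bool" where
  "opposite_signs \<sigma> i \<longleftrightarrow> (\<exists>s s'. (i, Occ_a, s) \<in> set \<sigma> \<and> (i, Occ_b, s') \<in> set \<sigma> \<and> s \<noteq> s')"

text \<open>
  The sequence lists the edges in the order in which their segments are met along the boundary
  circle of the vertex: \<open>\<gamma>\<close> traverses the circle once, and the \<open>k\<close>-th segment is the image of the
  parameter interval from \<open>a k\<close> to \<open>b k\<close>. The direction and the starting point of \<open>\<gamma>\<close> are
  arbitrary (except that it does not start in the interior of a segment).
\<close>

definition encodes_order :: "('e, 'a::t2_space) ribbon_graph \<Rightarrow> 'e signed_cyclic_seq \<Rightarrow> bool" where
  "encodes_order B \<sigma> \<longleftrightarrow>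
     (\<exists>\<gamma> a b. simple_path \<gamma> \<and> pathfinish \<gamma> = pathstart \<gamma> \<and>
        path_image \<gamma> = surface_boundary (\<Union> (verts B)) \<and>
        (\<forall>k < length \<sigma>. 0 \<le> a k \<and> a k < b k \<and> b k < 1 \<and>
           \<gamma> ` {a k..b k} \<in> edge_segments B (fst (\<sigma> ! k))) \<and>
        (\<forall>k. Suc k < length \<sigma> \<longrightarrow> b k < a (Suc k)))"

definition signed_rotation :: "('e, 'a::t2_space) ribbon_graph \<Rightarrow> 'e signed_cyclic_seq \<Rightarrow> bool" where
  "signed_rotation B \<sigma> \<longleftrightarrow>
     distinct (unsigned \<sigma>) \<and> set (unsigned \<sigma>) = edges B \<times> {Occ_a, Occ_b} \<and>
     encodes_order B \<sigma> \<and>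
     (\<forall>i \<in> edges B. opposite_signs \<sigma> i \<longleftrightarrow> nonorientable_loop B i)"

text \<open>The cyclic order that \<open>\<sigma>\<close> induces on the members of \<open>hs\<close> is \<open>hs\<close>.\<close>

definition relative_cyclic_order :: "'e signed_cyclic_seq \<Rightarrow> ('e \<times> occurrence) list \<Rightarrow> bool" where
  "relative_cyclic_order \<sigma> hs \<longleftrightarrow>
     (\<exists>k. rotate k (filter (\<lambda>h. h \<in> set hs) (unsigned \<sigma>)) = hs)"


section \<open>The symbolic skew-adjacency matrix\<close>

text \<open>Integer polynomials in the indeterminates \<open>x\<^sub>i\<^sub>j\<close>; monomials are exponent functions.\<close>

type_synonym monomial = "(nat \<times> nat) \<Rightarrow>\<^sub>0 nat"

type_synonym xpoly = "monomial \<Rightarrow>\<^sub>0 int"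

definition xvar :: "nat \<Rightarrow> nat \<Rightarrow> xpoly" where
  "xvar i j = Poly_Mapping.single (Poly_Mapping.single (i, j) 1) 1"

definition upper_entry :: "nat signed_cyclic_seq \<Rightarrow> nat \<Rightarrow> nat \<Rightarrow> xpoly" where
  "upper_entry \<sigma> i j =
     (if relative_cyclic_order \<sigma> [(i, Occ_a), (j, Occ_a), (i, Occ_b), (j, Occ_b)] then xvar i j
      else if relative_cyclic_order \<sigma> [(i, Occ_a), (j, Occ_b), (i, Occ_b), (j, Occ_a)] then - xvar i j
      else 0)"

definition skew_entry :: "nat signed_cyclic_seq \<Rightarrow> nat \<Rightarrow> nat \<Rightarrow> xpoly" where
  "skew_entry \<sigma> i j =
     (if i = j then (if opposite_signs \<sigma> i then xvar i i else 0)
      else if i < j then upper_entry \<sigma> i j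
      else - upper_entry \<sigma> j i)"

text \<open>Rows and columns of \<open>mat\<close> are indexed from 0, edges from 1.\<close>

definition skew_adjacency :: "nat \<Rightarrow> nat signed_cyclic_seq \<Rightarrow> xpoly mat" where
  "skew_adjacency n \<sigma> = mat n n (\<lambda>(i, j). skew_entry \<sigma> (i + 1) (j + 1))"


section \<open>The reduction map\<close>

text \<open>
  The target ring is the monoid ring over the integers of sets under union. The
  multiplication of \<^typ>\<open>'a \<Rightarrow>\<^sub>0 int\<close> is induced by addition on \<open>'a\<close>, hence the wrapper type whose
  addition is union.
\<close>

datatype union_set = USet "nat set"

instantiation union_set :: comm_monoid_add
begin

definition zero_union_set :: union_set where
  "0 = USet {}"

fun plus_union_set :: "union_set \<Rightarrow> union_set \<Rightarrow> union_set" where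
  "USet A + USet B = USet (A \<union> B)"

instance
proof
  fix a b c :: union_set
  show "a + b + c = a + (b + c)" by (cases a; cases b; cases c) (simp add: Un_assoc)
  show "a + b = b + a" by (cases a; cases b) (simp add: Un_commute)
  show "0 + a = a" by (cases a) (simp add: zero_union_set_def)
qed

end

type_synonym setpoly = "union_set \<Rightarrow>\<^sub>0 int"

definition xset :: "nat set \<Rightarrow> setpoly" where
  "xset A = Poly_Mapping.single (USet A) 1"

lemma xset_mult: "xset A * xset B = xset (A \<union> B)"
  by (simp add: xset_def mult_single)

lemma xset_empty: "xset {} = 1"
  by (simp add: xset_def flip: zero_union_set_def)

definition indices :: "monomial \<Rightarrow> nat set" where
  "indices m = (\<Union>(i, j) \<in> Poly_Mapping.keys m. {i, j})"

definition reduction :: "xpoly \<Rightarrow> setpoly" where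
  "reduction P = (\<Sum>m \<in> Poly_Mapping.keys P. of_int (Poly_Mapping.lookup P m) * xset (indices m))"

definition mod_2 :: "setpoly \<Rightarrow> setpoly" where
  "mod_2 P = Poly_Mapping.map (\<lambda>c. c mod 2) P"

text \<open>Substitution of 1 for all symbols \<open>x\<^sub>A\<close>.\<close>

definition at_ones :: "setpoly \<Rightarrow> int" where
  "at_ones P = (\<Sum>A \<in> Poly_Mapping.keys P. Poly_Mapping.lookup P A)"

end

theory Submission
  imports Defs "HOL-Library.Z2"
begin

text \<open>
  Fix a set \<open>X\<close> of edges and let \<open>S\<close> be the vertex disc with the ribbons of \<open>X\<close> attached. Two facts,
  one topological and one algebraic, give the theorem: the boundary of \<open>S\<close> is connected exactly if
  the principal submatrix of the intersection matrix on \<open>X\<close> is nonsingular over the field with two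
  elements, and the coefficient of \<open>x\<^sub>X\<close> in the reduced determinant is an integer that is
  congruent modulo 2 to the determinant of that submatrix.

  Topological fact. Invariance of domain shows in planar charts that the boundary of \<open>S\<close> consists of
  the boundary circle of the vertex without the open segments of \<open>X\<close>, together with the two long
  sides of every ribbon of \<open>X\<close> (\<open>surface_boundary_total\<close>). A splitting of this set into two closed
  parts colours its points by 0 and 1, constantly on every gap between segments and on every side.
  Let \<open>v e\<close> be the difference of the colours at the two ends of a segment of \<open>e\<close>; as the sides of the
  ribbon join the ends of one segment to those of the other, both segments of \<open>e\<close> give the same value.
  Walking along the circle from one end of a side of \<open>e\<close> to the other, the colour changes by \<open>v f\<close> at
  each segment of \<open>f\<close> that is passed. An edge is passed once exactly if it crosses \<open>e\<close>, and a twisted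
  ribbon makes the walk pass one segment of \<open>e\<close> itself. So equality of the colours at the ends of the
  side is the row of \<open>e\<close> in the linear system of the submatrix. Conversely a vector in the kernel
  determines a colouring, and the zero vector corresponds to the constant colourings
  (\<open>connected_boundary_iff\<close>).

  The argument needs the ribbons as squares whose bottom and top are the given segments. A disc can be
  parametrised in this way because a homeomorphism between boundary circles extends over the discs by
  coning; the direction in which the second segment is met decides between an untwisted and a twisted
  band. That the twisted bands are the Moebius bands follows in one direction from an explicit
  parametrisation. Conversely, the boundary of a Moebius band is connected, whereas the
  zero 1-by-1 matrix of an untwisted band is singular (\<open>moebius_band_single_iff\<close>).

  Algebraic fact. The reduction map is a ring homomorphism, so it can be applied to the entries of the
  matrix. Expanding the product for each permutation in the Leibniz formula for the determinant of
  \<open>I + A\<close> picks a set \<open>Z\<close> of rows in which the entry of \<open>A\<close> is taken; the identity factors vanish unless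
  the permutation fixes the complement of \<open>Z\<close>, and then the indices that occur are exactly those in \<open>Z\<close>.
  The coefficient of the symbol of \<open>Z\<close> is therefore the principal minor on \<open>Z\<close>, evaluated with every
  indeterminate equal to 1 (\<open>det_one_plus_expand\<close>).
\<close>


section \<open>Planar charts and the boundary of a surface\<close>

text \<open>
  By invariance of domain, a subset of the plane that is homeomorphic to an open disc is open. Hence
  whether a point of a surface is an interior point can be read off in any planar chart, whatever the
  shape of its domain.
\<close>

lemma chart_surface_boundary:
  fixes \<phi> :: "complex \<Rightarrow> 'a::topological_space"
  assumes hom: "homeomorphism Q O' \<phi> \<psi>" and O': "openin (top_of_set S) O'" and z: "z \<in> Q"
  shows "\<phi> z \<in> surface_boundary S \<longleftrightarrow> z \<notin> interior Q"
proof -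
  have "\<phi> z \<in> O'" using hom z by (auto simp: homeomorphism_def)
  have "O' \<subseteq> S" using O' openin_imp_subset by blast
  have "(\<exists>U. openin (top_of_set S) U \<and> \<phi> z \<in> U \<and> U homeomorphic ball (0::complex) 1) \<longleftrightarrow> z \<in> interior Q"
  proof
    assume "\<exists>U. openin (top_of_set S) U \<and> \<phi> z \<in> U \<and> U homeomorphic ball (0::complex) 1"
    then obtain U where U: "openin (top_of_set S) U" "\<phi> z \<in> U" and "U homeomorphic ball (0::complex) 1"
      by blast
    then obtain f g where fg: "homeomorphism U (ball (0::complex) 1) f g"
      by (auto simp: homeomorphic_def)
    define W where "W = U \<inter> O'"
    have WU: "openin (top_of_set U) W" and WO: "openin (top_of_set O') W"
      using U(1) O' \<open>O' \<subseteq> S\<close>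
      unfolding W_def by (auto simp: openin_open)
    have "openin (top_of_set (ball 0 1)) (f ` W)"
      using homeomorphism_imp_open_map[OF fg WU] .
    then have oW: "open (f ` W)"
      using openin_open_trans open_ball by blast
    have "homeomorphism W (f ` W) f g"
      using fg WU by (meson homeomorphism_of_subsets openin_imp_subset subset_refl)
    then have gW: "continuous_on (f ` W) g" "inj_on g (f ` W)" "g ` f ` W = W"
      by (auto simp: homeomorphism_def intro: inj_on_inverseI[where g=f])
    have ps: "continuous_on W \<psi>" "inj_on \<psi> W"
      using hom unfolding W_def homeomorphism_def
      by (auto intro: continuous_on_subset inj_on_inverseI[where g=\<phi>])
    have "open ((\<psi> \<circ> g) ` (f ` W))"
    proof (rule invariance_of_domain)
      show "continuous_on (f ` W) (\<psi> \<circ> g)"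
        using gW ps by (intro continuous_on_compose) auto
      show "inj_on (\<psi> \<circ> g) (f ` W)"
        using gW ps by (intro comp_inj_on) auto
    qed (fact oW)
    then have "open (\<psi> ` W)"
      using gW(3) by (metis image_comp)
    moreover have "\<psi> ` W \<subseteq> Q"
      using hom by (auto simp: W_def homeomorphism_def)
    moreover have "z \<in> \<psi> ` W"
      using hom z U(2) \<open>\<phi> z \<in> O'\<close> by (force simp: W_def homeomorphism_def image_iff)
    ultimately show "z \<in> interior Q"
      by (meson interiorI)
  next
    assume "z \<in> interior Q"
    then obtain r where r: "r > 0" "ball z r \<subseteq> Q"
      by (meson mem_interior)
    have "homeomorphism (ball z r) (\<phi> ` ball z r) \<phi> \<psi>"
      using hom r by (meson homeomorphism_of_subsets subset_refl)
    then have "\<phi> ` ball z r homeomorphic ball z r"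
      by (metis homeomorphic_def homeomorphic_sym)
    also have "ball z r homeomorphic ball (0::complex) 1"
      using r by (intro homeomorphic_balls) auto
    finally have "\<phi> ` ball z r homeomorphic ball (0::complex) 1" .
    moreover have "openin (top_of_set O') (\<phi> ` ball z r)"
      using r by (intro homeomorphism_imp_open_map[OF hom]) (simp add: open_subset)
    then have "openin (top_of_set S) (\<phi> ` ball z r)"
      using O' openin_trans by blast
    ultimately show "\<exists>U. openin (top_of_set S) U \<and> \<phi> z \<in> U \<and> U homeomorphic ball (0::complex) 1"
      using r by (metis centre_in_ball imageI)
  qed
  then show ?thesis
    using \<open>\<phi> z \<in> O'\<close> \<open>O' \<subseteq> S\<close> by (auto simp: surface_boundary_def)
qed

text \<open>
  A continuous map on a compact set is closed, so it restricts to a homeomorphism over every open part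
  of its image over which it is injective. This gives charts from parametrisations that identify some
  points of their domain.
\<close>

lemma compact_chart_surface_boundary:
  fixes \<Phi> :: "complex \<Rightarrow> 'a::t2_space"
  assumes Q: "compact Q" and cont: "continuous_on Q \<Phi>"
    and U: "openin (top_of_set S) U" "U \<subseteq> \<Phi> ` Q" and sub: "\<Phi> ` Q \<subseteq> S"
    and inj: "inj_on \<Phi> (Q \<inter> \<Phi> -` U)" and z: "z \<in> Q" "\<Phi> z \<in> U"
  shows "\<Phi> z \<in> surface_boundary S \<longleftrightarrow> z \<notin> interior Q"
proof -
  define Q0 where "Q0 = Q \<inter> \<Phi> -` U"
  define G where "G = inv_into Q0 \<Phi>"
  have im: "\<Phi> ` Q0 = U" using U(2) by (auto simp: Q0_def)
  have inj0: "inj_on \<Phi> Q0" using inj by (simp add: Q0_def)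
  have G: "G (\<Phi> x) = x" if "x \<in> Q0" for x
    using inv_into_f_f[OF inj0 that] by (simp add: G_def)
  have "continuous_on U G"
    unfolding continuous_on_closed_invariant
  proof (intro allI impI)
    fix B :: "complex set" assume "closed B"
    have "compact (\<Phi> ` (Q \<inter> B))"
      using Q cont \<open>closed B\<close> by (meson compact_Int_closed compact_continuous_image continuous_on_subset inf_le1)
    have "u \<in> \<Phi> ` (Q \<inter> B) \<longleftrightarrow> G u \<in> B" if "u \<in> U" for u
    proof
      assume "u \<in> \<Phi> ` (Q \<inter> B)"
      then obtain y where "y \<in> Q0" "y \<in> B" "u = \<Phi> y" using \<open>u \<in> U\<close> unfolding Q0_def by blast
      then show "G u \<in> B" using G by simp
    next
      assume B: "G u \<in> B"
      obtain y where "y \<in> Q0" "u = \<Phi> y" using \<open>u \<in> U\<close> im by blast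
      then show "u \<in> \<Phi> ` (Q \<inter> B)" using B G by (auto simp: Q0_def)
    qed
    then have "\<Phi> ` (Q \<inter> B) \<inter> U = G -` B \<inter> U" by blast
    with \<open>compact (\<Phi> ` (Q \<inter> B))\<close> show "\<exists>A. closed A \<and> A \<inter> U = G -` B \<inter> U"
      using compact_imp_closed by blast
  qed
  moreover have "continuous_on Q0 \<Phi>" unfolding Q0_def using cont by (rule continuous_on_subset) auto
  ultimately have hom: "homeomorphism Q0 U \<Phi> G"
    using G im by (intro homeomorphismI) auto
  obtain T where T: "open T" "U = S \<inter> T"
    using U by (auto simp: openin_open)
  have "openin (top_of_set Q) (Q \<inter> \<Phi> -` T)"
    using cont T continuous_openin_preimage_gen by blast
  moreover have "Q \<inter> \<Phi> -` T = Q0" using T sub by (auto simp: Q0_def)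
  ultimately have "openin (top_of_set Q) Q0" by simp
  then obtain T' where T': "open T'" "Q0 = Q \<inter> T'" by (auto simp: openin_open)
  have "z \<in> Q0" using z by (simp add: Q0_def)
  have "\<Phi> z \<in> surface_boundary S \<longleftrightarrow> z \<notin> interior Q0"
    using chart_surface_boundary[OF hom U(1) \<open>z \<in> Q0\<close>] .
  moreover have "interior Q0 = interior Q \<inter> T'"
    using T' by (simp add: interior_open)
  ultimately show ?thesis using \<open>z \<in> Q0\<close> T' by auto
qed

text \<open>
  Both images are the quotient of \<open>K\<close> by the same equivalence relation.
\<close>

lemma compatible_maps_homeomorphism:
  fixes f :: "'a::topological_space \<Rightarrow> 'b::t2_space" and g :: "'a \<Rightarrow> 'c::t2_space"
  assumes K: "compact K" and f: "continuous_on K f" and g: "continuous_on K g"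
    and eq: "\<And>x y. x \<in> K \<Longrightarrow> y \<in> K \<Longrightarrow> f x = f y \<longleftrightarrow> g x = g y"
  obtains h k where "homeomorphism (f ` K) (g ` K) h k" "\<And>x. x \<in> K \<Longrightarrow> h (f x) = g x"
proof -
  define h where "h = g \<circ> inv_into K f"
  have h: "h (f x) = g x" if "x \<in> K" for x
    unfolding h_def o_def
    using eq[of "inv_into K f (f x)" x] that
    by (simp add: f_inv_into_f inv_into_into)
  have "continuous_on (f ` K) h"
  proof (subst continuous_on_closed_vimage)
    show "closed (f ` K)" using K f compact_continuous_image compact_imp_closed by blast
    show "\<forall>B. closed B \<longrightarrow> closed (h -` B \<inter> f ` K)"
    proof (intro allI impI)
      fix B :: "'c set" assume "closed B"
      have "closedin (top_of_set K) (K \<inter> g -` B)"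
        using g \<open>closed B\<close> continuous_closedin_preimage by blast
      then have "compact (K \<inter> g -` B)"
        using K closedin_compact by blast
      then have "compact (f ` (K \<inter> g -` B))"
        using f by (meson Int_lower1 compact_continuous_image continuous_on_subset)
      moreover have "f ` (K \<inter> g -` B) = h -` B \<inter> f ` K" using h by auto
      ultimately show "closed (h -` B \<inter> f ` K)" using compact_imp_closed by auto
    qed
  qed
  moreover have "h ` f ` K = g ` K" using h by (simp add: image_image)
  moreover have "inj_on h (f ` K)" using h eq by (auto simp: inj_on_def)
  moreover have "compact (f ` K)" using K f compact_continuous_image by blast
  ultimately obtain k where "homeomorphism (f ` K) (g ` K) h k"
    using homeomorphism_compact[of "f ` K" h "g ` K"] \<open>continuous_on (f ` K) h\<close> by blast
  then show thesis using h that by blast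
qed

section \<open>Discs as squares with prescribed sides\<close>

lemma disc_parametrization:
  fixes D :: "'a::t2_space set"
  assumes "is_disc D"
  obtains h k where "homeomorphism (cball (0::complex) 1) D h k" "surface_boundary D = h ` sphere 0 1"
proof -
  obtain h k where hk: "homeomorphism (cball (0::complex) 1) D h k"
    using assms unfolding is_disc_def by (metis homeomorphic_def homeomorphic_sym)
  have "h z \<in> surface_boundary D \<longleftrightarrow> z \<in> sphere 0 1" if "z \<in> cball 0 1" for z
    using chart_surface_boundary[OF hk openin_subtopology_self that] that
    by (auto simp: interior_cball)
  moreover have "surface_boundary D \<subseteq> h ` cball 0 1"
    using hk by (auto simp: surface_boundary_def homeomorphism_def)
  moreover have "sphere 0 1 \<subseteq> cball (0::complex) 1" by auto
  ultimately have "surface_boundary D = h ` sphere 0 1" by blast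
  with hk show thesis using that by blast
qed

text \<open>
  Alexander's trick: \<open>\<theta>\<close> is applied on each circle around the origin.
\<close>

lemma cone_extension:
  fixes \<theta> :: "complex \<Rightarrow> complex"
  assumes cont: "continuous_on (sphere 0 1) \<theta>" and inj: "inj_on \<theta> (sphere 0 1)"
    and im: "\<theta> ` sphere 0 1 = sphere 0 1"
  obtains \<Theta> where "continuous_on (cball 0 1) \<Theta>" "inj_on \<Theta> (cball 0 1)" "\<Theta> ` cball 0 1 = cball 0 1"
    "\<And>z. z \<in> sphere 0 1 \<Longrightarrow> \<Theta> z = \<theta> z"
proof -
  define \<Theta> where "\<Theta> z = (if z = 0 then 0 else norm z *\<^sub>R \<theta> (sgn z))" for z
  have sg: "sgn z \<in> sphere 0 1" if "z \<noteq> 0" for z :: complex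
    using that by (simp add: norm_sgn)
  have th: "norm (\<theta> (sgn z)) = 1" if "z \<noteq> 0" for z
    using im sg[OF that] by auto
  have nTh: "norm (\<Theta> z) = norm z" for z
    using th by (simp add: \<Theta>_def)
  have sgTh: "sgn (\<Theta> z) = \<theta> (sgn z)" if "z \<noteq> 0" for z
    using that th[OF that] by (simp add: \<Theta>_def sgn_scaleR) (simp add: sgn_div_norm)
  have "continuous (at z within cball 0 1) \<Theta>" for z
  proof (cases "z = 0")
    case True
    have "(\<Theta> \<longlongrightarrow> 0) (at 0 within cball 0 1)"
    proof (rule Lim_null_comparison)
      show "\<forall>\<^sub>F x in at 0 within cball 0 1. norm (\<Theta> x) \<le> norm x"
        using nTh by simp
      show "(norm \<longlongrightarrow> 0) (at (0::complex) within cball 0 1)"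
        by (rule tendsto_norm_zero) (rule tendsto_ident_at)
    qed
    then show ?thesis using True by (simp add: continuous_within \<Theta>_def)
  next
    case False
    have "continuous_on (- {0}) (\<lambda>z. norm z *\<^sub>R \<theta> (sgn z))"
      by (intro continuous_intros continuous_on_compose2[OF cont]) (auto simp: norm_sgn split: if_splits)
    then have "continuous_on (- {0}) \<Theta>"
      by (rule continuous_on_eq) (auto simp: \<Theta>_def)
    then have "isCont \<Theta> z"
      using False continuous_on_interior[of "- {0}" \<Theta> z] by (simp add: interior_open open_Compl)
    then show ?thesis by (rule continuous_at_imp_continuous_at_within)
  qed
  then have "continuous_on (cball 0 1) \<Theta>"
    by (simp add: continuous_on_eq_continuous_within)
  moreover have "inj_on \<Theta> (cball 0 1)"
  proof (rule inj_onI)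
    fix x y assume xy: "\<Theta> x = \<Theta> y"
    then have n: "norm x = norm y" using nTh by metis
    show "x = y"
    proof (cases "x = 0")
      case False
      then have "y \<noteq> 0" using n by auto
      then have "\<theta> (sgn x) = \<theta> (sgn y)" using sgTh False xy by metis
      then have "sgn x = sgn y" using inj sg False \<open>y \<noteq> 0\<close> by (meson inj_onD)
      then show ?thesis using n False \<open>y \<noteq> 0\<close> by (simp add: sgn_div_norm)
    qed (use n in auto)
  qed
  moreover have "\<Theta> ` cball 0 1 = cball 0 1"
  proof (rule antisym)
    show "\<Theta> ` cball 0 1 \<subseteq> cball 0 1" using nTh by auto
    show "cball 0 1 \<subseteq> \<Theta> ` cball 0 1"
    proof
      fix w :: complex assume w: "w \<in> cball 0 1"
      show "w \<in> \<Theta> ` cball 0 1"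
      proof (cases "w = 0")
        case True then show ?thesis by (intro image_eqI[of _ _ 0]) (auto simp: \<Theta>_def)
      next
        case False
        then obtain u where u: "norm u = 1" "\<theta> u = sgn w"
          using sg[OF False] im by (metis imageE mem_sphere_0)
        have "\<Theta> (norm w *\<^sub>R u) = w"
          using u False by (auto simp: \<Theta>_def sgn_scaleR) (simp add: sgn_div_norm)
        then show ?thesis using u w by (intro image_eqI[of _ _ "norm w *\<^sub>R u"]) auto
      qed
    qed
  qed
  moreover have "\<Theta> z = \<theta> z" if "z \<in> sphere 0 1" for z
    using that by (auto simp: \<Theta>_def sgn_div_norm)
  ultimately show thesis using that by blast
qed

lemma loop_eq_iff:
  assumes "simple_path c" "pathfinish c = pathstart c" "x \<in> {0..1}" "y \<in> {0..1}"
  shows "c x = c y \<longleftrightarrow> x = y \<or> x = 0 \<and> y = 1 \<or> x = 1 \<and> y = 0"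
proof
  assume "c x = c y"
  then show "x = y \<or> x = 0 \<and> y = 1 \<or> x = 1 \<and> y = 0"
    using assms unfolding simple_path_def loop_free_def by blast
next
  assume "x = y \<or> x = 0 \<and> y = 1 \<or> x = 1 \<and> y = 0"
  then show "c x = c y" using assms(2) by (auto simp: pathfinish_def pathstart_def)
qed

text \<open>
  The two loops identify the boundary circles with each other, and coning extends this identification
  over the discs.
\<close>

lemma disc_homeomorphism_extending_loops:
  fixes D1 :: "'a::t2_space set" and D2 :: "'b::t2_space set"
  assumes D: "is_disc D1" "is_disc D2"
    and c1: "simple_path c1" "pathfinish c1 = pathstart c1" "path_image c1 = surface_boundary D1"
    and c2: "simple_path c2" "pathfinish c2 = pathstart c2" "path_image c2 = surface_boundary D2"
  obtains H where "continuous_on D1 H" "inj_on H D1" "H ` D1 = D2" "\<And>t. t \<in> {0..1} \<Longrightarrow> H (c1 t) = c2 t"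
proof -
  obtain h1 k1 where h1: "homeomorphism (cball (0::complex) 1) D1 h1 k1" "surface_boundary D1 = h1 ` sphere 0 1"
    using disc_parametrization[OF D(1)] .
  obtain h2 k2 where h2: "homeomorphism (cball (0::complex) 1) D2 h2 k2" "surface_boundary D2 = h2 ` sphere 0 1"
    using disc_parametrization[OF D(2)] .
  have sub: "sphere 0 1 \<subseteq> cball (0::complex) 1" by auto
  have k1: "continuous_on (path_image c1) k1" "inj_on k1 D1" "k1 ` path_image c1 = sphere 0 1" "path_image c1 \<subseteq> D1"
    using h1 sub unfolding homeomorphism_def c1(3)
    by (auto intro: continuous_on_subset inj_on_inverseI[where g=h1] simp: surface_boundary_def image_image subset_iff)
  have k2: "continuous_on (path_image c2) k2" "inj_on k2 D2" "k2 ` path_image c2 = sphere 0 1" "path_image c2 \<subseteq> D2"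
    using h2 sub unfolding homeomorphism_def c2(3)
    by (auto intro: continuous_on_subset inj_on_inverseI[where g=h2] simp: surface_boundary_def image_image subset_iff)
  have co1: "continuous_on {0..1} (k1 \<circ> c1)"
    using c1 k1 unfolding path_image_def by (intro continuous_on_compose) (auto simp: simple_path_def path_def)
  have co2: "continuous_on {0..1} (k2 \<circ> c2)"
    using c2 k2 unfolding path_image_def by (intro continuous_on_compose) (auto simp: simple_path_def path_def)
  have eq: "(k1 \<circ> c1) x = (k1 \<circ> c1) y \<longleftrightarrow> (k2 \<circ> c2) x = (k2 \<circ> c2) y" if "x \<in> {0..1}" "y \<in> {0..1}" for x y
  proof -
    have "c1 x \<in> D1" "c1 y \<in> D1" using k1(4) that by (auto simp: path_image_def)
    moreover have "c2 x \<in> D2" "c2 y \<in> D2" using k2(4) that by (auto simp: path_image_def)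
    ultimately show ?thesis
      using loop_eq_iff[OF c1(1,2) that] loop_eq_iff[OF c2(1,2) that] k1(2) k2(2)
      by (simp add: inj_on_eq_iff)
  qed
  obtain \<theta> \<theta>' where th: "homeomorphism ((k1 \<circ> c1) ` {0..1}) ((k2 \<circ> c2) ` {0..1}) \<theta> \<theta>'"
    and thc: "\<And>x. x \<in> {0..1} \<Longrightarrow> \<theta> ((k1 \<circ> c1) x) = (k2 \<circ> c2) x"
    using compatible_maps_homeomorphism[OF compact_Icc co1 co2 eq] by blast
  have im1: "(k1 \<circ> c1) ` {0..1} = sphere 0 1" and im2: "(k2 \<circ> c2) ` {0..1} = sphere 0 1"
    using k1(3) k2(3) by (auto simp: path_image_def image_comp)
  obtain \<Theta> where T: "continuous_on (cball 0 1) \<Theta>" "inj_on \<Theta> (cball 0 1)" "\<Theta> ` cball 0 1 = cball 0 1"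
    "\<And>z. z \<in> sphere 0 1 \<Longrightarrow> \<Theta> z = \<theta> z"
    using cone_extension[of \<theta>] th unfolding im1 im2 homeomorphism_def
    by (metis inj_on_def)
  define H where "H = h2 \<circ> \<Theta> \<circ> k1"
  have k1D: "continuous_on D1 k1" "k1 ` D1 = cball 0 1" using h1 by (auto simp: homeomorphism_def)
  have h2D: "continuous_on (cball 0 1) h2" "h2 ` cball 0 1 = D2" "inj_on h2 (cball 0 1)"
    using h2 by (auto simp: homeomorphism_def intro: inj_on_inverseI[where g=k2])
  show thesis
  proof (rule that)
    show "continuous_on D1 H" unfolding H_def
      using k1D T h2D by (intro continuous_on_compose) (auto simp: image_comp[symmetric])
    show "inj_on H D1" unfolding H_def
      using k1D k1(2) T h2D by (intro comp_inj_on) (auto simp: image_comp[symmetric])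
    show "H ` D1 = D2" unfolding H_def
      using k1D T h2D by (metis image_comp)
    fix t :: real assume t: "t \<in> {0..1}"
    then have "k1 (c1 t) \<in> sphere 0 1" using im1 by auto
    then have "H (c1 t) = h2 (\<theta> (k1 (c1 t)))" using T by (simp add: H_def)
    also have "\<dots> = h2 (k2 (c2 t))" using thc[OF t] by simp
    also have "\<dots> = c2 t" using homeomorphism_apply2[OF h2(1)] k2(4) t by (simp add: path_image_def image_subset_iff)
    finally show "H (c1 t) = c2 t" .
  qed
qed

abbreviation unit_square :: "complex set" where
  "unit_square \<equiv> cbox 0 (Complex 1 1)"

abbreviation bottom_side :: "(complex \<Rightarrow> 'a) \<Rightarrow> 'a set" where
  "bottom_side H \<equiv> (\<lambda>x. H (Complex x 0)) ` {0..1}"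

abbreviation top_side :: "(complex \<Rightarrow> 'a) \<Rightarrow> 'a set" where
  "top_side H \<equiv> (\<lambda>x. H (Complex x 1)) ` {0..1}"

lemma is_disc_unit_square: "is_disc unit_square"
  unfolding is_disc_def
proof (rule homeomorphic_convex_compact_cball)
  have "Complex (1/2) (1/2) \<in> box 0 (Complex 1 1)" by (simp add: in_box_complex_iff)
  then show "interior unit_square \<noteq> {}" by (metis empty_iff interior_cbox)
qed auto

lemma surface_boundary_unit_square:
  "surface_boundary unit_square = path_image (rectpath 0 (Complex 1 1))"
proof -
  have "z \<in> surface_boundary unit_square \<longleftrightarrow> z \<notin> box 0 (Complex 1 1)" if "z \<in> unit_square" for z
    using chart_surface_boundary[OF homeomorphism_ident openin_subtopology_self that] by (simp add: interior_cbox)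
  moreover have "surface_boundary unit_square \<subseteq> unit_square" by (auto simp: surface_boundary_def)
  ultimately show ?thesis by (subst path_image_rectpath_cbox_minus_box) auto
qed

text \<open>
  The joined loop is matched with the boundary of the unit square, traversed anticlockwise from the
  origin. The top side is then traversed from right to left, which is why \<open>s2\<close> is reversed.
\<close>

lemma disc_square_chart_of_joined_loop:
  fixes D :: "'a::t2_space set"
  assumes D: "is_disc D"
    and j: "pathfinish s1 = pathstart d1" "pathfinish d1 = pathstart s2" "pathfinish s2 = pathstart d2"
    and c: "simple_path (s1 +++ d1 +++ s2 +++ d2)" "pathfinish d2 = pathstart s1"
      "path_image (s1 +++ d1 +++ s2 +++ d2) = surface_boundary D"
  obtains H where "continuous_on unit_square H" "inj_on H unit_square" "H ` unit_square = D"
    "\<And>x. x \<in> {0..1} \<Longrightarrow> H (Complex x 0) = s1 x" "\<And>x. x \<in> {0..1} \<Longrightarrow> H (Complex x 1) = s2 (1 - x)"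
proof -
  define c where "c = s1 +++ d1 +++ s2 +++ d2"
  have c0: "pathfinish c = pathstart c" using c by (simp add: c_def)
  have r: "simple_path (rectpath 0 (Complex 1 1))" by simp
  have r': "pathfinish (rectpath 0 (Complex 1 1)) = pathstart (rectpath 0 (Complex 1 1))" by simp
  obtain H where H: "continuous_on unit_square H" "inj_on H unit_square" "H ` unit_square = D"
    "\<And>t. t \<in> {0..1} \<Longrightarrow> H (rectpath 0 (Complex 1 1) t) = c t"
    using disc_homeomorphism_extending_loops[OF is_disc_unit_square D r r' surface_boundary_unit_square[symmetric]
      c(1)[folded c_def] c0 c(3)[folded c_def]] by blast
  show thesis
  proof (rule that[OF H(1-3)])
    fix x :: real assume x: "x \<in> {0..1}"
    have "rectpath 0 (Complex 1 1) (x/2) = Complex x 0"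
      using x by (simp add: rectpath_def Let_def joinpaths_def linepath_def complex_eq_iff)
    moreover have "c (x/2) = s1 x" using x by (simp add: c_def joinpaths_def)
    ultimately show "H (Complex x 0) = s1 x" using H(4)[of "x/2"] x by simp
    \<comment> \<open>In nested joins of four paths, the third path occupies the parameters from 3/4 to 7/8.\<close>
    define y where "y = 1 - x"
    have y: "0 \<le> y" "y \<le> 1" using x by (auto simp: y_def)
    have "rectpath 0 (Complex 1 1) (3/4 + y/8) = Complex x 1"
      using y by (auto simp: rectpath_def Let_def joinpaths_def linepath_def complex_eq_iff y_def field_simps)
    moreover have "c (3/4 + y/8) = s2 y"
      using y j by (auto simp: c_def joinpaths_def field_simps pathfinish_def pathstart_def)
    ultimately show "H (Complex x 1) = s2 (1 - x)" using H(4)[of "3/4 + y/8"] y unfolding y_def[symmetric] by simp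
  qed
qed

definition subarc :: "(real \<Rightarrow> 'a) \<Rightarrow> real \<Rightarrow> real \<Rightarrow> real \<Rightarrow> 'a" where
  "subarc c u v t = c (u + t * (v - u))"

lemma subarc_ends [simp]: "pathstart (subarc c u v) = c u" "pathfinish (subarc c u v) = c v"
  by (simp_all add: subarc_def pathstart_def pathfinish_def)

lemma path_image_subarc: "u \<le> v \<Longrightarrow> path_image (subarc c u v) = c ` {u..v}"
proof -
  assume "u \<le> v"
  have "path_image (subarc c u v) = c ` ((\<lambda>t. u + t * (v - u)) ` {0..1})"
    by (simp add: path_image_def subarc_def image_image)
  also have "(\<lambda>t. u + t * (v - u)) ` {0..1} = {u..v}"
    using \<open>u \<le> v\<close> image_affinity_atLeastAtMost[of "v - u" u 0 "1::real"] by (simp add: mult.commute add.commute)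
  finally show ?thesis .
qed

lemma arc_subarc:
  assumes c: "simple_path c" "pathfinish c = pathstart c" and o: "0 \<le> u" "u < v" "v \<le> 1" "0 < u \<or> v < 1"
  shows "arc (subarc c u v)"
proof -
  have mem: "u + t * (v - u) \<in> {u..v}" if "t \<in> {0..1}" for t
  proof -
    have "t * (v - u) \<le> v - u" using that o by (intro mult_left_le_one_le) auto
    moreover have "0 \<le> t * (v - u)" using that o by (intro mult_nonneg_nonneg) auto
    ultimately show ?thesis by simp
  qed
  have sub: "(\<lambda>t. u + t * (v - u)) ` {0..1} \<subseteq> {0..1}"
  proof (rule image_subsetI)
    fix t :: real assume "t \<in> {0..1}"
    from mem[OF this] o show "u + t * (v - u) \<in> {0..1}" by auto
  qed
  have "continuous_on {0..1} c" using c(1) by (simp add: simple_path_def path_def)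
  then have "continuous_on {0..1} (subarc c u v)"
    unfolding subarc_def
    by (rule continuous_on_compose2[OF _ _ sub]) (intro continuous_intros)
  moreover have "inj_on (subarc c u v) {0..1}"
  proof (rule inj_onI)
    fix x y assume xy: "x \<in> {0..1}" "y \<in> {0..1}" and "subarc c u v x = subarc c u v y"
    moreover have "p = q" if "p \<in> {u..v}" "q \<in> {u..v}" "c p = c q" for p q
      using loop_eq_iff[OF c, of p q] that o by auto
    ultimately have "u + x * (v - u) = u + y * (v - u)"
      using mem[OF xy(1)] mem[OF xy(2)] unfolding subarc_def by blast
    then show "x = y" using o by simp
  qed
  ultimately show ?thesis by (simp add: arc_def path_def)
qed

lemma disc_square_chart_origin:
  fixes D :: "'a::t2_space set"
  assumes D: "is_disc D"
    and c: "simple_path c" "pathfinish c = pathstart c" "path_image c = surface_boundary D"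
    and o: "0 < r" "r < l'" "l' < r'" "r' < 1"
    and s1: "arc s1" "pathstart s1 = c 0" "pathfinish s1 = c r" "path_image s1 = c ` {0..r}"
    and s2: "arc s2" "pathstart s2 = c l'" "pathfinish s2 = c r'" "path_image s2 = c ` {l'..r'}"
  obtains H where "continuous_on unit_square H" "inj_on H unit_square" "H ` unit_square = D"
    "\<And>x. x \<in> {0..1} \<Longrightarrow> H (Complex x 0) = s1 x" "\<And>x. x \<in> {0..1} \<Longrightarrow> H (Complex x 1) = s2 (1 - x)"
proof -
  define d1 where "d1 = subarc c r l'"
  define d2 where "d2 = subarc c r' 1"
  note eq = loop_eq_iff[OF c(1,2)]
  have i1: "path_image d1 = c ` {r..l'}" and i2: "path_image d2 = c ` {r'..1}"
    using o by (auto simp: d1_def d2_def path_image_subarc)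
  have e1: "pathstart d1 = c r" "pathfinish d1 = c l'" by (auto simp: d1_def)
  have e2: "pathstart d2 = c r'" "pathfinish d2 = c 0" using c(2) unfolding pathfinish_def[of c] pathstart_def[of c] by (simp_all add: d2_def)
  have a1: "arc d1" and a2: "arc d2"
    unfolding d1_def d2_def using o c(1,2) by (auto intro!: arc_subarc)
  have A2: "arc (s2 +++ d2)"
  proof (rule arc_join[OF s2(1) a2])
    show "path_image s2 \<inter> path_image d2 \<subseteq> {pathstart d2}"
      using o by (auto simp: s2 i2 e2 eq)
  qed (simp add: s2 e2)
  have I2: "path_image (s2 +++ d2) = c ` {l'..1}"
  proof -
    have "{l'..r'} \<union> {r'..1} = {l'..1}" using o by auto
    then show ?thesis by (subst path_image_join) (auto simp: s2 e2 i2 image_Un[symmetric])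
  qed
  have A1: "arc (d1 +++ s2 +++ d2)"
  proof (rule arc_join[OF a1 A2])
    show "path_image d1 \<inter> path_image (s2 +++ d2) \<subseteq> {pathstart (s2 +++ d2)}"
      unfolding I2 i1 using o by (auto simp: s2 eq)
  qed (simp add: s2 e1)
  have I1: "path_image (d1 +++ s2 +++ d2) = c ` {r..1}"
  proof -
    have "{r..l'} \<union> {l'..1} = {r..1}" using o by auto
    then show ?thesis by (subst path_image_join) (auto simp: e1 s2 I2 i1 image_Un[symmetric])
  qed
  have S: "simple_path (s1 +++ d1 +++ s2 +++ d2)"
  proof (rule simple_path_join_loop[OF s1(1) A1])
    show "path_image s1 \<inter> path_image (d1 +++ s2 +++ d2) \<subseteq> {pathstart s1, pathstart (d1 +++ s2 +++ d2)}"
      unfolding I1 s1 using o by (auto simp: e1 eq)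
  qed (simp_all add: s1 e1 e2)
  have I: "path_image (s1 +++ d1 +++ s2 +++ d2) = surface_boundary D"
  proof -
    have "{0..r} \<union> {r..1} = {0..1}" using o by auto
    then show ?thesis unfolding c(3)[symmetric] path_image_def[of c]
      by (subst path_image_join) (auto simp: e1 s1 I1 image_Un[symmetric])
  qed
  show thesis
    by (rule disc_square_chart_of_joined_loop[OF D _ _ _ S _ I]) (auto simp: s1 s2 e1 e2 intro: that)
qed

text \<open>
  The base point of the loop is moved to the start of the first arc.
\<close>

lemma disc_square_chart:
  fixes D :: "'a::t2_space set"
  assumes D: "is_disc D"
    and c: "simple_path c" "pathfinish c = pathstart c" "path_image c = surface_boundary D"
    and o: "0 \<le> l" "l < r" "r < l'" "l' < r'" "r' < 1"
    and s1: "arc s1" "pathstart s1 = c l" "pathfinish s1 = c r" "path_image s1 = c ` {l..r}"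
    and s2: "arc s2" "pathstart s2 = c l'" "pathfinish s2 = c r'" "path_image s2 = c ` {l'..r'}"
  obtains H where "continuous_on unit_square H" "inj_on H unit_square" "H ` unit_square = D"
    "\<And>x. x \<in> {0..1} \<Longrightarrow> H (Complex x 0) = s1 x" "\<And>x. x \<in> {0..1} \<Longrightarrow> H (Complex x 1) = s2 (1 - x)"
proof -
  define c' where "c' = shiftpath l c"
  have c': "simple_path c'" "pathfinish c' = pathstart c'" "path_image c' = surface_boundary D"
    using c o by (auto simp: c'_def simple_path_shiftpath closed_shiftpath path_image_shiftpath)
  have val: "c' t = c (l + t)" if "l + t \<le> 1" for t using that by (simp add: c'_def shiftpath_def)
  have img: "c' ` {u..v} = c ` {l + u..l + v}" if "l + v \<le> 1" for u v
  proof -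
    have "c' ` {u..v} = (\<lambda>t. c (l + t)) ` {u..v}" using that by (intro image_cong) (auto simp: val)
    also have "\<dots> = c ` ((+) l ` {u..v})" by (simp only: image_image)
    finally show ?thesis by (simp add: add.commute)
  qed
  have "path_image s1 = c' ` {0..r - l}" "path_image s2 = c' ` {l' - l..r' - l}"
    using o img[of "r - l" 0] img[of "r' - l" "l' - l"] by (simp_all add: s1 s2)
  moreover have "c' 0 = c l" "c' (r - l) = c r" "c' (l' - l) = c l'" "c' (r' - l) = c r'"
    using o by (simp_all add: val)
  ultimately have s1': "pathstart s1 = c' 0" "pathfinish s1 = c' (r - l)" "path_image s1 = c' ` {0..r - l}"
    and s2': "pathstart s2 = c' (l' - l)" "pathfinish s2 = c' (r' - l)" "path_image s2 = c' ` {l' - l..r' - l}"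
    using s1 s2 by simp_all
  have o': "0 < r - l" "r - l < l' - l" "l' - l < r' - l" "r' - l < 1" using o by simp_all
  show thesis
    using disc_square_chart_origin[OF D c' o' s1(1) s1' s2(1) s2'] that by blast
qed

section \<open>Gluing two squares; Moebius bands\<close>

text \<open>
  Near the common bottom side, the union of the two discs is the rectangle \<open>[0,1] \<times> [-1,1]\<close>, with the
  second square reflected in the real axis, so of this side only the two ends are boundary points. The
  discs may meet in the top sides as well; there the map from the rectangle fails to be injective, and
  these points are removed before the chart is used.
\<close>

lemma glued_squares_boundary:
  fixes H1 H2 :: "complex \<Rightarrow> 'a::t2_space"
  assumes H1: "continuous_on unit_square H1" "inj_on H1 unit_square"
    and H2: "continuous_on unit_square H2" "inj_on H2 unit_square"
    and S: "S = H1 ` unit_square \<union> H2 ` unit_square \<union> F" and F: "closed F"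
    and bot: "\<And>x. x \<in> {0..1} \<Longrightarrow> H1 (Complex x 0) = H2 (Complex x 0)"
    and top: "top_side H1 = top_side H2"
    and int: "H1 ` unit_square \<inter> H2 ` unit_square \<subseteq> bottom_side H1 \<union> top_side H1"
    and x: "x \<in> {0..1}" "H1 (Complex x 0) \<notin> F"
  shows "H1 (Complex x 0) \<in> surface_boundary S \<longleftrightarrow> x = 0 \<or> x = 1"
proof -
  \<comment> \<open>The two squares side by side along the real axis, the second one reflected.\<close>
  define \<Phi> where "\<Phi> z = (if 0 \<le> Im z then H1 z else H2 (cnj z))" for z
  define Q where "Q = cbox (Complex 0 (-1)) (Complex 1 1)"
  define L where "L = cbox (Complex 0 (-1)) (Complex 1 0)"
  have QL: "Q = unit_square \<union> L" by (auto simp: Q_def L_def in_cbox_complex_iff)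
  have Lc: "cnj z \<in> unit_square" if "z \<in> L" for z using that by (auto simp: L_def in_cbox_complex_iff)
  have Lc': "cnj z \<in> L" if "z \<in> unit_square" for z using that by (auto simp: L_def in_cbox_complex_iff)
  have contL: "continuous_on L (\<lambda>z. H2 (cnj z))"
    by (rule continuous_on_compose2[OF H2(1)]) (auto intro: continuous_intros Lc)
  have cont: "continuous_on Q \<Phi>"
    unfolding QL \<Phi>_def
  proof (rule continuous_on_cases)
    show "\<forall>z. z \<in> unit_square \<and> \<not> 0 \<le> Im z \<or> z \<in> L \<and> 0 \<le> Im z \<longrightarrow> H1 z = H2 (cnj z)"
    proof (intro allI impI)
      fix z assume "z \<in> unit_square \<and> \<not> 0 \<le> Im z \<or> z \<in> L \<and> 0 \<le> Im z"
      then have "z = Complex (Re z) 0" "Re z \<in> {0..1}" by (auto simp: L_def in_cbox_complex_iff complex_eq_iff)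
      then show "H1 z = H2 (cnj z)" using bot[of "Re z"] by (metis complex_cnj minus_zero)
    qed
  qed (auto simp: L_def H1 contL[unfolded L_def])
  define T where "T = top_side H1"
  have T: "closed T"
  proof -
    have "continuous_on {0..1} (\<lambda>x. H1 (Complex x 1))"
      by (rule continuous_on_compose2[OF H1(1)])
        (auto simp: in_cbox_complex_iff intro!: continuous_intros)
    then show ?thesis unfolding T_def using compact_continuous_image compact_imp_closed by blast
  qed
  define U where "U = S - (F \<union> T)"
  have U: "openin (top_of_set S) U"
    unfolding U_def openin_open Diff_eq using open_Compl[OF closed_Un[OF F T]] by blast
  have im: "\<Phi> ` Q = H1 ` unit_square \<union> H2 ` unit_square"
  proof (rule antisym)
    show "\<Phi> ` Q \<subseteq> H1 ` unit_square \<union> H2 ` unit_square"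
      using Lc by (auto simp: \<Phi>_def QL) (auto simp: L_def in_cbox_complex_iff)
    have "H2 z \<in> \<Phi> ` Q" if z: "z \<in> unit_square" for z
    proof (cases "Im z = 0")
      case True
      then have "z = Complex (Re z) 0" "Re z \<in> {0..1}" using z by (auto simp: in_cbox_complex_iff complex_eq_iff)
      then have "\<Phi> z = H2 z" using bot[of "Re z"] by (metis \<Phi>_def True order_refl)
      then show ?thesis using z QL by (metis UnI1 image_eqI)
    next
      case False
      then have "\<Phi> (cnj z) = H2 z" using z by (auto simp: \<Phi>_def in_cbox_complex_iff)
      then show ?thesis using Lc'[OF z] QL by (metis UnI2 image_eqI)
    qed
    moreover have "H1 z \<in> \<Phi> ` Q" if "z \<in> unit_square" for z
      using that by (intro image_eqI[of _ _ z]) (auto simp: \<Phi>_def QL in_cbox_complex_iff)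
    ultimately show "H1 ` unit_square \<union> H2 ` unit_square \<subseteq> \<Phi> ` Q" by auto
  qed
  have mixed: False if h: "z \<in> unit_square" "w \<in> L" "\<not> 0 \<le> Im w" "H1 z = H2 (cnj w)" "H1 z \<notin> T" for z w
  proof -
    have "H1 z \<in> H1 ` unit_square \<inter> H2 ` unit_square"
      using imageI[OF that(1), of H1] imageI[OF Lc[OF that(2)], of H2] that(4) by simp
    from subsetD[OF int this] h(5)
    obtain x' where x': "x' \<in> {0..1}" "H1 z = H1 (Complex x' 0)" unfolding T_def by blast
    then have "H2 (cnj w) = H2 (Complex x' 0)" using bot[of x'] h(4) by simp
    moreover have "Complex x' 0 \<in> unit_square" using x' by (auto simp: in_cbox_complex_iff)
    ultimately have "cnj w = Complex x' 0" using H2(2) Lc[OF that(2)] by (meson inj_onD)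
    then show False using that by (auto simp: complex_eq_iff)
  qed
  have inj: "inj_on \<Phi> (Q \<inter> \<Phi> -` U)"
  proof (rule inj_onI)
    fix z w assume zw: "z \<in> Q \<inter> \<Phi> -` U" "w \<in> Q \<inter> \<Phi> -` U" and e: "\<Phi> z = \<Phi> w"
    have nT: "\<Phi> z \<notin> T" "\<Phi> w \<notin> T" using zw by (auto simp: U_def)
    have sq: "0 \<le> Im z \<Longrightarrow> z \<in> unit_square" "0 \<le> Im w \<Longrightarrow> w \<in> unit_square"
      "\<not> 0 \<le> Im z \<Longrightarrow> z \<in> L" "\<not> 0 \<le> Im w \<Longrightarrow> w \<in> L"
      using zw by (auto simp: Q_def L_def in_cbox_complex_iff)
    consider "0 \<le> Im z" "0 \<le> Im w" | "\<not> 0 \<le> Im z" "\<not> 0 \<le> Im w" | "0 \<le> Im z" "\<not> 0 \<le> Im w"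
      | "\<not> 0 \<le> Im z" "0 \<le> Im w" by blast
    then show "z = w"
    proof cases
      case 1
      then show ?thesis using e sq H1(2) by (simp add: \<Phi>_def inj_on_eq_iff)
    next
      case 2
      then have "H2 (cnj z) = H2 (cnj w)" using e by (simp add: \<Phi>_def)
      then have "cnj z = cnj w" using H2(2) Lc sq 2 by (meson inj_onD)
      then show ?thesis by simp
    next
      case 3
      then show ?thesis using mixed[of z w] sq e nT by (simp add: \<Phi>_def)
    next
      case 4
      then show ?thesis using mixed[of w z] sq e nT by (simp add: \<Phi>_def)
    qed
  qed
  have zQ: "Complex x 0 \<in> Q" using x by (auto simp: Q_def in_cbox_complex_iff)
  have Phz: "\<Phi> (Complex x 0) = H1 (Complex x 0)" by (simp add: \<Phi>_def)
  have "H1 (Complex x 0) \<notin> T"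
  proof
    assume "H1 (Complex x 0) \<in> T"
    then obtain x' where "x' \<in> {0..1}" "H1 (Complex x 0) = H1 (Complex x' 1)" by (auto simp: T_def)
    moreover have "Complex x' 1 \<in> unit_square" "Complex x 0 \<in> unit_square"
      using x calculation by (auto simp: in_cbox_complex_iff)
    ultimately have "Complex x 0 = Complex x' 1" using H1(2) by (meson inj_onD)
    then show False by simp
  qed
  then have zU: "\<Phi> (Complex x 0) \<in> U"
    using x im zQ unfolding U_def S Phz[symmetric] by auto
  have "\<Phi> (Complex x 0) \<in> surface_boundary S \<longleftrightarrow> Complex x 0 \<notin> interior Q"
  proof (rule compact_chart_surface_boundary[OF _ cont U _ _ inj zQ zU])
    show "compact Q" by (simp add: Q_def)
    show "U \<subseteq> \<Phi> ` Q" "\<Phi> ` Q \<subseteq> S" unfolding im by (auto simp: U_def S)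
  qed
  also have "Complex x 0 \<notin> interior Q \<longleftrightarrow> x = 0 \<or> x = 1"
    using x by (auto simp: Q_def interior_cbox in_box_complex_iff)
  finally show ?thesis by (simp add: Phz)
qed

text \<open>
  The band is cut along the common bottom side. The first square becomes the half \<open>u \<le> 1/2\<close> of the
  parameter square and the second one, turned by half a revolution, becomes the half \<open>u \<ge> 1/2\<close>.
\<close>

lemma moebius_bandI:
  fixes H1 H2 :: "complex \<Rightarrow> 'a::t2_space"
  assumes H1: "continuous_on unit_square H1" "inj_on H1 unit_square"
    and H2: "continuous_on unit_square H2" "inj_on H2 unit_square"
    and bot: "\<And>x. x \<in> {0..1} \<Longrightarrow> H1 (Complex x 0) = H2 (Complex x 0)"
    and top: "\<And>x. x \<in> {0..1} \<Longrightarrow> H1 (Complex x 1) = H2 (Complex (1 - x) 1)"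
    and int: "H1 ` unit_square \<inter> H2 ` unit_square \<subseteq> bottom_side H1 \<union> top_side H1"
  shows "moebius_band (H1 ` unit_square \<union> H2 ` unit_square)"
proof -
  define q where "q = (\<lambda>(u, v). if u \<le> 1/2 then H1 (Complex v (2 * u)) else H2 (Complex (1 - v) (2 - 2 * u)))"
  define A where "A = {0..1/2::real} \<times> {0..1::real}"
  define B where "B = {1/2..1::real} \<times> {0..1::real}"
  have AB: "{0..1} \<times> {0..1} = A \<union> B" by (auto simp: A_def B_def)
  have mA: "Complex v (2 * u) \<in> unit_square" if "0 \<le> u" "u \<le> 1/2" "0 \<le> v" "v \<le> 1" for u v
    using that by (auto simp: in_cbox_complex_iff)
  have mB: "Complex (1 - v) (2 - 2 * u) \<in> unit_square" if "1/2 \<le> u" "u \<le> 1" "0 \<le> v" "v \<le> 1" for u v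
    using that by (auto simp: in_cbox_complex_iff)
  have cA: "continuous_on A (\<lambda>p. H1 (Complex (snd p) (2 * fst p)))"
    by (rule continuous_on_compose2[OF H1(1)])
      (auto simp: A_def intro!: continuous_intros mA)
  have cB: "continuous_on B (\<lambda>p. H2 (Complex (1 - snd p) (2 - 2 * fst p)))"
    by (rule continuous_on_compose2[OF H2(1)])
      (auto simp: B_def intro!: continuous_intros mB)
  have cont: "continuous_on ({0..1} \<times> {0..1}) q"
    unfolding AB q_def case_prod_unfold
  proof (rule continuous_on_cases[OF _ _ cA cB])
    show "closed A" "closed B" by (auto simp: A_def B_def intro!: closed_Times)
    show "\<forall>p. p \<in> A \<and> \<not> fst p \<le> 1/2 \<or> p \<in> B \<and> fst p \<le> 1/2 \<longrightarrow>
      H1 (Complex (snd p) (2 * fst p)) = H2 (Complex (1 - snd p) (2 - 2 * fst p))"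
    proof (intro allI impI)
      fix p :: "real \<times> real" assume "p \<in> A \<and> \<not> fst p \<le> 1/2 \<or> p \<in> B \<and> fst p \<le> 1/2"
      then have "2 * fst p = 1" "snd p \<in> {0..1}" by (auto simp: A_def B_def)
      then show "H1 (Complex (snd p) (2 * fst p)) = H2 (Complex (1 - snd p) (2 - 2 * fst p))"
        using top[of "snd p"] by simp
    qed
  qed
  have im: "q ` ({0..1} \<times> {0..1}) = H1 ` unit_square \<union> H2 ` unit_square"
  proof (rule antisym)
    show "q ` ({0..1} \<times> {0..1}) \<subseteq> H1 ` unit_square \<union> H2 ` unit_square"
    proof (clarify)
      fix u v :: real assume uv: "u \<in> {0..1}" "v \<in> {0..1}" "q (u, v) \<notin> H2 ` unit_square"
      then have "u \<le> 1/2" using mB[of u v] by (auto simp: q_def split: if_splits)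
      then show "q (u, v) \<in> H1 ` unit_square" using uv mA[of u v] by (auto simp: q_def)
    qed
    have "H1 z \<in> q ` ({0..1} \<times> {0..1})" if "z \<in> unit_square" for z
      using that by (intro image_eqI[of _ _ "(Im z / 2, Re z)"]) (auto simp: q_def in_cbox_complex_iff)
    moreover have "H2 z \<in> q ` ({0..1} \<times> {0..1})" if z: "z \<in> unit_square" for z
    proof (cases "Im z = 1")
      case True
      then have "H2 z = q (1/2, 1 - Re z)" using z top[of "1 - Re z"]
        by (cases z) (auto simp: q_def in_cbox_complex_iff)
      then show ?thesis using z by (intro image_eqI[of _ _ "(1/2, 1 - Re z)"]) (auto simp: in_cbox_complex_iff)
    next
      case False
      then show ?thesis using z
        by (intro image_eqI[of _ _ "(1 - Im z / 2, 1 - Re z)"]) (auto simp: q_def in_cbox_complex_iff)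
    qed
    ultimately show "H1 ` unit_square \<union> H2 ` unit_square \<subseteq> q ` ({0..1} \<times> {0..1})" by auto
  qed
  have mixed: "u = 0 \<and> u' = 1 \<and> v' = 1 - v"
    if "u \<in> {0..1}" "v \<in> {0..1}" "u' \<in> {0..1}" "v' \<in> {0..1}" "u \<le> 1/2" "\<not> u' \<le> 1/2" "q (u, v) = q (u', v')" for u v u' v'
  proof -
    have e: "H1 (Complex v (2 * u)) = H2 (Complex (1 - v') (2 - 2 * u'))" using that by (simp add: q_def)
    have m1: "Complex v (2 * u) \<in> unit_square" and m2: "Complex (1 - v') (2 - 2 * u') \<in> unit_square"
      using that mA[of u v] mB[of u' v'] by auto
    have "H1 (Complex v (2 * u)) \<in> H1 ` unit_square \<inter> H2 ` unit_square"
      using imageI[OF m1, of H1] imageI[OF m2, of H2] e by simp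
    from subsetD[OF int this]
    obtain x b where xb: "x \<in> {0..1}" "b = 0 \<or> b = 1" "H1 (Complex v (2 * u)) = H1 (Complex x b)" by blast
    moreover have "Complex x b \<in> unit_square" using xb by (auto simp: in_cbox_complex_iff)
    ultimately have "Complex v (2 * u) = Complex x b" using H1(2) m1 by (meson inj_onD)
    then have u: "u = 0 \<or> 2 * u = 1" using xb by auto
    then show ?thesis
    proof
      assume "u = 0"
      then have "H2 (Complex v 0) = H2 (Complex (1 - v') (2 - 2 * u'))" using e bot[of v] that by simp
      moreover have "Complex v 0 \<in> unit_square" using that by (auto simp: in_cbox_complex_iff)
      ultimately have "Complex v 0 = Complex (1 - v') (2 - 2 * u')" using H2(2) m2 by (meson inj_onD)
      then show ?thesis using \<open>u = 0\<close> by auto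
    next
      assume "2 * u = 1"
      then have "H2 (Complex (1 - v) 1) = H2 (Complex (1 - v') (2 - 2 * u'))" using e top[of v] that by simp
      moreover have "Complex (1 - v) 1 \<in> unit_square" using that by (auto simp: in_cbox_complex_iff)
      ultimately have "Complex (1 - v) 1 = Complex (1 - v') (2 - 2 * u')" using H2(2) m2 by (meson inj_onD)
      then show ?thesis using that by auto
    qed
  qed
  have glue: "q (0, v) = q (1, 1 - v)" if "v \<in> {0..1}" for v
    using bot[OF that] by (simp add: q_def)
  have iff: "q (x, y) = q (x', y') \<longleftrightarrow>
             (x = x' \<and> y = y') \<or> (x = 0 \<and> x' = 1 \<and> y' = 1 - y) \<or> (x = 1 \<and> x' = 0 \<and> y' = 1 - y)"
    if m: "x \<in> {0..1}" "y \<in> {0..1}" "x' \<in> {0..1}" "y' \<in> {0..1}" for x y x' y'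
  proof
    assume e: "q (x, y) = q (x', y')"
    consider "x \<le> 1/2" "x' \<le> 1/2" | "\<not> x \<le> 1/2" "\<not> x' \<le> 1/2" | "x \<le> 1/2" "\<not> x' \<le> 1/2" | "\<not> x \<le> 1/2" "x' \<le> 1/2"
      by blast
    then show "(x = x' \<and> y = y') \<or> (x = 0 \<and> x' = 1 \<and> y' = 1 - y) \<or> (x = 1 \<and> x' = 0 \<and> y' = 1 - y)"
    proof cases
      case 1
      then have "Complex y (2 * x) = Complex y' (2 * x')"
        using e m mA[of x y] mA[of x' y'] by (intro inj_onD[OF H1(2)]) (auto simp: q_def)
      then show ?thesis by simp
    next
      case 2
      then have "Complex (1 - y) (2 - 2 * x) = Complex (1 - y') (2 - 2 * x')"
        using e m mB[of x y] mB[of x' y'] by (intro inj_onD[OF H2(2)]) (auto simp: q_def)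
      then show ?thesis by simp
    next
      case 3
      then show ?thesis using mixed[of x y x' y'] m e by auto
    next
      case 4
      then show ?thesis using mixed[of x' y' x y] m e by auto
    qed
  next
    assume "(x = x' \<and> y = y') \<or> (x = 0 \<and> x' = 1 \<and> y' = 1 - y) \<or> (x = 1 \<and> x' = 0 \<and> y' = 1 - y)"
    then consider "x = x'" "y = y'" | "x = 0" "x' = 1" "y' = 1 - y" | "x = 1" "x' = 0" "y = 1 - y'" by force
    then show "q (x, y) = q (x', y')"
    proof cases
      case 2
      then show ?thesis using glue[OF m(2)] by simp
    next
      case 3
      then show ?thesis using glue[OF m(4)] by simp
    qed simp
  qed
  show ?thesis unfolding moebius_band_def by (intro exI[of _ q] conjI ballI cont im iff)
qed

text \<open>
  Charts of the band without one cross-cut, once cut at parameter 0 and once at 1/2, show that the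
  boundary is the image of the two horizontal sides of the square. These meet in the point
  \<open>q (1, 0) = q (0, 1)\<close>.
\<close>

lemma connected_boundary_moebius_band:
  fixes M :: "'a::t2_space set"
  assumes "moebius_band M"
  shows "connected (surface_boundary M)"
proof -
  obtain q :: "real \<times> real \<Rightarrow> 'a" where cont: "continuous_on ({0..1} \<times> {0..1}) q" and im: "q ` ({0..1} \<times> {0..1}) = M"
    and iff: "\<And>x y x' y'. x \<in> {0..1} \<Longrightarrow> y \<in> {0..1} \<Longrightarrow> x' \<in> {0..1} \<Longrightarrow> y' \<in> {0..1} \<Longrightarrow>
           q (x, y) = q (x', y') \<longleftrightarrow>
             (x = x' \<and> y = y') \<or> (x = 0 \<and> x' = 1 \<and> y' = 1 - y) \<or> (x = 1 \<and> x' = 0 \<and> y' = 1 - y)"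
    using assms unfolding moebius_band_def by blast
  have clos: "closed (q ` ({c} \<times> {0..1}))" if "c \<in> {0..1}" for c
    using that by (intro compact_imp_closed compact_continuous_image continuous_on_subset[OF cont] compact_Times) auto
  have opn: "openin (top_of_set M) (M - q ` ({c} \<times> {0..1}))" if "c \<in> {0..1}" for c
    using clos[OF that] by (metis Diff_eq open_Compl openin_open)
  have bd: "q (x, y) \<in> surface_boundary M \<longleftrightarrow> y = 0 \<or> y = 1" if "x \<in> {0<..<1}" "y \<in> {0..1}" for x y
  proof -
    define \<Phi> where "\<Phi> z = q (Re z, Im z)" for z
    have "\<Phi> (Complex x y) \<in> surface_boundary M \<longleftrightarrow> Complex x y \<notin> interior unit_square"
    proof (rule compact_chart_surface_boundary[OF _ _ opn[of 0]])
      show "continuous_on unit_square \<Phi>" unfolding \<Phi>_def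
        by (rule continuous_on_compose2[OF cont]) (auto simp: in_cbox_complex_iff intro!: continuous_intros)
      have "\<Phi> ` unit_square = M"
      proof (rule antisym)
        show "\<Phi> ` unit_square \<subseteq> M" unfolding im[symmetric] by (auto simp: \<Phi>_def in_cbox_complex_iff)
        have "q (u, v) \<in> \<Phi> ` unit_square" if "u \<in> {0..1}" "v \<in> {0..1}" for u v
          using that by (intro image_eqI[of _ _ "Complex u v"]) (auto simp: \<Phi>_def in_cbox_complex_iff)
        then show "M \<subseteq> \<Phi> ` unit_square" unfolding im[symmetric] by auto
      qed
      then show "M - q ` ({0} \<times> {0..1}) \<subseteq> \<Phi> ` unit_square" "\<Phi> ` unit_square \<subseteq> M" by auto
      show "inj_on \<Phi> (unit_square \<inter> \<Phi> -` (M - q ` ({0} \<times> {0..1})))"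
      proof (rule inj_onI)
        fix z w assume z: "z \<in> unit_square \<inter> \<Phi> -` (M - q ` ({0} \<times> {0..1}))"
          and w: "w \<in> unit_square \<inter> \<Phi> -` (M - q ` ({0} \<times> {0..1}))" and e: "\<Phi> z = \<Phi> w"
        have "Re z \<noteq> 0" "Re w \<noteq> 0" using z w by (auto simp: \<Phi>_def in_cbox_complex_iff)
        then show "z = w" using z w e iff[of "Re z" "Im z" "Re w" "Im w"]
          by (auto simp: \<Phi>_def in_cbox_complex_iff complex_eq_iff)
      qed
      show "Complex x y \<in> unit_square" using that by (auto simp: in_cbox_complex_iff)
      show "\<Phi> (Complex x y) \<in> M - q ` ({0} \<times> {0..1})"
      proof -
        have "q (x, y) \<noteq> q (0, b)" if "b \<in> {0..1}" for b
          using iff[of x y 0 b] that \<open>x \<in> {0<..<1}\<close> \<open>y \<in> {0..1}\<close> by auto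
        then have "q (x, y) \<notin> q ` ({0} \<times> {0..1})" by blast
        moreover have "q (x, y) \<in> M" using that by (auto simp: im[symmetric])
        ultimately show ?thesis by (simp add: \<Phi>_def)
      qed
    qed auto
    then show ?thesis using that by (auto simp: \<Phi>_def interior_cbox in_box_complex_iff)
  qed
  have bd1: "q (1, y) \<in> surface_boundary M \<longleftrightarrow> y = 0 \<or> y = 1" if "y \<in> {0..1}" for y
  proof -
    define \<Phi> where "\<Phi> z = (if Re z \<le> 1 then q (Re z, Im z) else q (Re z - 1, 1 - Im z))" for z
    define L where "L = cbox (Complex (1/2) 0) (Complex 1 1)"
    define R where "R = cbox (Complex 1 0) (Complex (3/2) 1)"
    define Q where "Q = L \<union> R"
    have Q: "Q = cbox (Complex (1/2) 0) (Complex (3/2) 1)"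
      by (auto simp: Q_def L_def R_def in_cbox_complex_iff)
    have "\<Phi> (Complex 1 y) \<in> surface_boundary M \<longleftrightarrow> Complex 1 y \<notin> interior Q"
    proof (rule compact_chart_surface_boundary[OF _ _ opn[of "1/2"]])
      show "compact Q" by (simp add: Q)
      show "continuous_on Q \<Phi>" unfolding Q_def \<Phi>_def
      proof (rule continuous_on_cases)
        show "continuous_on L (\<lambda>z. q (Re z, Im z))"
          by (rule continuous_on_compose2[OF cont]) (auto simp: L_def in_cbox_complex_iff intro!: continuous_intros)
        show "continuous_on R (\<lambda>z. q (Re z - 1, 1 - Im z))"
          by (rule continuous_on_compose2[OF cont]) (auto simp: R_def in_cbox_complex_iff intro!: continuous_intros)
        show "\<forall>z. z \<in> L \<and> \<not> Re z \<le> 1 \<or> z \<in> R \<and> Re z \<le> 1 \<longrightarrow> q (Re z, Im z) = q (Re z - 1, 1 - Im z)"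
        proof (intro allI impI)
          fix z assume "z \<in> L \<and> \<not> Re z \<le> 1 \<or> z \<in> R \<and> Re z \<le> 1"
          then have "Re z = 1" "Im z \<in> {0..1}" by (auto simp: L_def R_def in_cbox_complex_iff)
          then show "q (Re z, Im z) = q (Re z - 1, 1 - Im z)" using iff[of 1 "Im z" 0 "1 - Im z"] by auto
        qed
      qed (auto simp: L_def R_def)
      have "\<Phi> ` Q = M"
      proof (rule antisym)
        show "\<Phi> ` Q \<subseteq> M" unfolding im[symmetric] by (auto simp: \<Phi>_def Q in_cbox_complex_iff)
        show "M \<subseteq> \<Phi> ` Q" unfolding im[symmetric]
        proof (clarify)
          fix u v :: real assume uv: "u \<in> {0..1}" "v \<in> {0..1}"
          consider "1/2 \<le> u" | "u = 0" | "0 < u" "u < 1/2" using uv by force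
          then show "q (u, v) \<in> \<Phi> ` Q"
          proof cases
            case 1
            then show ?thesis using uv by (intro image_eqI[of _ _ "Complex u v"]) (auto simp: \<Phi>_def Q in_cbox_complex_iff)
          next
            case 2
            then show ?thesis using uv iff[of 0 v 1 "1 - v"]
              by (intro image_eqI[of _ _ "Complex 1 (1 - v)"]) (auto simp: \<Phi>_def Q in_cbox_complex_iff)
          next
            case 3
            then show ?thesis using uv
              by (intro image_eqI[of _ _ "Complex (1 + u) (1 - v)"]) (auto simp: \<Phi>_def Q in_cbox_complex_iff)
          qed
        qed
      qed
      then show "M - q ` ({1/2} \<times> {0..1}) \<subseteq> \<Phi> ` Q" "\<Phi> ` Q \<subseteq> M" by auto
      show "inj_on \<Phi> (Q \<inter> \<Phi> -` (M - q ` ({1/2} \<times> {0..1})))"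
      proof (rule inj_onI)
        fix z w assume z: "z \<in> Q \<inter> \<Phi> -` (M - q ` ({1/2} \<times> {0..1}))"
          and w: "w \<in> Q \<inter> \<Phi> -` (M - q ` ({1/2} \<times> {0..1}))" and e: "\<Phi> z = \<Phi> w"
        have ne: "Re z \<noteq> 1/2" "Re w \<noteq> 1/2" "Re z \<noteq> 3/2" "Re w \<noteq> 3/2" using z w by (auto simp: \<Phi>_def Q in_cbox_complex_iff)
        have b: "1/2 \<le> Re z" "Re z \<le> 3/2" "0 \<le> Im z" "Im z \<le> 1" "1/2 \<le> Re w" "Re w \<le> 3/2" "0 \<le> Im w" "Im w \<le> 1"
          using z w by (auto simp: Q in_cbox_complex_iff)
        consider "Re z \<le> 1" "Re w \<le> 1" | "\<not> Re z \<le> 1" "Re w \<le> 1" | "Re z \<le> 1" "\<not> Re w \<le> 1" | "\<not> Re z \<le> 1" "\<not> Re w \<le> 1" by blast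
        then have "Re z = Re w \<and> Im z = Im w"
        proof cases
          case 1
          then show ?thesis using iff[of "Re z" "Im z" "Re w" "Im w"] b ne e by (auto simp: \<Phi>_def)
        next
          case 2
          then show ?thesis using iff[of "Re z - 1" "1 - Im z" "Re w" "Im w"] b ne e by (auto simp: \<Phi>_def)
        next
          case 3
          then show ?thesis using iff[of "Re z" "Im z" "Re w - 1" "1 - Im w"] b ne e by (auto simp: \<Phi>_def)
        next
          case 4
          then show ?thesis using iff[of "Re z - 1" "1 - Im z" "Re w - 1" "1 - Im w"] b ne e by (auto simp: \<Phi>_def)
        qed
        then show "z = w" by (simp add: complex_eq_iff)
      qed
      show "Complex 1 y \<in> Q" using that by (auto simp: Q in_cbox_complex_iff)
      show "\<Phi> (Complex 1 y) \<in> M - q ` ({1/2} \<times> {0..1})"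
      proof -
        have "q (1, y) \<noteq> q (1/2, b)" if "b \<in> {0..1}" for b
          using iff[of 1 y "1/2" b] that \<open>y \<in> {0..1}\<close> by auto
        then have "q (1, y) \<notin> q ` ({1/2} \<times> {0..1})" by blast
        moreover have "q (1, y) \<in> M" using that by (auto simp: im[symmetric])
        ultimately show ?thesis by (simp add: \<Phi>_def)
      qed
    qed auto
    then show ?thesis using that by (auto simp: \<Phi>_def Q interior_cbox in_box_complex_iff)
  qed
  have all: "q (x, y) \<in> surface_boundary M \<longleftrightarrow> y = 0 \<or> y = 1" if "x \<in> {0..1}" "y \<in> {0..1}" for x y
  proof -
    consider "x = 0" | "x = 1" | "x \<in> {0<..<1}" using \<open>x \<in> {0..1}\<close> by force
    then show ?thesis
    proof cases
      case 1
      have "q (0, y) = q (1, 1 - y)" using iff[of 0 y 1 "1 - y"] that by auto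
      then show ?thesis using 1 bd1[of "1 - y"] that by auto
    qed (use bd1 bd that in auto)
  qed
  have "surface_boundary M \<subseteq> M" by (auto simp: surface_boundary_def)
  have "surface_boundary M \<subseteq> q ` ({0..1} \<times> {0}) \<union> q ` ({0..1} \<times> {1})"
  proof
    fix p assume p: "p \<in> surface_boundary M"
    obtain x y where "x \<in> {0..1}" "y \<in> {0..1}" "p = q (x, y)"
      using \<open>surface_boundary M \<subseteq> M\<close> p im by blast
    then show "p \<in> q ` ({0..1} \<times> {0}) \<union> q ` ({0..1} \<times> {1})" using all p by blast
  qed
  moreover have "q ` ({0..1} \<times> {0}) \<union> q ` ({0..1} \<times> {1}) \<subseteq> surface_boundary M"
    using all by auto
  ultimately have eq: "surface_boundary M = q ` ({0..1} \<times> {0}) \<union> q ` ({0..1} \<times> {1})"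
    by (rule antisym)
  have "q (1, 0) = q (0, 1)" using iff[of 1 0 0 1] by auto
  moreover have "q (1, 0) \<in> q ` ({0..1} \<times> {0})" "q (0, 1) \<in> q ` ({0..1} \<times> {1})"
    by (intro imageI; simp)+
  ultimately have "q (1, 0) \<in> q ` ({0..1} \<times> {0}) \<inter> q ` ({0..1} \<times> {1})" by simp
  then have "q ` ({0..1} \<times> {0}) \<inter> q ` ({0..1} \<times> {1}) \<noteq> {}" by blast
  then show ?thesis unfolding eq
    by (intro connected_Un connected_continuous_image continuous_on_subset[OF cont] connected_Times) auto
qed

section \<open>Squares with two prescribed disjoint boundary arcs\<close>

text \<open>
  Away from its base point, the loop is a homeomorphism onto its image. Read in the parameter of the
  loop, the arc is a continuous injection from an interval to the real line, hence monotone.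
\<close>

lemma arc_on_loop_parameter_interval:
  fixes c :: "real \<Rightarrow> 'a::t2_space"
  assumes c: "simple_path c" "pathfinish c = pathstart c"
    and g: "arc g" "path_image g \<subseteq> path_image c" "c 0 \<notin> path_image g"
  obtains l r where "0 < l" "l < r" "r < 1" "path_image g = c ` {l..r}"
    "pathstart g = c l \<and> pathfinish g = c r \<or> pathstart g = c r \<and> pathfinish g = c l"
proof -
  define T where "T = {0..1} \<inter> c -` path_image g"
  have cc: "continuous_on {0..1} c" and cg: "continuous_on {0..1} g" and ig: "inj_on g {0..1}"
    using c g by (auto simp: simple_path_def path_def arc_def)
  have "compact (path_image g)" unfolding path_image_def using cg compact_continuous_image by blast
  then have "closedin (top_of_set {0..1}) T"
    unfolding T_def using cc compact_imp_closed continuous_closedin_preimage by blast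
  then have "compact T" using closedin_compact compact_Icc by blast
  have c1: "c 1 = c 0" using c(2) by (simp add: pathfinish_def pathstart_def)
  have T01: "0 < t \<and> t < 1" if "t \<in> T" for t
    using that g(3) c1 by (cases "t = 0"; cases "t = 1") (auto simp: T_def)
  have "inj_on c T"
  proof (rule inj_onI)
    fix x y assume "x \<in> T" "y \<in> T" "c x = c y"
    then show "x = y" using loop_eq_iff[OF c, of x y] T01[of x] T01[of y] by (auto simp: T_def)
  qed
  moreover have "c ` T = path_image g"
  proof -
    have "c ` T = path_image c \<inter> path_image g" unfolding T_def path_image_def[of c] by blast
    then show ?thesis using g(2) by blast
  qed
  moreover have "continuous_on T c" using cc by (rule continuous_on_subset) (auto simp: T_def)
  ultimately obtain k where k: "homeomorphism T (path_image g) c k"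
    using homeomorphism_compact[OF \<open>compact T\<close>] by blast
  define f where "f = k \<circ> g"
  have cf: "continuous_on {0..1} f" unfolding f_def
    using k cg by (intro continuous_on_compose) (auto simp: homeomorphism_def path_image_def)
  have imf: "f ` {0..1} = T" using k unfolding f_def homeomorphism_def path_image_def by (metis image_comp)
  have kc: "c (f t) = g t" if "t \<in> {0..1}" for t
    using k that by (simp add: f_def homeomorphism_def path_image_def)
  have "inj_on f {0..1}" using kc ig by (metis inj_on_def)
  then have mono: "(f 0 < f x \<and> f x < f 1) \<or> (f 1 < f x \<and> f x < f 0)" if "0 < x" "x < 1" for x
    using continuous_inj_imp_mono[OF that cf] by blast
  obtain l r where lr: "f ` {0..1} = {l..r}" "l \<le> r"
    using continuous_image_closed_interval[OF _ cf] by auto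
  have bound: "l \<le> f x \<and> f x \<le> r" if "x \<in> {0..1}" for x using lr that by auto
  have end_pt: "z = f 0 \<or> z = f 1" if z: "z = l \<or> z = r" for z
  proof -
    have "z \<in> f ` {0..1}" using lr z by auto
    then obtain x where x: "x \<in> {0..1}" "z = f x" by auto
    show ?thesis
    proof (cases "x = 0 \<or> x = 1")
      case False
      then have "0 < x" "x < 1" using x by auto
      then show ?thesis using mono[of x] bound[of 0] bound[of 1] z x by force
    qed (use x in auto)
  qed
  have "f 0 \<noteq> f 1" using \<open>inj_on f {0..1}\<close> by (auto dest: inj_onD)
  then have lr2: "l \<noteq> r" using bound[of 0] bound[of 1] by auto
  have ends: "pathstart g = c (f 0)" "pathfinish g = c (f 1)" using kc by (auto simp: pathstart_def pathfinish_def)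
  show thesis
  proof (rule that)
    show "0 < l" "r < 1" using T01 lr imf by auto
    show "l < r" using lr lr2 by simp
    show "path_image g = c ` {l..r}" using lr imf \<open>c ` T = path_image g\<close> by simp
    show "pathstart g = c l \<and> pathfinish g = c r \<or> pathstart g = c r \<and> pathfinish g = c l"
      using end_pt[of l] end_pt[of r] lr2 ends by auto
  qed
qed

lemma disc_boundary_loop:
  fixes D :: "'a::t2_space set"
  assumes "is_disc D"
  obtains c where "simple_path c" "pathfinish c = pathstart c" "path_image c = surface_boundary D"
proof -
  have "unit_square homeomorphic D"
    using assms is_disc_unit_square unfolding is_disc_def by (metis homeomorphic_sym homeomorphic_trans)
  then obtain h k where hom: "homeomorphism unit_square D h k" by (auto simp: homeomorphic_def)
  have "h z \<in> surface_boundary D \<longleftrightarrow> z \<in> path_image (rectpath 0 (Complex 1 1))" if "z \<in> unit_square" for z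
    using chart_surface_boundary[OF hom openin_subtopology_self that] that
    by (subst path_image_rectpath_cbox_minus_box) (auto simp: interior_cbox)
  moreover have "surface_boundary D \<subseteq> h ` unit_square" using hom by (auto simp: surface_boundary_def homeomorphism_def)
  moreover have sub: "path_image (rectpath 0 (Complex 1 1)) \<subseteq> unit_square"
    by (intro path_image_rectpath_subset_cbox) auto
  ultimately have sb: "surface_boundary D = h ` path_image (rectpath 0 (Complex 1 1))" by blast
  have inj: "inj_on h unit_square" and ch: "continuous_on unit_square h"
    using hom by (auto simp: homeomorphism_def intro: inj_on_inverseI[where g=k])
  have sp: "simple_path (rectpath 0 (Complex 1 1))" by simp
  define c where "c = h \<circ> rectpath 0 (Complex 1 1)"
  show thesis
  proof (rule that)
    show "path_image c = surface_boundary D" by (simp add: c_def sb path_image_compose)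
    show "pathfinish c = pathstart c" by (simp add: c_def pathfinish_compose pathstart_compose)
    have "path c" unfolding c_def using sub ch by (intro path_continuous_image) (auto intro: continuous_on_subset)
    moreover have "loop_free c"
      unfolding loop_free_def
    proof (intro ballI impI)
      fix x y :: real assume xy: "x \<in> {0..1}" "y \<in> {0..1}" and "c x = c y"
      then have "rectpath 0 (Complex 1 1) x = rectpath 0 (Complex 1 1) y"
        using sub by (intro inj_onD[OF inj]) (auto simp: c_def path_image_def)
      then show "x = y \<or> x = 0 \<and> y = 1 \<or> x = 1 \<and> y = 0"
        using sp xy unfolding simple_path_def loop_free_def by blast
    qed
    ultimately show "simple_path c" by (simp add: simple_path_def)
  qed
qed

text \<open>
  The boundary loop is based off both arcs and oriented so that it meets \<open>g1\<close> before \<open>g2\<close>; a reflection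
  of the square then adjusts the direction of \<open>g1\<close>. No freedom is left to adjust the direction of \<open>g2\<close>:
  the two alternatives in the last conclusion are the twisted and the untwisted way to attach a ribbon.
\<close>

lemma disc_square_chart_of_disjoint_arcs:
  fixes D :: "'a::t2_space set"
  assumes D: "is_disc D"
    and g1: "arc g1" "path_image g1 \<subseteq> surface_boundary D"
    and g2: "arc g2" "path_image g2 \<subseteq> surface_boundary D"
    and disj: "path_image g1 \<inter> path_image g2 = {}"
  obtains H where "continuous_on unit_square H" "inj_on H unit_square" "H ` unit_square = D"
    "\<And>x. x \<in> {0..1} \<Longrightarrow> H (Complex x 0) = g1 x"
    "(\<forall>x\<in>{0..1}. H (Complex x 1) = g2 x) \<or> (\<forall>x\<in>{0..1}. H (Complex x 1) = g2 (1 - x))"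
proof -
  note result = that
  obtain c0 where c0: "simple_path c0" "pathfinish c0 = pathstart c0" "path_image c0 = surface_boundary D"
    using disc_boundary_loop[OF D] .
  have cl: "closed (path_image g1)" "closed (path_image g2)"
    using g1 g2 unfolding path_image_def arc_def path_def
    by (meson compact_Icc compact_continuous_image compact_imp_closed)+
  have "\<not> path_image c0 \<subseteq> path_image g1 \<union> path_image g2"
  proof
    assume sub: "path_image c0 \<subseteq> path_image g1 \<union> path_image g2"
    have "connected (path_image c0)"
      using c0(1) unfolding path_image_def simple_path_def path_def by (meson connected_Icc connected_continuous_image)
    moreover have "path_image g1 \<inter> path_image c0 \<noteq> {}" "path_image g2 \<inter> path_image c0 \<noteq> {}"
      using g1 g2 unfolding c0(3) by (metis Int_absorb2 path_image_nonempty)+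
    ultimately show False
      using sub disj cl unfolding connected_closed by blast
  qed
  then obtain t0 where t0: "t0 \<in> {0..1}" "c0 t0 \<notin> path_image g1" "c0 t0 \<notin> path_image g2"
    unfolding path_image_def[of c0] by blast
  define c where "c = shiftpath t0 c0"
  have c: "simple_path c" "pathfinish c = pathstart c" "path_image c = surface_boundary D"
    using c0 t0 by (auto simp: c_def simple_path_shiftpath closed_shiftpath path_image_shiftpath)
  have cs: "c 0 \<notin> path_image g1" "c 0 \<notin> path_image g2"
    using t0 by (auto simp: c_def shiftpath_def)
  have main: thesis
    if c: "simple_path c" "pathfinish c = pathstart c" "path_image c = surface_boundary D"
      and 1: "0 < l1" "l1 < r1" "path_image g1 = c ` {l1..r1}"
          "pathstart g1 = c l1 \<and> pathfinish g1 = c r1 \<or> pathstart g1 = c r1 \<and> pathfinish g1 = c l1"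
      and 2: "l2 < r2" "r2 < 1" "path_image g2 = c ` {l2..r2}"
          "pathstart g2 = c l2 \<and> pathfinish g2 = c r2 \<or> pathstart g2 = c r2 \<and> pathfinish g2 = c l2"
      and lt: "r1 < l2" for c l1 r1 l2 r2
  proof -
    define s1 where "s1 = (if pathstart g1 = c l1 then g1 else reversepath g1)"
    define s2 where "s2 = (if pathstart g2 = c l2 then g2 else reversepath g2)"
    have ne: "c l1 \<noteq> c r1" "c l2 \<noteq> c r2"
      using loop_eq_iff[OF c(1,2), of l1 r1] loop_eq_iff[OF c(1,2), of l2 r2] 1 2 lt by auto
    have s1: "arc s1" "pathstart s1 = c l1" "pathfinish s1 = c r1" "path_image s1 = c ` {l1..r1}"
      using 1 g1 ne by (auto simp: s1_def arc_reversepath)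
    have s2: "arc s2" "pathstart s2 = c l2" "pathfinish s2 = c r2" "path_image s2 = c ` {l2..r2}"
      using 2 g2 ne by (auto simp: s2_def arc_reversepath)
    obtain H where H: "continuous_on unit_square H" "inj_on H unit_square" "H ` unit_square = D"
      "\<And>x. x \<in> {0..1} \<Longrightarrow> H (Complex x 0) = s1 x" "\<And>x. x \<in> {0..1} \<Longrightarrow> H (Complex x 1) = s2 (1 - x)"
      using disc_square_chart[OF D c _ _ _ _ _ s1 s2] 1 2 lt by (metis less_imp_le)
    have s2v: "(\<forall>x\<in>{0..1}. s2 x = g2 x) \<or> (\<forall>x\<in>{0..1}. s2 x = g2 (1 - x))"
      by (auto simp: s2_def reversepath_def)
    show thesis
    proof (cases "s1 = g1")
      case True
      have "(\<forall>x\<in>{0..1}. H (Complex x 1) = g2 x) \<or> (\<forall>x\<in>{0..1}. H (Complex x 1) = g2 (1 - x))"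
        using s2v H(5) by auto
      then show thesis using result[OF H(1-3)] H(4) True by simp
    next
      case False
      then have s1g: "s1 = reversepath g1" by (auto simp: s1_def)
      define r where "r z = Complex (1 - Re z) (Im z)" for z
      have rsq: "r z \<in> unit_square \<longleftrightarrow> z \<in> unit_square" for z by (auto simp: r_def in_cbox_complex_iff)
      have rr: "r (r z) = z" for z by (simp add: r_def)
      have imr: "r ` unit_square = unit_square" using rsq rr by (metis (no_types, lifting) image_eqI subset_antisym image_subsetI subsetI)
      have contr: "continuous_on unit_square r" unfolding r_def by (intro continuous_intros)
      have injr: "inj_on r unit_square" by (metis rr inj_on_def)
      show thesis
      proof (rule result[of "H \<circ> r"])
        show "continuous_on unit_square (H \<circ> r)" using contr H(1) imr by (intro continuous_on_compose) auto
        show "inj_on (H \<circ> r) unit_square" using injr H(2) imr by (intro comp_inj_on) auto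
        show "(H \<circ> r) ` unit_square = D" using imr H(3) by (metis image_comp)
        show "(H \<circ> r) (Complex x 0) = g1 x" if "x \<in> {0..1}" for x
          using H(4)[of "1 - x"] that by (simp add: r_def s1g reversepath_def)
        have "(H \<circ> r) (Complex x 1) = s2 x" if "x \<in> {0..1}" for x
          using H(5)[of "1 - x"] that by (simp add: r_def)
        then show "(\<forall>x\<in>{0..1}. (H \<circ> r) (Complex x 1) = g2 x) \<or> (\<forall>x\<in>{0..1}. (H \<circ> r) (Complex x 1) = g2 (1 - x))"
          using s2v by auto
      qed
    qed
  qed
  obtain l1 r1 where 1: "0 < l1" "l1 < r1" "r1 < 1" "path_image g1 = c ` {l1..r1}"
    "pathstart g1 = c l1 \<and> pathfinish g1 = c r1 \<or> pathstart g1 = c r1 \<and> pathfinish g1 = c l1"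
    using arc_on_loop_parameter_interval[OF c(1,2) g1(1) _ cs(1)] g1 c by metis
  obtain l2 r2 where 2: "0 < l2" "l2 < r2" "r2 < 1" "path_image g2 = c ` {l2..r2}"
    "pathstart g2 = c l2 \<and> pathfinish g2 = c r2 \<or> pathstart g2 = c r2 \<and> pathfinish g2 = c l2"
    using arc_on_loop_parameter_interval[OF c(1,2) g2(1) _ cs(2)] g2 c by metis
  have "r1 < l2 \<or> r2 < l1"
  proof (rule ccontr)
    assume "\<not> (r1 < l2 \<or> r2 < l1)"
    then have "max l1 l2 \<in> {l1..r1} \<inter> {l2..r2}" using 1 2 by auto
    then show False using disj 1 2 by blast
  qed
  then show thesis
  proof
    assume "r1 < l2"
    then show thesis using main[OF c 1(1,2,4,5) 2(2-5)] by blast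
  next
    assume lt: "r2 < l1"
    define c' where "c' = reversepath c"
    have c': "simple_path c'" "pathfinish c' = pathstart c'" "path_image c' = surface_boundary D"
      using c by (auto simp: c'_def simple_path_reversepath)
    have v: "c' (1 - t) = c t" for t by (simp add: c'_def reversepath_def)
    have img: "c ` {u..v} = c' ` {1 - v..1 - u}" for u v
    proof -
      have "c' ` {1 - v..1 - u} = c ` ((\<lambda>t. 1 - t) ` {1 - v..1 - u})"
        by (simp only: image_image c'_def reversepath_def)
      then show ?thesis by simp
    qed
    show thesis
      by (rule main[OF c', of "1 - r1" "1 - l1" "1 - r2" "1 - l2"])
        (use 1 2 lt in \<open>auto simp: v img\<close>)
  qed
qed

section \<open>The boundary of a disc with ribbons attached\<close>

lemma successive_intervals:
  fixes a b :: "nat \<Rightarrow> real"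
  assumes "\<And>k. k < N \<Longrightarrow> a k < b k" and "\<And>k. Suc k < N \<Longrightarrow> b k < a (Suc k)"
  shows "j < k \<Longrightarrow> k < N \<Longrightarrow> b j < a k"
proof (induction k)
  case (Suc k)
  then have "b k < a (Suc k)" using assms(2) by simp
  moreover have "b j \<le> b k" using Suc assms(1)[of k] by (cases "j = k") auto
  ultimately show ?case by simp
qed simp

text \<open>
  A disc \<open>V\<close> with ribbons \<open>R e\<close> for \<open>e \<in> X\<close>. The boundary loop \<open>\<gamma>\<close> of \<open>V\<close> runs through \<open>N\<close> segments, of
  which segment \<open>k\<close> belongs to the edge \<open>lab k\<close>; those of \<open>e\<close> have the numbers \<open>p e\<close> and \<open>q e\<close>. There may
  be segments of edges outside \<open>X\<close>, so that all subsets of the edges of one bouquet can share the same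
  loop. The chart \<open>H e\<close> of a ribbon has the segments as its bottom and top sides; read from left to
  right, these run along \<open>\<gamma>\<close> in the same direction if \<open>tw e\<close> holds and in opposite directions otherwise.
\<close>

locale bouquet_bands =
  fixes V :: "'a::t2_space set" and R :: "'e \<Rightarrow> 'a set" and X :: "'e set"
    and \<gamma> :: "real \<Rightarrow> 'a" and N :: nat and a b :: "nat \<Rightarrow> real" and lab :: "nat \<Rightarrow> 'e"
    and p q :: "'e \<Rightarrow> nat" and H :: "'e \<Rightarrow> complex \<Rightarrow> 'a" and tw :: "'e \<Rightarrow> bool"
  assumes disc: "is_disc V"
    and loop: "simple_path \<gamma>" "pathfinish \<gamma> = pathstart \<gamma>" "path_image \<gamma> = surface_boundary V"
    and ab: "\<And>k. k < N \<Longrightarrow> 0 \<le> a k \<and> a k < b k \<and> b k < 1"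
    and ab_Suc: "\<And>k. Suc k < N \<Longrightarrow> b k < a (Suc k)"
    and fin: "finite X"
    and pq: "\<And>e. e \<in> X \<Longrightarrow> p e < q e \<and> q e < N"
    and lab: "\<And>e k. e \<in> X \<Longrightarrow> k < N \<Longrightarrow> lab k = e \<longleftrightarrow> k = p e \<or> k = q e"
    and disj: "disjoint_family_on R X"
    and VR: "\<And>e. e \<in> X \<Longrightarrow> V \<inter> R e = \<gamma> ` {a (p e)..b (p e)} \<union> \<gamma> ` {a (q e)..b (q e)}"
    and H: "\<And>e. e \<in> X \<Longrightarrow> continuous_on unit_square (H e)" "\<And>e. e \<in> X \<Longrightarrow> inj_on (H e) unit_square"
      "\<And>e. e \<in> X \<Longrightarrow> H e ` unit_square = R e"
    and H_bot: "\<And>e x. e \<in> X \<Longrightarrow> x \<in> {0..1} \<Longrightarrow> H e (Complex x 0) = subarc \<gamma> (a (p e)) (b (p e)) x"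
    and H_top: "\<And>e x. e \<in> X \<Longrightarrow> x \<in> {0..1} \<Longrightarrow>
      H e (Complex x 1) = subarc \<gamma> (a (q e)) (b (q e)) (if tw e then x else 1 - x)"
begin

definition total :: "'a set" where
  "total = V \<union> \<Union> (R ` X)"

text \<open>
  The parameters of the boundary points of the vertex that stay boundary points after the ribbons are
  attached. The ends of the segments are included.
\<close>

definition free_params :: "real set" where
  "free_params = {t \<in> {0..1}. \<forall>k<N. lab k \<in> X \<longrightarrow> \<not> (a k < t \<and> t < b k)}"

definition side :: "'e \<Rightarrow> real \<Rightarrow> 'a set" where
  "side e c = (\<lambda>y. H e (Complex c y)) ` {0..1}"

lemmas loop_eq = loop_eq_iff[OF loop(1,2)]

lemma b_less_a: "j < k \<Longrightarrow> k < N \<Longrightarrow> b j < a k"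
  by (rule successive_intervals[of N a b]) (use ab ab_Suc in auto)

lemma image_subarc: "k < N \<Longrightarrow> (\<lambda>x. subarc \<gamma> (a k) (b k) x) ` {0..1} = \<gamma> ` {a k..b k}"
  using path_image_subarc[of "a k" "b k" \<gamma>] ab[of k] by (simp add: path_image_def)

lemma image_subarc': "k < N \<Longrightarrow> (\<lambda>x. subarc \<gamma> (a k) (b k) (1 - x)) ` {0..1} = \<gamma> ` {a k..b k}"
proof -
  assume k: "k < N"
  have "(\<lambda>x. subarc \<gamma> (a k) (b k) (1 - x)) ` {0..1} = subarc \<gamma> (a k) (b k) ` ((\<lambda>x. 1 - x) ` {0..1})"
    by (simp only: image_image)
  also have "(\<lambda>x::real. 1 - x) ` {0..1} = {0..1}" by simp
  finally show ?thesis using image_subarc[OF k] by simp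
qed

lemma loop_in_V: "t \<in> {0..1} \<Longrightarrow> \<gamma> t \<in> V"
  using loop(3) by (auto simp: path_image_def surface_boundary_def)

lemma compact_V: "compact V"
  using disc unfolding is_disc_def by (metis compact_cball homeomorphic_compactness)

lemma compact_R: "e \<in> X \<Longrightarrow> compact (R e)"
  using H compact_continuous_image by (metis compact_cbox)

lemma closed_Union_R: "Y \<subseteq> X \<Longrightarrow> closed (\<Union> (R ` Y))"
  using fin compact_R by (intro compact_imp_closed compact_UN) (auto intro: finite_subset)

lemma openin_total_minus: "closed F \<Longrightarrow> openin (top_of_set total) (total - F)"
  unfolding openin_open Diff_eq using open_Compl by blast

lemma boundary_off_ribbons:
  assumes "x \<in> V" "x \<notin> \<Union> (R ` X)"
  shows "x \<in> surface_boundary total \<longleftrightarrow> x \<in> path_image \<gamma>"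
proof -
  obtain h k where hk: "homeomorphism (cball (0::complex) 1) V h k" "surface_boundary V = h ` sphere 0 1"
    using disc_parametrization[OF disc] .
  have inj: "inj_on h (cball 0 1)" and co: "continuous_on (cball 0 1) h" and im: "h ` cball 0 1 = V"
    using hk by (auto simp: homeomorphism_def intro: inj_on_inverseI[where g=k])
  obtain z where z: "z \<in> cball 0 1" "x = h z" using assms im by blast
  have "h z \<in> surface_boundary total \<longleftrightarrow> z \<notin> interior (cball 0 1)"
  proof (rule compact_chart_surface_boundary[OF _ co openin_total_minus[OF closed_Union_R[OF order_refl]]])
    show "total - \<Union> (R ` X) \<subseteq> h ` cball 0 1" "h ` cball 0 1 \<subseteq> total" unfolding im by (auto simp: total_def)
    show "inj_on h (cball 0 1 \<inter> h -` (total - \<Union> (R ` X)))" using inj by (rule inj_on_subset) auto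
    show "h z \<in> total - \<Union> (R ` X)" using assms z by (auto simp: total_def)
  qed (use z in auto)
  also have "\<dots> \<longleftrightarrow> z \<in> sphere 0 1" using z by (auto simp: interior_cball)
  also have "\<dots> \<longleftrightarrow> h z \<in> h ` sphere 0 1" using inj z
    by (simp add: inj_on_image_mem_iff[OF inj z(1) sphere_cball])
  finally show ?thesis by (simp add: z loop(3) hk(2))
qed

lemma ribbon_meets_vertex:
  assumes e: "e \<in> X"
  shows "R e \<inter> V \<subseteq> bottom_side (H e) \<union> top_side (H e)"
    and "bottom_side (H e) = \<gamma> ` {a (p e)..b (p e)}"
    and "top_side (H e) = \<gamma> ` {a (q e)..b (q e)}"
proof -
  show 1: "bottom_side (H e) = \<gamma> ` {a (p e)..b (p e)}"
  proof -
    have "bottom_side (H e) = (\<lambda>x. subarc \<gamma> (a (p e)) (b (p e)) x) ` {0..1}"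
      using H_bot[OF e] by (intro image_cong) auto
    then show ?thesis using image_subarc[of "p e"] pq[OF e] by simp
  qed
  show 2: "top_side (H e) = \<gamma> ` {a (q e)..b (q e)}"
  proof -
    have "top_side (H e) = (\<lambda>x. subarc \<gamma> (a (q e)) (b (q e)) (if tw e then x else 1 - x)) ` {0..1}"
      using H_top[OF e] by (intro image_cong) auto
    then show ?thesis using image_subarc[of "q e"] image_subarc'[of "q e"] pq[OF e] by (cases "tw e") simp_all
  qed
  show "R e \<inter> V \<subseteq> bottom_side (H e) \<union> top_side (H e)"
    unfolding 1 2 using VR[OF e] by blast
qed

lemma boundary_off_vertex:
  assumes e: "e \<in> X" and x: "x \<in> R e" "x \<notin> V"
  shows "x \<in> surface_boundary total \<longleftrightarrow> x \<in> side e 0 \<union> side e 1"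
proof -
  define F where "F = V \<union> \<Union> (R ` (X - {e}))"
  have F: "closed F" unfolding F_def using closed_Union_R[of "X - {e}"] compact_V compact_imp_closed by blast
  obtain z where z: "z \<in> unit_square" "x = H e z" using x H(3)[OF e] by blast
  have Im: "Im z \<noteq> 0" "Im z \<noteq> 1"
  proof -
    have "H e (Complex c 0) \<in> V" "H e (Complex c 1) \<in> V" if "c \<in> {0..1}" for c
      using that ribbon_meets_vertex(2,3)[OF e] VR[OF e] by blast+
    moreover have "Re z \<in> {0..1}" using z by (auto simp: in_cbox_complex_iff)
    ultimately have HV: "H e (Complex (Re z) 0) \<in> V" "H e (Complex (Re z) 1) \<in> V" by auto
    show "Im z \<noteq> 0"
    proof
      assume "Im z = 0"
      then have eq: "Complex (Re z) 0 = z" by (simp add: complex_eq_iff)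
      show False using HV(1) unfolding eq using z x by simp
    qed
    show "Im z \<noteq> 1"
    proof
      assume "Im z = 1"
      then have eq: "Complex (Re z) 1 = z" by (simp add: complex_eq_iff)
      show False using HV(2) unfolding eq using z x by simp
    qed
  qed
  have "H e z \<in> surface_boundary total \<longleftrightarrow> z \<notin> interior unit_square"
  proof (rule compact_chart_surface_boundary[OF _ H(1)[OF e] openin_total_minus[OF F]])
    show "total - F \<subseteq> H e ` unit_square" "H e ` unit_square \<subseteq> total" unfolding H(3)[OF e] using e by (auto simp: total_def F_def)
    show "inj_on (H e) (unit_square \<inter> H e -` (total - F))" using H(2)[OF e] by (rule inj_on_subset) auto
    have "x \<notin> R f" if "f \<in> X" "f \<noteq> e" for f
      using disj e that x by (auto simp: disjoint_family_on_def)
    then show "H e z \<in> total - F" using x z e by (auto simp: total_def F_def)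
  qed (use z in auto)
  also have "\<dots> \<longleftrightarrow> Re z = 0 \<or> Re z = 1" using Im z by (auto simp: interior_cbox in_box_complex_iff in_cbox_complex_iff)
  also have "\<dots> \<longleftrightarrow> H e z \<in> side e 0 \<union> side e 1"
  proof
    assume "Re z = 0 \<or> Re z = 1"
    moreover have "H e z \<in> side e (Re z)" unfolding side_def
      using z by (intro image_eqI[of _ _ "Im z"]) (auto simp: in_cbox_complex_iff)
    ultimately show "H e z \<in> side e 0 \<union> side e 1" by auto
  next
    assume "H e z \<in> side e 0 \<union> side e 1"
    then obtain c y where "c = 0 \<or> c = 1" "y \<in> {0..1}" "H e z = H e (Complex c y)" unfolding side_def by blast
    moreover then have "Complex c y \<in> unit_square" by (auto simp: in_cbox_complex_iff)
    ultimately have "z = Complex c y" using H(2)[OF e] z by (meson inj_onD)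
    then show "Re z = 0 \<or> Re z = 1" using \<open>c = 0 \<or> c = 1\<close> by auto
  qed
  finally show ?thesis by (simp add: z)
qed

lemma vertex_square_chart:
  assumes e: "e \<in> X"
  obtains G where "continuous_on unit_square G" "inj_on G unit_square" "G ` unit_square = V"
    "\<And>x. x \<in> {0..1} \<Longrightarrow> G (Complex x 0) = subarc \<gamma> (a (p e)) (b (p e)) x"
    "\<And>x. x \<in> {0..1} \<Longrightarrow> G (Complex x 1) = subarc \<gamma> (a (q e)) (b (q e)) (1 - x)"
    "bottom_side G = \<gamma> ` {a (p e)..b (p e)}"
    "top_side G = \<gamma> ` {a (q e)..b (q e)}"
proof -
  have P: "p e < q e" "p e < N" "q e < N" using pq[OF e] by auto
  have o: "0 \<le> a (p e)" "a (p e) < b (p e)" "b (p e) < a (q e)" "a (q e) < b (q e)" "b (q e) < 1"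
    using ab P b_less_a by auto
  obtain G where G: "continuous_on unit_square G" "inj_on G unit_square" "G ` unit_square = V"
    "\<And>x. x \<in> {0..1} \<Longrightarrow> G (Complex x 0) = subarc \<gamma> (a (p e)) (b (p e)) x"
    "\<And>x. x \<in> {0..1} \<Longrightarrow> G (Complex x 1) = subarc \<gamma> (a (q e)) (b (q e)) (1 - x)"
    by (rule disc_square_chart[OF disc loop o, of "subarc \<gamma> (a (p e)) (b (p e))" "subarc \<gamma> (a (q e)) (b (q e))"])
      (use o loop in \<open>auto intro: that intro!: arc_subarc path_image_subarc\<close>)
  have "bottom_side G = (\<lambda>x. subarc \<gamma> (a (p e)) (b (p e)) x) ` {0..1}"
    "top_side G = (\<lambda>x. subarc \<gamma> (a (q e)) (b (q e)) (1 - x)) ` {0..1}"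
    using G(4,5) by (auto intro!: image_cong)
  then show thesis
    using that[OF G] image_subarc[OF P(2)] image_subarc'[OF P(3)] by simp
qed

text \<open>
  The ribbon and the vertex are glued along both segments of \<open>e\<close>. The first segment is the common bottom
  of the two square charts; for the second one, both squares are turned upside down, and the one of the
  vertex is also reflected if the ribbon is twisted.
\<close>

lemma boundary_on_segment:
  assumes e: "e \<in> X" and c: "c = 0 \<or> c = 1" and x: "x \<in> {0..1}"
  shows "H e (Complex x c) \<in> surface_boundary total \<longleftrightarrow> x = 0 \<or> x = 1"
proof -
  define F where "F = \<Union> (R ` (X - {e}))"
  have F: "closed F" unfolding F_def using closed_Union_R[of "X - {e}"] by blast
  obtain G where G: "continuous_on unit_square G" "inj_on G unit_square" "G ` unit_square = V"
    "\<And>x. x \<in> {0..1} \<Longrightarrow> G (Complex x 0) = subarc \<gamma> (a (p e)) (b (p e)) x"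
    "\<And>x. x \<in> {0..1} \<Longrightarrow> G (Complex x 1) = subarc \<gamma> (a (q e)) (b (q e)) (1 - x)"
    and imG: "bottom_side G = \<gamma> ` {a (p e)..b (p e)}"
      "top_side G = \<gamma> ` {a (q e)..b (q e)}"
    using vertex_square_chart[OF e] by blast
  have S: "total = R e \<union> V \<union> F" using e by (auto simp: total_def F_def)
  have "R e \<inter> F = {}" using disj e by (auto simp: disjoint_family_on_def F_def)
  then have nF: "H e z \<notin> F" if "z \<in> unit_square" for z
    using H(3)[OF e] that by blast
  show ?thesis
    using c
  proof
    assume c: "c = 0"
    show ?thesis unfolding c
    proof (rule glued_squares_boundary[OF H(1,2)[OF e] G(1,2) _ F _ _ _ x])
      show "total = H e ` unit_square \<union> G ` unit_square \<union> F" using S G(3) H(3)[OF e] by simp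
      show "H e (Complex x 0) = G (Complex x 0)" if "x \<in> {0..1}" for x using G(4) H_bot[OF e] that by simp
      show "top_side (H e) = top_side G"
        by (simp only: imG ribbon_meets_vertex(3)[OF e])
      show "H e ` unit_square \<inter> G ` unit_square \<subseteq> bottom_side (H e) \<union> top_side (H e)"
        using ribbon_meets_vertex(1)[OF e] G(3) H(3)[OF e] by simp
      show "H e (Complex x 0) \<notin> F" using x by (intro nF) (auto simp: in_cbox_complex_iff)
    qed
  next
    assume c: "c = 1"
    define r where "r fl z = Complex (if fl then 1 - Re z else Re z) (1 - Im z)" for fl :: bool and z
    have rsq: "r fl z \<in> unit_square \<longleftrightarrow> z \<in> unit_square" for fl z by (auto simp: r_def in_cbox_complex_iff)
    have rr: "r fl (r fl z) = z" for fl z by (simp add: r_def)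
    have imr: "r fl ` unit_square = unit_square" for fl
      using rsq rr by (metis (no_types, lifting) image_eqI subset_antisym image_subsetI subsetI)
    have contr: "continuous_on unit_square (r fl)" for fl unfolding r_def
      by (cases fl) (simp_all, (intro continuous_intros)+)
    have injr: "inj_on (r fl) unit_square" for fl by (metis rr inj_on_def)
    have comp: "continuous_on unit_square (f \<circ> r fl)" "inj_on (f \<circ> r fl) unit_square" "(f \<circ> r fl) ` unit_square = f ` unit_square"
      if "continuous_on unit_square f" "inj_on f unit_square" for f :: "complex \<Rightarrow> 'a" and fl
    proof -
      show "continuous_on unit_square (f \<circ> r fl)"
        using that(1) contr[of fl] imr[of fl] by (intro continuous_on_compose) auto
      show "inj_on (f \<circ> r fl) unit_square"
        using that(2) injr[of fl] imr[of fl] by (intro comp_inj_on) auto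
      show "(f \<circ> r fl) ` unit_square = f ` unit_square" using imr[of fl] by (metis image_comp)
    qed
    have swap: "(\<lambda>x. f (Complex (1 - x) (0::real))) ` {0..1} = bottom_side f" for f :: "complex \<Rightarrow> 'a"
    proof -
      have "(\<lambda>x. f (Complex (1 - x) (0::real))) ` {0..1} = (\<lambda>x. f (Complex x 0)) ` ((\<lambda>x. 1 - x) ` {0..1})"
        by (simp only: image_image)
      then show ?thesis by simp
    qed
    have "(H e \<circ> r False) (Complex x 0) \<in> surface_boundary total \<longleftrightarrow> x = 0 \<or> x = 1"
    proof (rule glued_squares_boundary[OF comp(1,2)[OF H(1,2)[OF e]] comp(1,2)[OF G(1,2), of "tw e"] _ F _ _ _ x])
      show "total = (H e \<circ> r False) ` unit_square \<union> (G \<circ> r (tw e)) ` unit_square \<union> F"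
        unfolding comp(3)[OF H(1,2)[OF e]] comp(3)[OF G(1,2)] using S G(3) H(3)[OF e] by simp
      show "(H e \<circ> r False) (Complex x 0) = (G \<circ> r (tw e)) (Complex x 0)" if "x \<in> {0..1}" for x
        using G(5)[of x] G(5)[of "1 - x"] H_top[OF e that] that by (simp add: r_def)
      show "top_side (H e \<circ> r False) = top_side (G \<circ> r (tw e))"
        using imG(1) ribbon_meets_vertex(2)[OF e] swap[of G] by (cases "tw e") (simp_all add: r_def)
      show "(H e \<circ> r False) ` unit_square \<inter> (G \<circ> r (tw e)) ` unit_square
        \<subseteq> bottom_side (H e \<circ> r False) \<union> top_side (H e \<circ> r False)"
        unfolding comp(3)[OF H(1,2)[OF e]] comp(3)[OF G(1,2)]
        using ribbon_meets_vertex(1)[OF e] G(3) H(3)[OF e] by (simp add: r_def Un_commute)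
      show "(H e \<circ> r False) (Complex x 0) \<notin> F" unfolding o_def
        using x by (intro nF) (auto simp: in_cbox_complex_iff r_def)
    qed
    then show ?thesis by (simp add: r_def c)
  qed
qed

lemma segment_on_ribbon:
  assumes e: "e \<in> X" and k: "k < N" "lab k = e" and t: "t \<in> {a k..b k}"
  obtains x c where "x \<in> {0..1}" "c = 0 \<or> c = 1" "\<gamma> t = H e (Complex x c)" "x = 0 \<or> x = 1 \<longleftrightarrow> t = a k \<or> t = b k"
proof -
  define y where "y = (t - a k) / (b k - a k)"
  have d: "b k - a k > 0" using ab k by simp
  have y: "y \<in> {0..1}" using t d by (auto simp: y_def)
  have g: "\<gamma> t = subarc \<gamma> (a k) (b k) y" using d by (simp add: subarc_def y_def)
  have en: "y = 0 \<longleftrightarrow> t = a k" "y = 1 \<longleftrightarrow> t = b k" using d by (auto simp: y_def)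
  have "k = p e \<or> k = q e" using lab[OF e k(1)] k(2) by simp
  then show thesis
  proof
    assume "k = p e"
    then show thesis using that[of y 0] H_bot[OF e y] y g en by simp
  next
    assume k: "k = q e"
    show thesis
    proof (cases "tw e")
      case True
      then show thesis using that[of y 1] H_top[OF e y] y g en k by simp
    next
      case False
      then show thesis using that[of "1 - y" 1] H_top[OF e, of "1 - y"] y g en k by auto
    qed
  qed
qed

lemma free_params_endpoint:
  assumes "k < N" "t = a k \<or> t = b k"
  shows "t \<in> free_params"
proof -
  have "\<not> (a j < t \<and> t < b j)" if "j < N" for j
    using b_less_a[of j k] b_less_a[of k j] ab[of j] ab[of k] assms that by (cases j k rule: linorder_cases) auto
  then show ?thesis using ab[OF assms(1)] assms(2) by (auto simp: free_params_def)
qed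

lemma side_subset:
  assumes "e \<in> X" "c = 0 \<or> c = 1"
  shows "side e c \<subseteq> R e"
proof -
  have "Complex c y \<in> unit_square" if "y \<in> {0..1}" for y
    using that assms(2) by (auto simp: in_cbox_complex_iff)
  then show ?thesis using H(3)[OF assms(1)] unfolding side_def by blast
qed

text \<open>
  Every point lies in the vertex only, in one ribbon only, or on a segment, and each of these cases has
  its own chart. On a segment exactly the two ends are boundary points, and they belong to both parts
  of the right-hand side.
\<close>

theorem surface_boundary_total:
  "surface_boundary total = \<gamma> ` free_params \<union> (\<Union>e\<in>X. side e 0 \<union> side e 1)" (is "_ = ?A \<union> ?B")
proof -
  have A: "?A \<subseteq> V" using loop_in_V by (auto simp: free_params_def)
  have "x \<in> surface_boundary total \<longleftrightarrow> x \<in> ?A \<union> ?B" if x: "x \<in> total" for x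
  proof -
    consider "x \<in> V" "x \<notin> \<Union> (R ` X)" | e where "e \<in> X" "x \<in> R e" "x \<notin> V" | e where "e \<in> X" "x \<in> R e" "x \<in> V"
      using x by (auto simp: total_def)
    then show ?thesis
    proof cases
      case 1
      have "x \<in> ?A" if xg: "x \<in> path_image \<gamma>"
      proof -
        obtain t where t: "t \<in> {0..1}" "x = \<gamma> t" using xg unfolding path_image_def by blast
        have "\<not> (a k < t \<and> t < b k)" if "k < N" "lab k \<in> X" for k
        proof
          assume "a k < t \<and> t < b k"
          then have "x \<in> \<gamma> ` {a k..b k}" using t by auto
          moreover have "k = p (lab k) \<or> k = q (lab k)" using lab that by blast
          ultimately have "x \<in> R (lab k)" using VR[OF that(2)] by auto
          then show False using 1 that by blast
        qed
        then show ?thesis using t by (auto simp: free_params_def)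
      qed
      moreover have "?A \<subseteq> path_image \<gamma>" by (auto simp: free_params_def path_image_def)
      moreover have "x \<notin> ?B" using side_subset 1 by blast
      ultimately show ?thesis using boundary_off_ribbons[OF 1] by blast
    next
      case 2
      have "x \<in> ?B \<longleftrightarrow> x \<in> side e 0 \<union> side e 1"
      proof
        assume "x \<in> ?B"
        then obtain f where f: "f \<in> X" "x \<in> side f 0 \<union> side f 1" by blast
        then have "x \<in> R f" using side_subset by blast
        then have "f = e" using disj f 2 by (auto simp: disjoint_family_on_def)
        then show "x \<in> side e 0 \<union> side e 1" using f by simp
      qed (use 2 in blast)
      then show ?thesis using boundary_off_vertex[OF 2] A 2 by blast
    next
      case 3
      have "x \<in> \<gamma> ` {a (p e)..b (p e)} \<union> \<gamma> ` {a (q e)..b (q e)}" using VR[OF 3(1)] 3 by blast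
      then obtain k t where k': "k = p e \<or> k = q e" and t: "t \<in> {a k..b k}" "x = \<gamma> t" by blast
      have k: "k < N" using k' pq[OF 3(1)] by auto
      then have k: "k < N" "lab k = e" using k' lab[OF 3(1)] by auto
      obtain y c where y: "y \<in> {0..1}" "c = 0 \<or> c = 1" "\<gamma> t = H e (Complex y c)" "y = 0 \<or> y = 1 \<longleftrightarrow> t = a k \<or> t = b k"
        using segment_on_ribbon[OF 3(1) k t(1)] .
      have sb: "x \<in> surface_boundary total \<longleftrightarrow> t = a k \<or> t = b k"
        using boundary_on_segment[OF 3(1) y(2,1)] y t by simp
      have "x \<in> ?A" if "t = a k \<or> t = b k" using free_params_endpoint[OF k(1) that] t by blast
      moreover have "t = a k \<or> t = b k" if "x \<in> ?A"
      proof -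
        obtain s where s: "s \<in> free_params" "\<gamma> t = \<gamma> s" using \<open>x \<in> ?A\<close> unfolding t(2) by (elim imageE)
        then have "t = s \<or> t = 0" using loop_eq[of t s] ab[OF k(1)] t by (auto simp: free_params_def)
        then show ?thesis
        proof
          assume "t = s"
          then show ?thesis using s t k 3 by (force simp: free_params_def)
        qed (use t ab[OF k(1)] in auto)
      qed
      moreover have "t = a k \<or> t = b k" if "x \<in> ?B"
      proof -
        obtain f where f: "f \<in> X" "x \<in> side f 0 \<union> side f 1" using \<open>x \<in> ?B\<close> by blast
        then have "x \<in> R f" using side_subset by blast
        then have "f = e" using disj f 3 by (auto simp: disjoint_family_on_def)
        then have "x \<in> side e 0 \<union> side e 1" using f by simp
        then obtain c' y' where c': "c' = 0 \<or> c' = 1" "y' \<in> {0..1}" "x = H e (Complex c' y')"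
          unfolding side_def by (elim UnE imageE) auto
        have "Complex c' y' \<in> unit_square" "Complex y c \<in> unit_square"
          using c'(1,2) y(1,2) by (auto simp: in_cbox_complex_iff)
        moreover have "H e (Complex c' y') = H e (Complex y c)" using c'(3) y(3) t(2) by simp
        ultimately have "Complex c' y' = Complex y c" using inj_onD[OF H(2)[OF 3(1)]] by blast
        then show ?thesis using c' y by auto
      qed
      ultimately show ?thesis using sb by blast
    qed
  qed
  moreover have "surface_boundary total \<subseteq> total" by (auto simp: surface_boundary_def)
  moreover have "?A \<union> ?B \<subseteq> total" using A side_subset by (fastforce simp: total_def)
  ultimately show ?thesis by blast
qed

end

section \<open>Connectedness of the boundary as linear algebra over the field with two elements\<close>

text \<open>
  Sums of bits stay sums instead of becoming bit operations, so that the laws of finite sums apply.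
\<close>

declare add_bit_eq_xor [simp del] mult_bit_eq_and [simp del]

lemma bit_add_self [simp]: "(x::bit) + x = 0"
  by (simp flip: mult_2)

lemma bit_add_self_left [simp]: "(x::bit) + (x + y) = y"
  by (simp flip: add.assoc)

lemma bit_add_eq_0_iff: "(x::bit) + y = 0 \<longleftrightarrow> x = y"
proof
  assume "x + y = 0"
  then have "x + (x + y) = x" by simp
  then show "x = y" by simp
qed simp

context bouquet_bands
begin

text \<open>
  The kernel of the principal submatrix of the intersection matrix on \<open>X\<close>. The sum in the row of \<open>e\<close> runs
  over the segments between the two segments of \<open>e\<close>; an edge that does not cross \<open>e\<close> occurs there twice or
  not at all and cancels.
\<close>

definition in_kernel :: "('e \<Rightarrow> bit) \<Rightarrow> bool" where
  "in_kernel v \<longleftrightarrow> (\<forall>e. e \<notin> X \<longrightarrow> v e = 0) \<and>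
     (\<forall>e\<in>X. (\<Sum>k\<in>{p e<..<q e}. v (lab k)) + (if tw e then v e else 0) = 0)"

text \<open>
  Gap \<open>k\<close> is the closed parameter interval before segment \<open>k\<close>, and gap \<open>N\<close> comes after the last
  segment; gaps \<open>0\<close> and \<open>N\<close> join at the base point of the loop.
\<close>

definition gap_start :: "nat \<Rightarrow> real" where
  "gap_start k = (if k = 0 then 0 else b (k - 1))"

definition gap_end :: "nat \<Rightarrow> real" where
  "gap_end k = (if k = N then 1 else a k)"

lemma gap_le: "k \<le> N \<Longrightarrow> gap_start k \<le> gap_end k"
  using ab[of k] ab[of "k - 1"] ab_Suc[of "k - 1"] by (cases k) (auto simp: gap_start_def gap_end_def)

lemma gap_bounds: "k \<le> N \<Longrightarrow> 0 \<le> gap_start k \<and> gap_end k \<le> 1"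
  using ab[of k] ab[of "k - 1"] by (cases k) (auto simp: gap_start_def gap_end_def)

lemma le_gap_start: "j < k \<Longrightarrow> k \<le> N \<Longrightarrow> b j \<le> gap_start k"
  using b_less_a[of j "k - 1"] ab[of "k - 1"] by (cases k; cases "j = k - 1") (auto simp: gap_start_def)

lemma gap_end_le: "k \<le> j \<Longrightarrow> j < N \<Longrightarrow> gap_end k \<le> a j"
  using b_less_a[of k j] ab[of k] by (cases "j = k") (auto simp: gap_end_def)

lemma gap_subset_free: "k \<le> N \<Longrightarrow> {gap_start k..gap_end k} \<subseteq> free_params"
proof
  fix t assume k: "k \<le> N" and t: "t \<in> {gap_start k..gap_end k}"
  have "\<not> (a j < t \<and> t < b j)" if "j < N" for j
    using le_gap_start[of j k] gap_end_le[of k j] that k t by (cases "j < k") auto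
  then show "t \<in> free_params" using gap_bounds[OF k] t by (auto simp: free_params_def)
qed

lemma unused_segment_subset_free: "k < N \<Longrightarrow> lab k \<notin> X \<Longrightarrow> {a k..b k} \<subseteq> free_params"
proof
  fix t assume k: "k < N" "lab k \<notin> X" and t: "t \<in> {a k..b k}"
  have "\<not> (a j < t \<and> t < b j)" if "j < N" "lab j \<in> X" for j
    using b_less_a[of j k] b_less_a[of k j] that k t by (cases j k rule: linorder_cases) auto
  then show "t \<in> free_params" using ab[OF k(1)] t by (auto simp: free_params_def)
qed

lemma gap_or_segment:
  assumes "t \<in> {0..1}"
  obtains k where "k \<le> N" "t \<in> {gap_start k..gap_end k}" | k where "k < N" "t \<in> {a k..b k}"
proof -
  \<comment> \<open>The last gap that starts at or before t: beyond its end only segment k can contain t.\<close>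
  define k where "k = (GREATEST k. k \<le> N \<and> gap_start k \<le> t)"
  have "0 \<le> N \<and> gap_start 0 \<le> t" using assms by (auto simp: gap_start_def)
  then have k: "k \<le> N" "gap_start k \<le> t"
    unfolding k_def using GreatestI_nat[of "\<lambda>k. k \<le> N \<and> gap_start k \<le> t" 0 N] by auto
  have "t < b k" if "k < N"
  proof (rule ccontr)
    assume "\<not> t < b k"
    then have "Suc k \<le> N \<and> gap_start (Suc k) \<le> t" using that by (auto simp: gap_start_def)
    then have "Suc k \<le> k" unfolding k_def by (rule Greatest_le_nat[where b=N]) auto
    then show False by simp
  qed
  moreover have "t \<in> {gap_start k..gap_end k} \<or> k < N \<and> a k < t"
    using k assms by (auto simp: gap_end_def)
  ultimately show thesis using that k(1) by (metis atLeastAtMost_iff less_imp_le)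
qed

lemma free_cases:
  assumes "t \<in> free_params"
  obtains k where "k \<le> N" "t \<in> {gap_start k..gap_end k}" | k where "k < N" "lab k \<notin> X" "t \<in> {a k..b k}"
proof -
  have "t \<in> {0..1}" using assms by (auto simp: free_params_def)
  then show thesis
  proof (cases rule: gap_or_segment)
    case (2 k)
    show thesis
    proof (cases "lab k \<in> X")
      case True
      then consider "t = a k" | "t = b k" using 2 assms by (force simp: free_params_def)
      then show thesis
      proof cases
        case 1
        then have "t \<in> {gap_start k..gap_end k}" using 2 gap_le[of k] by (auto simp: gap_end_def)
        then show thesis using that(1)[of k] 2 by auto
      next
        case at_b: 2
        then have "t \<in> {gap_start (Suc k)..gap_end (Suc k)}" using at_b gap_le[of "Suc k"] 2 by (auto simp: gap_start_def)
        then show thesis using that(1)[of "Suc k"] 2 by auto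
      qed
    qed (use 2 that in blast)
  qed (use that in blast)
qed

lemma side_ends:
  assumes e: "e \<in> X"
  shows "\<gamma> (a (p e)) \<in> side e 0" "\<gamma> (b (p e)) \<in> side e 1"
    "\<gamma> (a (q e)) \<in> side e (if tw e then 0 else 1)" "\<gamma> (b (q e)) \<in> side e (if tw e then 1 else 0)"
proof -
  have in_side: "H e (Complex c 0) \<in> side e c" "H e (Complex c 1) \<in> side e c" for c
    by (auto simp: side_def)
  show "\<gamma> (a (p e)) \<in> side e 0" "\<gamma> (b (p e)) \<in> side e 1"
    using in_side[of 0] in_side[of 1] H_bot[OF e, of 0] H_bot[OF e, of 1] by (simp_all add: subarc_def)
  show "\<gamma> (a (q e)) \<in> side e (if tw e then 0 else 1)" "\<gamma> (b (q e)) \<in> side e (if tw e then 1 else 0)"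
    using in_side[of 0] in_side[of 1] H_top[OF e, of 0] H_top[OF e, of 1] by (cases "tw e"; simp add: subarc_def)+
qed

lemma compact_side: "e \<in> X \<Longrightarrow> c \<in> {0..1} \<Longrightarrow> compact (side e c)"
  and connected_side: "e \<in> X \<Longrightarrow> c \<in> {0..1} \<Longrightarrow> connected (side e c)"
proof -
  assume e: "e \<in> X" and c: "c \<in> {0..1}"
  have co: "continuous_on {0..1} (\<lambda>y. H e (Complex c y))"
    using c by (intro continuous_on_compose2[OF H(1)[OF e]]) (auto simp: in_cbox_complex_iff intro!: continuous_intros)
  show "compact (side e c)" unfolding side_def by (rule compact_continuous_image[OF co compact_Icc])
  show "connected (side e c)" unfolding side_def by (rule connected_continuous_image[OF co connected_Icc])
qed

lemma continuous_loop: "continuous_on {0..1} \<gamma>"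
  using loop(1) by (simp add: simple_path_def path_def)

text \<open>
  A splitting of the boundary into two closed parts is a colouring, whose changes across the segments
  form a vector in the kernel. If this vector vanishes, then the colour is the same on all gaps, and
  every side of a ribbon touches a gap.
\<close>

lemma connected_boundary_if_kernel_trivial:
  assumes triv: "\<And>v e. in_kernel v \<Longrightarrow> v e = 0"
  shows "connected (surface_boundary total)"
proof (rule ccontr)
  define F where "F = surface_boundary total"
  have F: "F = \<gamma> ` free_params \<union> (\<Union>e\<in>X. side e 0 \<union> side e 1)"
    unfolding F_def by (rule surface_boundary_total)
  assume "\<not> connected (surface_boundary total)"
  then obtain A B where AB: "closed A" "closed B" "F \<subseteq> A \<union> B" "A \<inter> B \<inter> F = {}" "A \<inter> F \<noteq> {}" "B \<inter> F \<noteq> {}"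
    unfolding F_def[symmetric] connected_closed by blast
  define col :: "'a \<Rightarrow> bit" where "col x = (if x \<in> A then 1 else 0)" for x
  have const: "col x = col y" if "connected C" "C \<subseteq> F" "x \<in> C" "y \<in> C" for C x y
  proof -
    have "A \<inter> C = {} \<or> B \<inter> C = {}"
      using connected_closedD[OF that(1), of A B] AB that(2) by blast
    then show ?thesis using AB that by (auto simp: col_def)
  qed
  have path: "col (\<gamma> s) = col (\<gamma> t)" if "{u..v} \<subseteq> free_params" "s \<in> {u..v}" "t \<in> {u..v}" for u v s t
  proof (rule const[of "\<gamma> ` {u..v}"])
    have "free_params \<subseteq> {0..1}" by (auto simp: free_params_def)
    then have "{u..v} \<subseteq> {0..1}" using that(1) by (rule subset_trans[rotated])
    then show "connected (\<gamma> ` {u..v})"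
      using continuous_loop by (meson connected_Icc connected_continuous_image continuous_on_subset)
  qed (use that in \<open>auto simp: F\<close>)
  have sides: "col x = col y" if "e \<in> X" "c = 0 \<or> c = 1" "x \<in> side e c" "y \<in> side e c" for e c x y
    by (rule const[of "side e c"]) (use that in \<open>auto simp: F intro!: connected_side\<close>)
  define v where "v e = (if e \<in> X then col (\<gamma> (a (p e))) + col (\<gamma> (b (p e))) else 0)" for e
  have ends: "col (\<gamma> (a (q e))) = col (\<gamma> (if tw e then a (p e) else b (p e)))"
     "col (\<gamma> (b (q e))) = col (\<gamma> (if tw e then b (p e) else a (p e)))" if e: "e \<in> X" for e
  proof -
    have 0: "col y = col (\<gamma> (a (p e)))" if "y \<in> side e 0" for y
      using sides[OF e _ that side_ends(1)[OF e]] by simp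
    have 1: "col y = col (\<gamma> (b (p e)))" if "y \<in> side e 1" for y
      using sides[OF e _ that side_ends(2)[OF e]] by simp
    show "col (\<gamma> (a (q e))) = col (\<gamma> (if tw e then a (p e) else b (p e)))"
      using side_ends(3)[OF e] 0[of "\<gamma> (a (q e))"] 1[of "\<gamma> (a (q e))"] by (cases "tw e") simp_all
    show "col (\<gamma> (b (q e))) = col (\<gamma> (if tw e then b (p e) else a (p e)))"
      using side_ends(4)[OF e] 0[of "\<gamma> (b (q e))"] 1[of "\<gamma> (b (q e))"] by (cases "tw e") simp_all
  qed
  have jump: "col (\<gamma> (b k)) = col (\<gamma> (a k)) + v (lab k)" if k: "k < N" for k
  proof (cases "lab k \<in> X")
    case True
    then have "k = p (lab k) \<or> k = q (lab k)" using lab k by blast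
    then show ?thesis
    proof
      assume "k = p (lab k)"
      then have "v (lab k) = col (\<gamma> (a k)) + col (\<gamma> (b k))" using True by (simp add: v_def)
      then show ?thesis by simp
    next
      assume "k = q (lab k)"
      then have "col (\<gamma> (a k)) = col (\<gamma> (if tw (lab k) then a (p (lab k)) else b (p (lab k))))"
        "col (\<gamma> (b k)) = col (\<gamma> (if tw (lab k) then b (p (lab k)) else a (p (lab k))))"
        using ends[OF True] by simp_all
      then show ?thesis using True by (auto simp: v_def add.commute)
    qed
  next
    case False
    then have "col (\<gamma> (b k)) = col (\<gamma> (a k))"
      using path[OF unused_segment_subset_free[OF k False], of "b k" "a k"] ab[OF k] by auto
    then show ?thesis using False by (simp add: v_def)
  qed
  have gap: "col (\<gamma> (a (Suc k))) = col (\<gamma> (b k))" if "Suc k < N" for k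
    using path[OF gap_subset_free[of "Suc k"], of "a (Suc k)" "b k"] gap_le[of "Suc k"] that by (auto simp: gap_start_def gap_end_def)
  have sum: "j < m \<Longrightarrow> m < N \<Longrightarrow> col (\<gamma> (a m)) = col (\<gamma> (b j)) + (\<Sum>k\<in>{j<..<m}. v (lab k))" for j m
  proof (induction m)
    case (Suc m)
    show ?case
    proof (cases "j = m")
      case True
      then have "{j<..<Suc m} = {}" by auto
      then show ?thesis using gap Suc.prems True by simp
    next
      case False
      then have "j < m" "m < N" using Suc.prems by auto
      moreover have "{j<..<Suc m} = insert m {j<..<m}" using \<open>j < m\<close> by auto
      ultimately show ?thesis using gap Suc jump[of m] by (simp add: algebra_simps)
    qed
  qed simp
  have "in_kernel v"
    unfolding in_kernel_def
  proof (intro conjI allI ballI impI)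
    fix e assume e: "e \<in> X"
    have "(\<Sum>k\<in>{p e<..<q e}. v (lab k)) = col (\<gamma> (b (p e))) + col (\<gamma> (a (q e)))"
      using sum[of "p e" "q e"] pq[OF e] by simp
    also have "\<dots> = (if tw e then v e else 0)"
      using ends(1)[OF e] e by (simp add: v_def add.commute)
    finally show "(\<Sum>k\<in>{p e<..<q e}. v (lab k)) + (if tw e then v e else 0) = 0" by simp
  qed (simp add: v_def)
  then have v0: "v e = 0" for e using triv by blast
  have gaps: "k \<le> N \<Longrightarrow> t \<in> {gap_start k..gap_end k} \<Longrightarrow> col (\<gamma> t) = col (\<gamma> 0)" for k t
  proof (induction k arbitrary: t)
    case 0
    then show ?case using path[OF gap_subset_free[of 0], of t 0] by (auto simp: gap_start_def)
  next
    case (Suc k)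
    have "col (\<gamma> t) = col (\<gamma> (b k))"
      using path[OF gap_subset_free[of "Suc k"], of t "b k"] Suc.prems by (auto simp: gap_start_def)
    also have "\<dots> = col (\<gamma> (a k))" using jump[of k] Suc.prems v0 by simp
    also have "\<dots> = col (\<gamma> 0)" using Suc.IH[of "a k"] Suc.prems gap_le[of k] by (auto simp: gap_end_def)
    finally show ?case .
  qed
  have free: "col (\<gamma> t) = col (\<gamma> 0)" if "t \<in> free_params" for t
    using that
  proof (cases rule: free_cases)
    case (2 k)
    then have "col (\<gamma> t) = col (\<gamma> (a k))"
      using path[OF unused_segment_subset_free[OF 2(1,2)], of t "a k"] by auto
    also have "\<dots> = col (\<gamma> 0)" using gaps[of k "a k"] gap_le[of k] 2 by (auto simp: gap_end_def)
    finally show ?thesis .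
  qed (use gaps in blast)
  have "col x = col (\<gamma> 0)" if xF: "x \<in> F" for x
  proof -
    consider t where "t \<in> free_params" "x = \<gamma> t" | e where "e \<in> X" "x \<in> side e 0" | e where "e \<in> X" "x \<in> side e 1"
      using xF F by blast
    then show ?thesis
    proof cases
      case (1 t)
      then show ?thesis using free by simp
    next
      case (2 e)
      then have "col x = col (\<gamma> (a (p e)))" using sides[of e 0] side_ends(1) by blast
      moreover have "a (p e) \<in> free_params" using free_params_endpoint[of "p e"] pq[OF 2(1)] by auto
      ultimately show ?thesis using free by simp
    next
      case (3 e)
      then have "col x = col (\<gamma> (b (p e)))" using sides[of e 1] side_ends(2) by blast
      moreover have "b (p e) \<in> free_params" using free_params_endpoint[of "p e"] pq[OF 3(1)] by auto
      ultimately show ?thesis using free by simp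
    qed
  qed
  moreover obtain x y where xy: "x \<in> A" "x \<in> F" "y \<in> B" "y \<in> F" using AB by blast
  moreover from this have "col x = 1" "col y = 0" using AB by (auto simp: col_def)
  ultimately show False by (metis zero_neq_one)
qed

text \<open>
  A vector \<open>v\<close> in the kernel colours gap \<open>k\<close> by the sum of \<open>v\<close> over the segments before it. The sum over
  all segments is zero because each edge has two of them, so the colours agree at the base point. The
  rows of the linear system say that the colours at the two ends of each side agree. The two colour
  classes are closed and disjoint, so one of them is empty if the boundary is connected.
\<close>

lemma kernel_trivial_if_connected_boundary:
  assumes conn: "connected (surface_boundary total)" and ker: "in_kernel v"
  shows "v e = 0"
proof -
  define F where "F = surface_boundary total"
  have F: "F = \<gamma> ` free_params \<union> (\<Union>e\<in>X. side e 0 \<union> side e 1)"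
    unfolding F_def by (rule surface_boundary_total)
  have v_out: "v f = 0" if "f \<notin> X" for f using ker that by (simp add: in_kernel_def)
  define c where "c k = (\<Sum>j<k. v (lab j))" for k
  \<comment> \<open>The colour of gap k is c k. As a function of the parameter it is C, which jumps only at the end of a segment.\<close>
  define C where "C t = (\<Sum>j\<in>{j. j < N \<and> b j \<le> t}. v (lab j))" for t
  have C_gap: "C t = c k" if "k \<le> N" "t \<in> {gap_start k..gap_end k}" for k t
  proof -
    have "b j \<le> t \<longleftrightarrow> j < k" if "j < N" for j
      using le_gap_start[of j k] gap_end_le[of k j] ab[OF that] that \<open>k \<le> N\<close> \<open>t \<in> _\<close> by (cases "j < k") auto
    then have "{j. j < N \<and> b j \<le> t} = {..<k}" using that by auto
    then show ?thesis by (simp add: C_def c_def)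
  qed
  have C_a: "C (a k) = c k" if "k < N" for k
    using C_gap[of k "a k"] gap_le[of k] that by (auto simp: gap_end_def)
  have C_b: "C (b k) = c (Suc k)" if "k < N" for k
    using C_gap[of "Suc k" "b k"] gap_le[of "Suc k"] that by (auto simp: gap_start_def)
  have C_unused: "C t = c k" if k: "k < N" "lab k \<notin> X" and t: "t \<in> {a k..b k}" for k t
  proof (cases "t = b k")
    case True
    then show ?thesis using C_b[OF k(1)] v_out[OF k(2)] by (simp add: c_def)
  next
    case False
    have "b j \<le> t \<longleftrightarrow> j < k" if "j < N" for j
      using b_less_a[of j k] b_less_a[of k j] ab[OF that] that k t False by (cases j k rule: linorder_cases) auto
    then have "{j. j < N \<and> b j \<le> t} = {..<k}" using k by auto
    then show ?thesis by (simp add: C_def c_def)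
  qed
  have cN: "c N = 0"
  proof -
    define S where "S = {j. j < N \<and> lab j \<in> X}"
    have "c N = (\<Sum>j\<in>S. v (lab j))" unfolding c_def
      by (rule sum.mono_neutral_right) (auto simp: S_def v_out)
    also have "\<dots> = (\<Sum>f\<in>X. \<Sum>j\<in>{j\<in>S. lab j = f}. v (lab j))"
      by (rule sum.group[symmetric]) (auto simp: S_def fin)
    also have "\<dots> = (\<Sum>f\<in>X. 0)"
    proof (rule sum.cong[OF refl])
      fix f assume f: "f \<in> X"
      have l: "lab (p f) = f" "lab (q f) = f" using lab[OF f] pq[OF f] by auto
      have "{j\<in>S. lab j = f} = {p f, q f}"
      proof (rule Set.set_eqI)
        fix j
        have "p f < N" "q f < N" using pq[OF f] by auto
        then show "j \<in> {j\<in>S. lab j = f} \<longleftrightarrow> j \<in> {p f, q f}"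
          using lab[OF f, of j] f l by (cases "j < N") (auto simp: S_def)
      qed
      with l show "(\<Sum>j\<in>{j\<in>S. lab j = f}. v (lab j)) = 0" using pq[OF f] by simp
    qed
    finally show ?thesis by simp
  qed
  have C0: "C 0 = 0" using C_gap[of 0 0] gap_le[of 0] by (auto simp: gap_start_def c_def)
  have C1: "C 1 = 0" using C_gap[of N 1] gap_le[of N] cN by (auto simp: gap_end_def)
  have C_loop: "C s = C t" if "\<gamma> s = \<gamma> t" "s \<in> {0..1}" "t \<in> {0..1}" for s t
    using loop_eq[OF that(2,3)] that(1) C0 C1 by auto
  have free01: "free_params \<subseteq> {0..1}" by (auto simp: free_params_def)
  \<comment> \<open>A side takes its colour from its end on the first segment of the ribbon.\<close>
  define val where "val f i = (if i = (0::real) then c (p f) else c (Suc (p f)))" for f i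
  have c_q: "c (q f) = c (p f) + (if tw f then 0 else v f)" "c (Suc (q f)) = c (p f) + (if tw f then v f else 0)"
    "c (Suc (p f)) = c (p f) + v f" if f: "f \<in> X" for f
  proof -
    have l: "lab (p f) = f" "lab (q f) = f" using lab[OF f] pq[OF f] by auto
    have "{..<q f} = {..<p f} \<union> insert (p f) {p f<..<q f}" using pq[OF f] by auto
    then have "c (q f) = sum (\<lambda>k. v (lab k)) ({..<p f} \<union> insert (p f) {p f<..<q f})"
      by (simp add: c_def)
    also have "\<dots> = c (p f) + sum (\<lambda>k. v (lab k)) (insert (p f) {p f<..<q f})"
      unfolding c_def by (rule sum.union_disjoint) auto
    also have "sum (\<lambda>k. v (lab k)) (insert (p f) {p f<..<q f}) = v f + (\<Sum>k\<in>{p f<..<q f}. v (lab k))"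
      using l by (subst sum.insert) auto
    finally have "c (q f) = c (p f) + (v f + (\<Sum>k\<in>{p f<..<q f}. v (lab k)))" .
    moreover have "(\<Sum>k\<in>{p f<..<q f}. v (lab k)) = (if tw f then v f else 0)"
      using ker f unfolding in_kernel_def bit_add_eq_0_iff by blast
    ultimately show 1: "c (q f) = c (p f) + (if tw f then 0 else v f)" by (simp split: if_split)
    have "c (Suc (q f)) = c (q f) + v f" using l by (simp add: c_def)
    then show "c (Suc (q f)) = c (p f) + (if tw f then v f else 0)" using 1 by (simp add: add.assoc)
    show "c (Suc (p f)) = c (p f) + v f" using l by (simp add: c_def)
  qed
  have C_side: "C t = val f i" if f: "f \<in> X" and i: "i = 0 \<or> i = 1" and t: "t \<in> {0..1}" "\<gamma> t \<in> side f i" for f i t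
  proof -
    obtain y where y: "y \<in> {0..1}" "\<gamma> t = H f (Complex i y)" using t(2) unfolding side_def by blast
    have sq: "Complex i y \<in> unit_square" using i y by (auto simp: in_cbox_complex_iff)
    then have "\<gamma> t \<in> R f \<inter> V" using y(2) H(3)[OF f] loop_in_V[OF t(1)] by auto
    then have "\<gamma> t \<in> bottom_side (H f) \<union> top_side (H f)"
      using ribbon_meets_vertex(1)[OF f] by blast
    then obtain x w where xw: "x \<in> {0..1}" "w = 0 \<or> w = 1" "\<gamma> t = H f (Complex x w)" by blast
    then have "Complex x w \<in> unit_square" by (auto simp: in_cbox_complex_iff)
    then have "Complex i y = Complex x w" using inj_onD[OF H(2)[OF f] _ sq] xw(3) y(2) by simp
    then have "y = 0 \<or> y = 1" using xw by simp
    then obtain s where ks: "\<gamma> t = \<gamma> s" "s \<in> {0..1}" "C s = val f i"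
    proof
      have P: "p f < N" "q f < N" using pq[OF f] by auto
      have i01: "i \<in> {0..1}" using i by auto
      assume "y = 0"
      then have "\<gamma> t = \<gamma> (if i = 0 then a (p f) else b (p f))" using y(2) H_bot[OF f i01] i by (auto simp: subarc_def)
      moreover have "C (if i = 0 then a (p f) else b (p f)) = val f i" using C_a[OF P(1)] C_b[OF P(1)] by (simp add: val_def)
      ultimately show thesis using that[of "if i = 0 then a (p f) else b (p f)"] ab[OF P(1)] by auto
    next
      have P: "p f < N" "q f < N" using pq[OF f] by auto
      have i01: "i \<in> {0..1}" using i by auto
      define s where "s = (if (i = 0) = tw f then a (q f) else b (q f))"
      assume "y = 1"
      then have "\<gamma> t = \<gamma> s" using y(2) H_top[OF f i01] i by (auto simp: subarc_def s_def)
      moreover have "C s = val f i" using C_a[OF P(2)] C_b[OF P(2)] c_q[OF f] i by (auto simp: val_def s_def)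
      ultimately show thesis using that[of s] ab[OF P(2)] by (auto simp: s_def)
    qed
    then show ?thesis using C_loop[of t s] t by simp
  qed
  \<comment> \<open>The free parameters of colour \<beta> as a finite union of compact intervals, which makes the colour classes closed.\<close>
  define P where "P \<beta> = (\<Union>k\<in>{k. k \<le> N \<and> c k = \<beta>}. {gap_start k..gap_end k}) \<union>
     (\<Union>k\<in>{k. k < N \<and> lab k \<notin> X \<and> c k = \<beta>}. {a k..b k})" for \<beta>
  define A where "A \<beta> = \<gamma> ` P \<beta> \<union> (\<Union>f\<in>{f\<in>X. val f 0 = \<beta>}. side f 0) \<union> (\<Union>f\<in>{f\<in>X. val f 1 = \<beta>}. side f 1)" for \<beta>
  have P_sub: "P \<beta> \<subseteq> free_params" for \<beta>
    unfolding P_def using gap_subset_free unused_segment_subset_free by blast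
  have P_C: "C t = \<beta>" if "t \<in> P \<beta>" for t \<beta>
    using that unfolding P_def
  proof (elim UnE UN_E)
    fix k assume "k \<in> {k. k \<le> N \<and> c k = \<beta>}" "t \<in> {gap_start k..gap_end k}"
    then show ?thesis using C_gap[of k t] by simp
  next
    fix k assume "k \<in> {k. k < N \<and> lab k \<notin> X \<and> c k = \<beta>}" "t \<in> {a k..b k}"
    then show ?thesis using C_unused[of k t] by simp
  qed
  have P_mem: "t \<in> P (C t)" if "t \<in> free_params" for t
    using that
  proof (cases rule: free_cases)
    case (1 k)
    then show ?thesis unfolding C_gap[OF 1] P_def by (intro UnI1 UN_I[of k]) auto
  next
    case (2 k)
    then show ?thesis unfolding C_unused[OF 2] P_def by (intro UnI2 UN_I[of k]) auto
  qed
  have closed: "closed (A \<beta>)" for \<beta>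
  proof -
    have "compact (P \<beta>)" unfolding P_def by (intro compact_Un compact_UN) auto
    then have "compact (\<gamma> ` P \<beta>)"
      using P_sub[of \<beta>] free01 by (intro compact_continuous_image continuous_on_subset[OF continuous_loop]) auto
    moreover have "compact (\<Union>f\<in>{f\<in>X. val f i = \<beta>}. side f i)" if "i \<in> {0..1}" for i
      using fin compact_side that by (intro compact_UN) auto
    ultimately show ?thesis unfolding A_def by (intro closed_Un compact_imp_closed) auto
  qed
  have val_side: "val f i = val g j" if h: "f \<in> X" "g \<in> X" "i = 0 \<or> i = 1" "j = 0 \<or> j = 1" "x \<in> side f i" "x \<in> side g j" for f g i j x
  proof -
    have "x \<in> R f \<inter> R g" using side_subset[OF h(1,3)] side_subset[OF h(2,4)] h(5,6) by blast
    then have fg: "f = g" using disj h(1,2) by (auto simp: disjoint_family_on_def)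
    obtain y y' where y: "y \<in> {0..1}" "y' \<in> {0..1}" "x = H f (Complex i y)" "x = H f (Complex j y')"
      using h(5,6) unfolding fg side_def by (elim imageE) auto
    then have "H f (Complex i y) = H f (Complex j y')" by simp
    moreover have "Complex i y \<in> unit_square" "Complex j y' \<in> unit_square"
      using h(3,4) y(1,2) by (auto simp: in_cbox_complex_iff)
    ultimately have "Complex i y = Complex j y'" using inj_onD[OF H(2)[OF h(1)]] by blast
    then show ?thesis using fg by simp
  qed
  have A_cases: "(\<exists>t\<in>free_params. x = \<gamma> t \<and> C t = \<beta>) \<or> (\<exists>f\<in>X. \<exists>i. (i = 0 \<or> i = 1) \<and> x \<in> side f i \<and> val f i = \<beta>)"
    if "x \<in> A \<beta>" for x \<beta>
    using that unfolding A_def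
  proof (elim UnE UN_E imageE)
    fix t assume "x = \<gamma> t" "t \<in> P \<beta>"
    then show ?thesis using P_sub[of \<beta>] P_C[of t \<beta>] by blast
  next
    fix f assume "f \<in> {f\<in>X. val f 0 = \<beta>}" "x \<in> side f 0"
    then show ?thesis by (intro disjI2 bexI[of _ f] exI[of _ 0]) auto
  next
    fix f assume "f \<in> {f\<in>X. val f 1 = \<beta>}" "x \<in> side f 1"
    then show ?thesis by (intro disjI2 bexI[of _ f] exI[of _ 1]) auto
  qed
  have unique: "\<beta> = \<beta>'" if x: "x \<in> A \<beta>" "x \<in> A \<beta>'" for x \<beta> \<beta>'
  proof -
    have pp: "C t = C t'" if "t \<in> free_params" "t' \<in> free_params" "x = \<gamma> t" "x = \<gamma> t'" for t t'
      using that C_loop[of t t'] subsetD[OF free01, of t] subsetD[OF free01, of t'] by simp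
    have ps: "C t = val f i" if "t \<in> free_params" "x = \<gamma> t" "f \<in> X" "i = 0 \<or> i = 1" "x \<in> side f i" for t f i
      using that C_side[of f i t] subsetD[OF free01, of t] by simp
    show ?thesis
      using A_cases[OF x(1)]
    proof
      assume "\<exists>t\<in>free_params. x = \<gamma> t \<and> C t = \<beta>"
      then obtain t where t: "t \<in> free_params" "x = \<gamma> t" "C t = \<beta>" by blast
      show ?thesis using A_cases[OF x(2)] pp[OF t(1) _ t(2)] ps[OF t(1,2)] t(3) by metis
    next
      assume "\<exists>f\<in>X. \<exists>i. (i = 0 \<or> i = 1) \<and> x \<in> side f i \<and> val f i = \<beta>"
      then obtain f i where f: "f \<in> X" "x \<in> side f i" "val f i = \<beta>" and i: "i = 0 \<or> i = 1" by blast
      show ?thesis using A_cases[OF x(2)] ps[OF _ _ f(1) i f(2)] val_side[OF f(1) _ i _ f(2)] f(3) by metis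
    qed
  qed
  have in_A: "\<gamma> t \<in> A (C t)" if "t \<in> free_params" for t
    using P_mem[OF that] unfolding A_def by blast
  have bit_cases: "\<beta> = 0 \<or> \<beta> = 1" for \<beta> :: bit using bit_not_zero_iff by blast
  have cover: "F \<subseteq> A 0 \<union> A 1"
  proof
    fix x assume "x \<in> F"
    then consider t where "t \<in> free_params" "x = \<gamma> t" | f where "f \<in> X" "x \<in> side f 0" | f where "f \<in> X" "x \<in> side f 1"
      using F by blast
    then have "\<exists>\<beta>. x \<in> A \<beta>"
    proof cases
      case 1
      then show ?thesis using in_A by blast
    qed (auto simp: A_def)
    then show "x \<in> A 0 \<union> A 1" using bit_cases by (metis UnCI)
  qed
  have AB: "A 0 \<inter> F = {} \<or> A 1 \<inter> F = {}"
  proof (rule connected_closedD[OF conn[folded F_def] _ cover closed closed])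
    show "A 0 \<inter> A 1 \<inter> F = {}" using unique[of _ 0 1] by auto
  qed
  show "v e = 0"
  proof (cases "e \<in> X")
    case True
    have P: "p e < N" using pq[OF True] by auto
    have fr: "a (p e) \<in> free_params" "b (p e) \<in> free_params" using free_params_endpoint[OF P] by auto
    have "C (a (p e)) = C (b (p e))"
    proof -
      have "\<gamma> (a (p e)) \<in> F" "\<gamma> (b (p e)) \<in> F" using fr F by auto
      moreover have "\<gamma> (a (p e)) \<in> A (C (a (p e)))" "\<gamma> (b (p e)) \<in> A (C (b (p e)))" using in_A fr by auto
      ultimately show ?thesis using AB bit_cases[of "C (a (p e))"] bit_cases[of "C (b (p e))"] by auto
    qed
    then have "c (p e) = c (p e) + v e" using C_a[OF P] C_b[OF P] c_q(3)[OF True] by simp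
    then show ?thesis by simp
  qed (rule v_out)
qed

theorem connected_boundary_iff:
  "connected (surface_boundary total) \<longleftrightarrow> (\<forall>v. in_kernel v \<longrightarrow> (\<forall>e. v e = 0))"
  using connected_boundary_if_kernel_trivial kernel_trivial_if_connected_boundary by blast

end

section \<open>Bouquets and signed rotations\<close>

context bouquet_bands
begin

text \<open>
  The boundary of a Moebius band is connected, but a single untwisted ribbon has the zero matrix, whose
  kernel is not trivial.
\<close>

lemma moebius_band_single_iff:
  assumes X: "X = {e}"
  shows "moebius_band (V \<union> R e) \<longleftrightarrow> tw e"
proof
  assume mb: "moebius_band (V \<union> R e)"
  have "total = V \<union> R e" unfolding total_def by (simp add: X)
  then have conn: "connected (surface_boundary total)"
    using connected_boundary_moebius_band[OF mb] by (simp only:)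
  show "tw e"
  proof (rule ccontr)
    assume "\<not> tw e"
    \<comment> \<open>No other edge of X occurs between the two segments of e, so the row of e vanishes.\<close>
    define v where "v f = (if f = e then 1 else 0 :: bit)" for f
    have "lab k \<noteq> e" if "k \<in> {p e<..<q e}" for k
      using lab[of e k] pq[of e] that X by auto
    then have "in_kernel v" unfolding in_kernel_def using \<open>\<not> tw e\<close>
      by (auto simp: X v_def intro!: sum.neutral)
    then have "v e = 0" using kernel_trivial_if_connected_boundary[OF conn] by blast
    then show False by (simp add: v_def)
  qed
next
  assume tw: "tw e"
  have e: "e \<in> X" using X by simp
  obtain G where G: "continuous_on unit_square G" "inj_on G unit_square" "G ` unit_square = V"
    "\<And>x. x \<in> {0..1} \<Longrightarrow> G (Complex x 0) = subarc \<gamma> (a (p e)) (b (p e)) x"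
    "\<And>x. x \<in> {0..1} \<Longrightarrow> G (Complex x 1) = subarc \<gamma> (a (q e)) (b (q e)) (1 - x)"
    and imG: "bottom_side G = \<gamma> ` {a (p e)..b (p e)}"
      "top_side G = \<gamma> ` {a (q e)..b (q e)}"
    using vertex_square_chart[OF e] by blast
  have "moebius_band (G ` unit_square \<union> H e ` unit_square)"
  proof (rule moebius_bandI[OF G(1,2) H(1,2)[OF e]])
    show "G (Complex x 0) = H e (Complex x 0)" if "x \<in> {0..1}" for x
      using G(4)[OF that] H_bot[OF e that] by simp
    show "G (Complex x 1) = H e (Complex (1 - x) 1)" if "x \<in> {0..1}" for x
      using G(5)[OF that] H_top[OF e, of "1 - x"] tw that by simp
    show "G ` unit_square \<inter> H e ` unit_square
      \<subseteq> bottom_side G \<union> top_side G"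
      unfolding G(3) H(3)[OF e] VR[OF e] using imG by blast
  qed
  then show "moebius_band (V \<union> R e)" using G(3) H(3)[OF e] by simp
qed

lemma boundary_nonempty: "surface_boundary total \<noteq> {}"
proof -
  have "0 \<in> free_params" using ab by (force simp: free_params_def)
  then show ?thesis unfolding surface_boundary_total by blast
qed

end

lemma card_components_eq_1_iff:
  assumes "S \<noteq> {}"
  shows "card (components S) = 1 \<longleftrightarrow> connected S"
proof
  assume "card (components S) = 1"
  then obtain C where C: "components S = {C}" by (auto simp: card_1_singleton_iff)
  then have "C = S" using Union_components[of S] by simp
  then show "connected S" using C components_eq_sing_iff by blast
next
  assume "connected S"
  then have "components S = {S}" using assms by (simp add: components_eq_sing_iff)
  then show "card (components S) = 1" by simp
qed

text \<open>
  Every segment lies on the boundary of some ribbon, and it determines this ribbon because the ribbons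
  are disjoint.
\<close>

lemma bouquet_segments:
  fixes B :: "('e, 'a::t2_space) ribbon_graph"
  assumes B: "ribbon_graph B" and V: "verts B = {V}" and e: "e \<in> edges B"
  shows "V \<inter> ribbon B e = \<Union> (edge_segments B e)"
    and "s \<in> edge_segments B e \<Longrightarrow> s \<subseteq> surface_boundary (ribbon B e)"
proof -
  have sb: "surface_boundary Y \<subseteq> Y" for Y :: "'a set" by (auto simp: surface_boundary_def)
  have seg: "\<exists>f\<in>edges B. s \<subseteq> surface_boundary (ribbon B f)" if "s \<in> segments B" for s
  proof -
    have "\<forall>s \<in> segments B. \<exists>!e. e \<in> edges B \<and> s \<subseteq> surface_boundary (ribbon B e)"
      using B by (simp add: ribbon_graph_def)
    then show ?thesis using that by (meson ex1_implies_ex)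
  qed
  have disj: "f = g" if "f \<in> edges B" "g \<in> edges B" "x \<in> ribbon B f" "x \<in> ribbon B g" for f g x
  proof -
    have "disjoint_family_on (ribbon B) (edges B)" using B by (simp add: ribbon_graph_def)
    then show ?thesis using that by (auto simp: disjoint_family_on_def)
  qed
  show "s \<subseteq> surface_boundary (ribbon B e)" if s: "s \<in> edge_segments B e" for s
  proof -
    have s': "s \<in> segments B" "s \<subseteq> ribbon B e" using s by (auto simp: edge_segments_def)
    obtain f where f: "f \<in> edges B" "s \<subseteq> surface_boundary (ribbon B f)" using seg[OF s'(1)] by blast
    have "s \<noteq> {}" using s'(1) in_components_nonempty unfolding segments_def by blast
    then obtain x where "x \<in> s" by blast
    then have "f = e" using disj[OF f(1) e, of x] f(2) sb[of "ribbon B f"] s'(2) by blast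
    then show ?thesis using f by simp
  qed
  show "V \<inter> ribbon B e = \<Union> (edge_segments B e)"
  proof (rule antisym)
    show "\<Union> (edge_segments B e) \<subseteq> V \<inter> ribbon B e"
    proof
      fix x assume "x \<in> \<Union> (edge_segments B e)"
      then obtain s where s: "s \<in> segments B" "s \<subseteq> ribbon B e" "x \<in> s" by (auto simp: edge_segments_def)
      then have "s \<subseteq> V" using in_components_subset[of s] unfolding segments_def V by auto
      then show "x \<in> V \<inter> ribbon B e" using s by blast
    qed
    show "V \<inter> ribbon B e \<subseteq> \<Union> (edge_segments B e)"
    proof
      fix x assume x: "x \<in> V \<inter> ribbon B e"
      then have "x \<in> \<Union> (segments B)" using e unfolding segments_def Union_components V by auto
      then obtain s where s: "s \<in> segments B" "x \<in> s" by blast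
      obtain f where f: "f \<in> edges B" "s \<subseteq> surface_boundary (ribbon B f)" using seg[OF s(1)] by blast
      have "x \<in> ribbon B f" using f s sb by blast
      then have "f = e" using disj[OF f(1) e] x by blast
      then have "s \<subseteq> ribbon B e" using f sb by blast
      then show "x \<in> \<Union> (edge_segments B e)" using s by (auto simp: edge_segments_def)
    qed
  qed
qed

definition occurrence_positions :: "'e signed_cyclic_seq \<Rightarrow> 'e set \<Rightarrow> ('e \<Rightarrow> nat) \<Rightarrow> ('e \<Rightarrow> nat) \<Rightarrow> bool" where
  "occurrence_positions \<sigma> E p q \<longleftrightarrow> (\<forall>e\<in>E. p e < q e \<and> q e < length \<sigma> \<and>
     (\<forall>k<length \<sigma>. fst (\<sigma> ! k) = e \<longleftrightarrow> k = p e \<or> k = q e))"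

lemma occurrence_positions_exist:
  assumes d: "distinct (unsigned \<sigma>)" and s: "set (unsigned \<sigma>) = E \<times> {Occ_a, Occ_b}"
  obtains p q where "occurrence_positions \<sigma> E p q"
proof -
  have len: "length (unsigned \<sigma>) = length \<sigma>" by (simp add: unsigned_def)
  have fu: "fst (unsigned \<sigma> ! k) = fst (\<sigma> ! k)" if "k < length \<sigma>" for k
    using that by (simp add: unsigned_def split: prod.split)
  have "\<exists>i j. i < j \<and> j < length \<sigma> \<and> (\<forall>k<length \<sigma>. fst (\<sigma> ! k) = e \<longleftrightarrow> k = i \<or> k = j)" if e: "e \<in> E" for e
  proof -
    obtain i where i: "i < length \<sigma>" "unsigned \<sigma> ! i = (e, Occ_a)"
      using s e len by (metis in_set_conv_nth insertI1 mem_Sigma_iff)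
    obtain j where j: "j < length \<sigma>" "unsigned \<sigma> ! j = (e, Occ_b)"
      using s e len by (metis in_set_conv_nth insertI1 insertI2 mem_Sigma_iff)
    have iff: "fst (\<sigma> ! k) = e \<longleftrightarrow> k = i \<or> k = j" if k: "k < length \<sigma>" for k
    proof
      assume "fst (\<sigma> ! k) = e"
      then obtain c where c: "unsigned \<sigma> ! k = (e, c)" using fu[OF k] by (metis prod.collapse)
      have "c = Occ_a \<or> c = Occ_b" by (cases c) auto
      then show "k = i \<or> k = j"
        using c i j k d len by (metis nth_eq_iff_index_eq)
    next
      assume "k = i \<or> k = j"
      then show "fst (\<sigma> ! k) = e" using fu[OF k] i j by auto
    qed
    have "i \<noteq> j" using i j by auto
    then consider "i < j" | "j < i" by linarith
    then show ?thesis
    proof cases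
      case 1
      then show ?thesis using iff j by blast
    next
      case 2
      then show ?thesis using iff i by blast
    qed
  qed
  then have "\<exists>f g. \<forall>e\<in>E. f e < g e \<and> g e < length \<sigma> \<and>
      (\<forall>k<length \<sigma>. fst (\<sigma> ! k) = e \<longleftrightarrow> k = f e \<or> k = g e)"
    by metis
  then show thesis using that unfolding occurrence_positions_def by blast
qed

text \<open>
  The ribbons admit square charts with the segments at the bottom and the top. Attaching just one ribbon
  shows that its chart is twisted exactly if the loop is non-orientable, that is, if its two signs
  differ; then the boundary is described for all ribbons in \<open>Y\<close> at once.
\<close>

theorem quasi_tree_iff_kernel_trivial:
  fixes B :: "('e, 'a::t2_space) ribbon_graph" and \<sigma> :: "'e signed_cyclic_seq"
  assumes bq: "bouquet B" and \<sigma>: "signed_rotation B \<sigma>" and Y: "Y \<subseteq> edges B"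
    and pos: "occurrence_positions \<sigma> (edges B) p q"
  shows "quasi_tree (spanning_subgraph B Y) \<longleftrightarrow>
    (\<forall>v :: 'e \<Rightarrow> bit. (\<forall>e. e \<notin> Y \<longrightarrow> v e = 0) \<and>
       (\<forall>e\<in>Y. (\<Sum>k\<in>{p e<..<q e}. v (fst (\<sigma> ! k))) + (if opposite_signs \<sigma> e then v e else 0) = 0)
     \<longrightarrow> (\<forall>e. v e = 0))"
proof -
  have B: "ribbon_graph B" using bq by (simp add: bouquet_def)
  obtain V where V: "verts B = {V}" using bq by (auto simp: bouquet_def card_1_singleton_iff)
  have fin: "finite (edges B)" and dV: "is_disc V" and dR: "\<And>e. e \<in> edges B \<Longrightarrow> is_disc (ribbon B e)"
    and dj: "disjoint_family_on (ribbon B) (edges B)" and c2: "\<And>e. e \<in> edges B \<Longrightarrow> card (edge_segments B e) = 2"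
    using B unfolding ribbon_graph_def V by auto
  define N where "N = length \<sigma>"
  define lab where "lab k = fst (\<sigma> ! k)" for k
  obtain \<gamma> a b where loop: "simple_path \<gamma>" "pathfinish \<gamma> = pathstart \<gamma>" "path_image \<gamma> = surface_boundary V"
    and ab: "\<And>k. k < N \<Longrightarrow> 0 \<le> a k \<and> a k < b k \<and> b k < 1"
    and seg: "\<And>k. k < N \<Longrightarrow> \<gamma> ` {a k..b k} \<in> edge_segments B (lab k)"
    and ab_Suc: "\<And>k. Suc k < N \<Longrightarrow> b k < a (Suc k)"
  proof -
    have "encodes_order B \<sigma>" using \<sigma> by (simp add: signed_rotation_def)
    then obtain \<gamma> a b where *: "simple_path \<gamma>" "pathfinish \<gamma> = pathstart \<gamma>" "path_image \<gamma> = surface_boundary V"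
      "\<forall>k < N. 0 \<le> a k \<and> a k < b k \<and> b k < 1 \<and> \<gamma> ` {a k..b k} \<in> edge_segments B (lab k)"
      "\<forall>k. Suc k < N \<longrightarrow> b k < a (Suc k)"
      unfolding encodes_order_def V N_def lab_def by auto
    show thesis by (rule that[OF *(1-3)]) (use *(4,5) in blast)+
  qed
  have ba: "j < k \<Longrightarrow> k < N \<Longrightarrow> b j < a k" for j k
    by (rule successive_intervals[of N a b]) (use ab ab_Suc in auto)
  have pq: "p e < q e" "q e < N" "\<And>k. k < N \<Longrightarrow> lab k = e \<longleftrightarrow> k = p e \<or> k = q e" if "e \<in> edges B" for e
    using pos that unfolding occurrence_positions_def N_def lab_def by auto
  note eq = loop_eq_iff[OF loop(1,2)]
  have disjoint_segments: "\<gamma> ` {a (p e)..b (p e)} \<inter> \<gamma> ` {a (q e)..b (q e)} = {}" if e: "e \<in> edges B" for e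
  proof -
    have P: "p e < N" "q e < N" using pq[OF e] by auto
    have "\<gamma> s \<noteq> \<gamma> t" if "s \<in> {a (p e)..b (p e)}" "t \<in> {a (q e)..b (q e)}" for s t
      using eq[of s t] ab[OF P(1)] ab[OF P(2)] ba[OF pq(1,2)[OF e]] that by auto
    then show ?thesis by blast
  qed
  have segs: "edge_segments B e = {\<gamma> ` {a (p e)..b (p e)}, \<gamma> ` {a (q e)..b (q e)}}" if e: "e \<in> edges B" for e
  proof -
    have P: "p e < N" "q e < N" "lab (p e) = e" "lab (q e) = e" using pq[OF e] by auto
    have sub: "{\<gamma> ` {a (p e)..b (p e)}, \<gamma> ` {a (q e)..b (q e)}} \<subseteq> edge_segments B e"
      using seg[OF P(1)] seg[OF P(2)] P by auto
    have "\<gamma> ` {a (p e)..b (p e)} \<noteq> {}" using ab[OF P(1)] by auto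
    then have "\<gamma> ` {a (p e)..b (p e)} \<noteq> \<gamma> ` {a (q e)..b (q e)}" using disjoint_segments[OF e] by auto
    then have "card {\<gamma> ` {a (p e)..b (p e)}, \<gamma> ` {a (q e)..b (q e)}} = card (edge_segments B e)"
      using c2[OF e] by simp
    moreover have "finite (edge_segments B e)" using c2[OF e] by (metis card.infinite zero_neq_numeral)
    ultimately show ?thesis using card_subset_eq[OF _ sub] by simp
  qed
  have VR: "V \<inter> ribbon B e = \<gamma> ` {a (p e)..b (p e)} \<union> \<gamma> ` {a (q e)..b (q e)}" if e: "e \<in> edges B" for e
    using bouquet_segments(1)[OF B V e] segs[OF e] by simp
  define chart where "chart e G t \<longleftrightarrow> continuous_on unit_square G \<and> inj_on G unit_square \<and> G ` unit_square = ribbon B e \<and>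
     (\<forall>x\<in>{0..1}. G (Complex x 0) = subarc \<gamma> (a (p e)) (b (p e)) x) \<and>
     (\<forall>x\<in>{0..1}. G (Complex x 1) = subarc \<gamma> (a (q e)) (b (q e)) (if t then x else 1 - x))" for e G t
  have bands: "bouquet_bands V (ribbon B) Z \<gamma> N a b lab p q Hf tw"
    if Z: "Z \<subseteq> edges B" and Hf: "\<And>e. e \<in> Z \<Longrightarrow> chart e (Hf e) (tw e)" for Z Hf tw
  proof
    show "disjoint_family_on (ribbon B) Z" using dj Z by (rule disjoint_family_on_mono[rotated])
    show "finite Z" using fin Z by (rule finite_subset[rotated])
    show "V \<inter> ribbon B e = \<gamma> ` {a (p e)..b (p e)} \<union> \<gamma> ` {a (q e)..b (q e)}" if "e \<in> Z" for e
      using VR Z that by blast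
    show "lab k = e \<longleftrightarrow> k = p e \<or> k = q e" if "e \<in> Z" "k < N" for e k
      using pq(3)[of e k] Z that by blast
  qed (use dV loop ab ab_Suc pq Z Hf in \<open>auto simp: chart_def\<close>)
  have ex: "\<exists>G. chart e G (opposite_signs \<sigma> e)" if e: "e \<in> edges B" for e
  proof -
    have P: "p e < N" "q e < N" using pq[OF e] by auto
    have ar: "arc (subarc \<gamma> (a k) (b k))" "path_image (subarc \<gamma> (a k) (b k)) = \<gamma> ` {a k..b k}" if "k < N" for k
      using ab[OF that] loop by (auto intro!: arc_subarc path_image_subarc)
    have im: "path_image (subarc \<gamma> (a (p e)) (b (p e))) \<subseteq> surface_boundary (ribbon B e)"
      "path_image (subarc \<gamma> (a (q e)) (b (q e))) \<subseteq> surface_boundary (ribbon B e)"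
      using bouquet_segments(2)[OF B V e] segs[OF e] ar(2) P by auto
    have dis: "path_image (subarc \<gamma> (a (p e)) (b (p e))) \<inter> path_image (subarc \<gamma> (a (q e)) (b (q e))) = {}"
      using ar(2) P disjoint_segments[OF e] by simp
    obtain G where G: "continuous_on unit_square G" "inj_on G unit_square" "G ` unit_square = ribbon B e"
      "\<And>x. x \<in> {0..1} \<Longrightarrow> G (Complex x 0) = subarc \<gamma> (a (p e)) (b (p e)) x"
      "(\<forall>x\<in>{0..1}. G (Complex x 1) = subarc \<gamma> (a (q e)) (b (q e)) x) \<or>
       (\<forall>x\<in>{0..1}. G (Complex x 1) = subarc \<gamma> (a (q e)) (b (q e)) (1 - x))"
      using disc_square_chart_of_disjoint_arcs[OF dR[OF e] ar(1)[OF P(1)] im(1) ar(1)[OF P(2)] im(2) dis] by metis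
    obtain t where t: "chart e G t"
    proof -
      from G(5) show thesis
      proof
        assume "\<forall>x\<in>{0..1}. G (Complex x 1) = subarc \<gamma> (a (q e)) (b (q e)) x"
        then show thesis using that[of True] G(1-4) by (simp add: chart_def)
      next
        assume "\<forall>x\<in>{0..1}. G (Complex x 1) = subarc \<gamma> (a (q e)) (b (q e)) (1 - x)"
        then show thesis using that[of False] G(1-4) by (simp add: chart_def)
      qed
    qed
    interpret single: bouquet_bands V "ribbon B" "{e}" \<gamma> N a b lab p q "\<lambda>_. G" "\<lambda>_. t"
      using bands[of "{e}" "\<lambda>_. G" "\<lambda>_. t"] e t by simp
    have "moebius_band (V \<union> ribbon B e) \<longleftrightarrow> t" using single.moebius_band_single_iff[OF refl] .
    moreover have "opposite_signs \<sigma> e \<longleftrightarrow> moebius_band (V \<union> ribbon B e)"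
      using \<sigma> e unfolding signed_rotation_def nonorientable_loop_def V by simp
    ultimately show ?thesis using t by auto
  qed
  then obtain Hf where Hf: "\<And>e. e \<in> edges B \<Longrightarrow> chart e (Hf e) (opposite_signs \<sigma> e)" by metis
  interpret bouquet_bands V "ribbon B" Y \<gamma> N a b lab p q Hf "opposite_signs \<sigma>"
    using bands[OF Y] Hf Y by blast
  have "surface (spanning_subgraph B Y) = total"
    by (simp add: surface_def spanning_subgraph_def V total_def)
  then have "quasi_tree (spanning_subgraph B Y) \<longleftrightarrow> connected (surface_boundary total)"
    using card_components_eq_1_iff[OF boundary_nonempty] by (simp add: quasi_tree_def boundary_components_def)
  then show ?thesis unfolding connected_boundary_iff in_kernel_def lab_def .
qed

section \<open>Crossing edges in a signed rotation\<close>

definition crossing :: "'e signed_cyclic_seq \<Rightarrow> 'e \<Rightarrow> 'e \<Rightarrow> bool" where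
  "crossing \<sigma> i j \<longleftrightarrow>
     relative_cyclic_order \<sigma> [(i, Occ_a), (j, Occ_a), (i, Occ_b), (j, Occ_b)] \<or>
     relative_cyclic_order \<sigma> [(i, Occ_a), (j, Occ_b), (i, Occ_b), (j, Occ_a)]"

lemma rotate_4_eq_iff:
  "(\<exists>k. rotate k [w, x, y, z] = T) \<longleftrightarrow> T \<in> {[w, x, y, z], [x, y, z, w], [y, z, w, x], [z, w, x, y]}"
proof -
  have r: "rotate 0 [w, x, y, z] = [w, x, y, z]" "rotate (Suc 0) [w, x, y, z] = [x, y, z, w]"
    "rotate (Suc (Suc 0)) [w, x, y, z] = [y, z, w, x]" "rotate (Suc (Suc (Suc 0))) [w, x, y, z] = [z, w, x, y]"
    by (simp_all only: rotate_Suc rotate0 rotate1.simps append.simps id_apply)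
  show ?thesis
  proof
    assume "\<exists>k. rotate k [w, x, y, z] = T"
    then obtain k where k: "rotate k [w, x, y, z] = T" by blast
    have "T = rotate (k mod 4) [w, x, y, z]" using k rotate_conv_mod[of k "[w, x, y, z]"] by simp
    moreover have "k mod 4 = 0 \<or> k mod 4 = Suc 0 \<or> k mod 4 = Suc (Suc 0) \<or> k mod 4 = Suc (Suc (Suc 0))"
      by linarith
    ultimately show "T \<in> {[w, x, y, z], [x, y, z, w], [y, z, w, x], [z, w, x, y]}"
      using r by (elim disjE) simp_all
  next
    assume "T \<in> {[w, x, y, z], [x, y, z, w], [y, z, w, x], [z, w, x, y]}"
    then show "\<exists>k. rotate k [w, x, y, z] = T" using r by blast
  qed
qed

lemma crossing_commute: "crossing \<sigma> i j \<longleftrightarrow> crossing \<sigma> j i"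
proof -
  have rot: "(\<exists>k. rotate k L = [w, x, y, z]) \<longleftrightarrow> (\<exists>k. rotate k L = [x, y, z, w])" for L and w x y z :: "'a \<times> occurrence"
  proof
    assume "\<exists>k. rotate k L = [w, x, y, z]"
    then obtain k where "rotate k L = [w, x, y, z]" by blast
    then have "rotate (Suc k) L = [x, y, z, w]" by simp
    then show "\<exists>k. rotate k L = [x, y, z, w]" by blast
  next
    assume "\<exists>k. rotate k L = [x, y, z, w]"
    then obtain k where "rotate k L = [x, y, z, w]" by blast
    then have "rotate (Suc (Suc (Suc k))) L = [w, x, y, z]"
      by (simp only: rotate_Suc rotate1.simps append.simps)
    then show "\<exists>k. rotate k L = [w, x, y, z]" by blast
  qed
  have "relative_cyclic_order \<sigma> [w, x, y, z] \<longleftrightarrow> relative_cyclic_order \<sigma> [x, y, z, w]" for w x y z :: "'a \<times> occurrence"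
  proof -
    have "set [w, x, y, z] = set [x, y, z, w]" by auto
    then show ?thesis unfolding relative_cyclic_order_def rot[of _ w] by simp
  qed
  then show ?thesis unfolding crossing_def by blast
qed

lemma two_element_list:
  assumes "distinct xs" "set xs = {x, y}" "x \<noteq> y"
  shows "xs = [x, y] \<or> xs = [y, x]"
proof -
  have "length xs = 2" using assms distinct_card[of xs] by simp
  then obtain u v where "xs = [u, v]" by (auto simp: length_Suc_conv numeral_2_eq_2)
  then show ?thesis using assms by (auto simp: doubleton_eq_iff)
qed

text \<open>
  Restricted to the four occurrences of \<open>i\<close> and \<open>j\<close>, the rotation has the form
  \<open>f1 @ h1 # f2 @ h2 # f3\<close>, where \<open>h1\<close> and \<open>h2\<close> are the occurrences of \<open>i\<close>. The occurrences alternate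
  cyclically exactly if \<open>f2\<close> contains one of the two occurrences of \<open>j\<close>.
\<close>

lemma crossing_iff_odd_between:
  fixes \<sigma> :: "'e signed_cyclic_seq"
  assumes d: "distinct (unsigned \<sigma>)" and s: "set (unsigned \<sigma>) = E \<times> {Occ_a, Occ_b}"
    and i: "i \<in> E" and j: "j \<in> E" and ij: "i \<noteq> j" and pos: "occurrence_positions \<sigma> E p q"
  shows "crossing \<sigma> i j \<longleftrightarrow> odd (card {k \<in> {p i<..<q i}. fst (\<sigma> ! k) = j})"
proof -
  define us where "us = unsigned \<sigma>"
  have len: "length us = length \<sigma>" by (simp add: us_def unsigned_def)
  have fu: "fst (us ! k) = fst (\<sigma> ! k)" if "k < length \<sigma>" for k
    using that by (simp add: us_def unsigned_def split: prod.split)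
  have pq: "p i < q i" "q i < length \<sigma>" and lab: "\<And>k. k < length \<sigma> \<Longrightarrow> fst (\<sigma> ! k) = i \<longleftrightarrow> k = p i \<or> k = q i"
    using pos i unfolding occurrence_positions_def by auto
  define u1 where "u1 = take (p i) us"
  define u2 where "u2 = take (q i - Suc (p i)) (drop (Suc (p i)) us)"
  define u3 where "u3 = drop (Suc (q i)) us"
  define h1 where "h1 = us ! p i"
  define h2 where "h2 = us ! q i"
  have split: "us = u1 @ h1 # u2 @ h2 # u3"
  proof -
    have "us = u1 @ h1 # drop (Suc (p i)) us"
      unfolding u1_def h1_def using pq len by (intro id_take_nth_drop) simp
    moreover have "drop (Suc (p i)) us = u2 @ drop (q i) us"
    proof -
      have "drop (q i) us = drop (q i - Suc (p i)) (drop (Suc (p i)) us)" using pq by simp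
      then show ?thesis unfolding u2_def by (simp only: append_take_drop_id)
    qed
    moreover have "drop (q i) us = h2 # u3" unfolding h2_def u3_def using pq len by (simp add: Cons_nth_drop_Suc)
    ultimately show ?thesis by simp
  qed
  have fh: "fst h1 = i" "fst h2 = i" using fu lab pq by (auto simp: h1_def h2_def)
  have du: "distinct us" using d by (simp add: us_def)
  have occ: "c = Occ_a \<or> c = Occ_b" for c by (cases c) auto
  have h: "h1 = (i, Occ_a) \<and> h2 = (i, Occ_b) \<or> h1 = (i, Occ_b) \<and> h2 = (i, Occ_a)"
  proof -
    have "h1 \<noteq> h2" using du unfolding split by auto
    then show ?thesis using fh occ[of "snd h1"] occ[of "snd h2"] by (cases h1; cases h2) auto
  qed
  define S where "S = {(i, Occ_a), (j, Occ_a), (i, Occ_b), (j, Occ_b)}"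
  define P where "P x \<longleftrightarrow> x \<in> S" for x
  define f1 f2 f3 where "f1 = filter P u1" and "f2 = filter P u2" and "f3 = filter P u3"
  have L: "filter P us = f1 @ h1 # f2 @ h2 # f3"
    unfolding split using h by (auto simp: P_def S_def f1_def f2_def f3_def)
  have "set (filter P us) = S" using s i j by (auto simp: P_def S_def us_def)
  then have sL: "insert h1 (insert h2 (set (f1 @ f2 @ f3))) = S" unfolding L by auto
  have dL: "distinct (f1 @ h1 # f2 @ h2 # f3)" using du L by (metis distinct_filter)
  then have "distinct (f1 @ f2 @ f3)" and "h1 \<notin> set (f1 @ f2 @ f3)" "h2 \<notin> set (f1 @ f2 @ f3)" by auto
  moreover have "set (f1 @ f2 @ f3) = S - {h1, h2}" using sL calculation(2,3) by auto
  then have "set (f1 @ f2 @ f3) = {(j, Occ_a), (j, Occ_b)}" using h ij by (auto simp: S_def)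
  ultimately have F: "f1 @ f2 @ f3 = [(j, Occ_a), (j, Occ_b)] \<or> f1 @ f2 @ f3 = [(j, Occ_b), (j, Occ_a)]"
    by (intro two_element_list) auto
  have cross: "crossing \<sigma> i j \<longleftrightarrow> (\<exists>k. rotate k (filter P us) = [(i, Occ_a), (j, Occ_a), (i, Occ_b), (j, Occ_b)]) \<or>
      (\<exists>k. rotate k (filter P us) = [(i, Occ_a), (j, Occ_b), (i, Occ_b), (j, Occ_a)])"
  proof -
    have "set [(i, Occ_a), (j, Occ_a), (i, Occ_b), (j, Occ_b)] = S" "set [(i, Occ_a), (j, Occ_b), (i, Occ_b), (j, Occ_a)] = S"
      by (auto simp: S_def)
    then show ?thesis unfolding crossing_def relative_cyclic_order_def us_def P_def by simp
  qed
  have "crossing \<sigma> i j \<longleftrightarrow> length f2 = 1"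
  proof -
    obtain x y where xy: "f1 @ f2 @ f3 = [x, y]" "(x, y) = ((j, Occ_a), (j, Occ_b)) \<or> (x, y) = ((j, Occ_b), (j, Occ_a))"
      using F by blast
    have "(f1, f2, f3) \<in> {([], [], [x, y]), ([], [x], [y]), ([], [x, y], []), ([x], [], [y]), ([x], [y], []), ([x, y], [], [])}"
      using xy(1) by (auto simp: append_eq_Cons_conv)
    then show ?thesis
      unfolding cross L using xy(2) h ij
      by (elim insertE emptyE disjE conjE; simp add: rotate_4_eq_iff)
  qed
  also have "length f2 = card {k \<in> {p i<..<q i}. fst (\<sigma> ! k) = j}"
  proof -
    have l2: "length u2 = q i - Suc (p i)" unfolding u2_def using pq len by simp
    have nth: "u2 ! m = us ! (Suc (p i) + m)" if "m < length u2" for m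
      using that pq len unfolding u2_def by simp
    have Pj: "P (us ! k) \<longleftrightarrow> fst (\<sigma> ! k) = j" if "k < length \<sigma>" "k \<noteq> p i" "k \<noteq> q i" for k
    proof -
      have "fst (us ! k) \<noteq> i" using lab[OF that(1)] fu[OF that(1)] that by simp
      then have "P (us ! k) \<longleftrightarrow> fst (us ! k) = j"
        using occ[of "snd (us ! k)"] by (cases "us ! k") (auto simp: P_def S_def)
      then show ?thesis using fu[OF that(1)] by simp
    qed
    have "length f2 = card {m. m < length u2 \<and> P (u2 ! m)}" unfolding f2_def by (rule length_filter_conv_card)
    also have "\<dots> = card ((\<lambda>m. Suc (p i) + m) ` {m. m < length u2 \<and> P (u2 ! m)})"
      by (rule card_image[symmetric]) (auto simp: inj_on_def)
    also have "(\<lambda>m. Suc (p i) + m) ` {m. m < length u2 \<and> P (u2 ! m)} = {k \<in> {p i<..<q i}. fst (\<sigma> ! k) = j}"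
    proof (rule Set.set_eqI)
      fix k
      show "k \<in> (\<lambda>m. Suc (p i) + m) ` {m. m < length u2 \<and> P (u2 ! m)} \<longleftrightarrow> k \<in> {k \<in> {p i<..<q i}. fst (\<sigma> ! k) = j}"
      proof
        assume "k \<in> (\<lambda>m. Suc (p i) + m) ` {m. m < length u2 \<and> P (u2 ! m)}"
        then obtain m where m: "k = Suc (p i) + m" "m < length u2" "P (u2 ! m)" by blast
        then have "p i < k" "k < q i" using l2 by auto
        moreover have "P (us ! k)" using nth m by simp
        ultimately show "k \<in> {k \<in> {p i<..<q i}. fst (\<sigma> ! k) = j}" using Pj[of k] pq by simp
      next
        assume k: "k \<in> {k \<in> {p i<..<q i}. fst (\<sigma> ! k) = j}"
        define m where "m = k - Suc (p i)"
        have m: "k = Suc (p i) + m" "m < length u2" using k l2 by (auto simp: m_def)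
        moreover have "P (u2 ! m)" using nth[OF m(2)] m(1) k Pj[of k] pq by simp
        ultimately show "k \<in> (\<lambda>m. Suc (p i) + m) ` {m. m < length u2 \<and> P (u2 ! m)}" by blast
      qed
    qed
    finally show ?thesis .
  qed
  finally have 1: "crossing \<sigma> i j \<longleftrightarrow> card {k \<in> {p i<..<q i}. fst (\<sigma> ! k) = j} = 1" .
  have "{k \<in> {p i<..<q i}. fst (\<sigma> ! k) = j} \<subseteq> {p j, q j}"
  proof
    fix k assume k: "k \<in> {k \<in> {p i<..<q i}. fst (\<sigma> ! k) = j}"
    then have "k < length \<sigma>" using pq by simp
    then show "k \<in> {p j, q j}" using k pos j unfolding occurrence_positions_def by blast
  qed
  then have "card {k \<in> {p i<..<q i}. fst (\<sigma> ! k) = j} \<le> card {p j, q j}" by (intro card_mono) auto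
  also have "\<dots> \<le> 2" by (simp add: card_insert_le_m1)
  finally have le: "card {k \<in> {p i<..<q i}. fst (\<sigma> ! k) = j} \<le> 2" .
  have "m = 1 \<longleftrightarrow> odd m" if "m \<le> 2" for m :: nat
    using that by (cases m rule: nat.exhaust) (auto simp: le_Suc_eq numeral_2_eq_2)
  from this[OF le] show ?thesis using 1 by simp
qed

section \<open>Reduction and principal minors\<close>

lemma reduction_superset:
  assumes "finite S" "Poly_Mapping.keys P \<subseteq> S"
  shows "reduction P = (\<Sum>m\<in>S. of_int (Poly_Mapping.lookup P m) * xset (indices m))"
  unfolding reduction_def using assms
  by (intro sum.mono_neutral_left) (auto simp: in_keys_iff)

lemma reduction_0: "reduction 0 = 0"
  by (simp add: reduction_def)

lemma reduction_add: "reduction (P + Q) = reduction P + reduction Q"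
proof -
  define S where "S = Poly_Mapping.keys P \<union> Poly_Mapping.keys Q"
  have "finite S" "Poly_Mapping.keys P \<subseteq> S" "Poly_Mapping.keys Q \<subseteq> S" "Poly_Mapping.keys (P + Q) \<subseteq> S"
    using keys_add[of P Q] by (auto simp: S_def)
  then show ?thesis
    by (simp add: reduction_superset[of S] lookup_add sum.distrib[symmetric] distrib_right)
qed

lemma reduction_single: "reduction (Poly_Mapping.single m c) = of_int c * xset (indices m)"
proof -
  have "reduction (Poly_Mapping.single m c) = (\<Sum>m'\<in>{m}. of_int (Poly_Mapping.lookup (Poly_Mapping.single m c) m') * xset (indices m'))"
    by (rule reduction_superset) auto
  then show ?thesis by simp
qed

lemma reduction_sum: "reduction (\<Sum>x\<in>S. f x) = (\<Sum>x\<in>S. reduction (f x))"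
  by (induction S rule: infinite_finite_induct) (simp_all add: reduction_add reduction_0)

lemma indices_add: "indices (m + m') = indices m \<union> indices m'"
proof -
  have "Poly_Mapping.keys (m + m') = Poly_Mapping.keys m \<union> Poly_Mapping.keys m'"
    by (auto simp: in_keys_iff lookup_add)
  then show ?thesis by (auto simp: indices_def)
qed

lemma sum_of_singles: "P = (\<Sum>m\<in>Poly_Mapping.keys P. Poly_Mapping.single m (Poly_Mapping.lookup P m))"
proof (rule poly_mapping_eqI)
  fix k
  show "Poly_Mapping.lookup P k = Poly_Mapping.lookup (\<Sum>m\<in>Poly_Mapping.keys P. Poly_Mapping.single m (Poly_Mapping.lookup P m)) k"
    by (simp add: lookup_sum lookup_single when_def in_keys_iff)
qed

lemma reduction_mult: "reduction (P * Q) = reduction P * reduction Q"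
proof -
  let ?s = "\<lambda>P m. Poly_Mapping.single m (Poly_Mapping.lookup P m)"
  have "reduction (P * Q) = reduction ((\<Sum>m\<in>Poly_Mapping.keys P. ?s P m) * (\<Sum>m\<in>Poly_Mapping.keys Q. ?s Q m))"
    by (simp flip: sum_of_singles)
  also have "\<dots> = (\<Sum>m\<in>Poly_Mapping.keys P. \<Sum>m'\<in>Poly_Mapping.keys Q. reduction (?s P m * ?s Q m'))"
    by (simp only: sum_product reduction_sum)
  also have "\<dots> = (\<Sum>m\<in>Poly_Mapping.keys P. \<Sum>m'\<in>Poly_Mapping.keys Q. reduction (?s P m) * reduction (?s Q m'))"
    by (simp add: mult_single reduction_single indices_add xset_mult[symmetric] ac_simps)
  also have "\<dots> = reduction (\<Sum>m\<in>Poly_Mapping.keys P. ?s P m) * reduction (\<Sum>m\<in>Poly_Mapping.keys Q. ?s Q m)"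
    by (simp only: sum_product reduction_sum)
  finally show ?thesis by (simp flip: sum_of_singles)
qed

lemma reduction_1: "reduction 1 = 1"
  using reduction_single[of 0 1] by (simp add: indices_def xset_empty)

interpretation reduction: comm_ring_hom reduction
  by unfold_locales (simp_all add: reduction_add reduction_mult reduction_1 reduction_0)

lemma reduction_xvar: "reduction (xvar i j) = xset {i, j}"
  by (simp add: xvar_def reduction_single indices_def)

text \<open>
  The coefficient of \<open>x\<^sub>i\<^sub>j\<close>, or for \<open>i > j\<close> of \<open>x\<^sub>j\<^sub>i\<close>, in the entry at \<open>(i, j)\<close> of the skew-adjacency
  matrix. The reduction map sends both indeterminates to the symbol of \<open>{i, j}\<close>.
\<close>

definition adjacency_sign :: "nat signed_cyclic_seq \<Rightarrow> nat \<Rightarrow> nat \<Rightarrow> int" where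
  "adjacency_sign \<sigma> i j =
    (let up = \<lambda>i j. if relative_cyclic_order \<sigma> [(i, Occ_a), (j, Occ_a), (i, Occ_b), (j, Occ_b)] then 1
       else if relative_cyclic_order \<sigma> [(i, Occ_a), (j, Occ_b), (i, Occ_b), (j, Occ_a)] then -1 else 0
     in if i = j then of_bool (opposite_signs \<sigma> i) else if i < j then up i j else - up j i)"

lemma reduction_skew_entry: "reduction (skew_entry \<sigma> i j) = of_int (adjacency_sign \<sigma> i j) * xset {i, j}"
  by (auto simp: skew_entry_def upper_entry_def adjacency_sign_def reduction_xvar reduction.hom_uminus insert_commute)

lemma adjacency_sign_bit:
  "(of_int (adjacency_sign \<sigma> i j) :: bit) = (if i = j then of_bool (opposite_signs \<sigma> i) else of_bool (crossing \<sigma> i j))"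
  using crossing_commute[of \<sigma> i j] by (auto simp: adjacency_sign_def crossing_def)

lemma prod_of_int_xset:
  assumes "finite Z"
  shows "(\<Prod>i\<in>Z. of_int (c i) * xset (A i)) = of_int (\<Prod>i\<in>Z. c i) * xset (\<Union>i\<in>Z. A i)"
  using assms by (induction Z rule: finite_induct) (simp_all add: xset_empty xset_mult[symmetric] ac_simps)

text \<open>
  Rows outside \<open>Z\<close> are taken from the identity matrix, so the determinant is the principal minor on \<open>Z\<close>.
\<close>

definition minor_mat :: "nat \<Rightarrow> (nat \<Rightarrow> nat \<Rightarrow> 'c::comm_ring_1) \<Rightarrow> nat set \<Rightarrow> 'c mat" where
  "minor_mat n c Z = Matrix.mat n n (\<lambda>(i, j). if i \<in> Z then c i j else of_bool (i = j))"

text \<open>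
  In the Leibniz formula, the product over all rows is expanded into a sum over the set \<open>Z\<close> of rows from
  which the second summand is taken. A permutation contributes only if it fixes the complement of \<open>Z\<close>
  pointwise; then it permutes \<open>Z\<close>, and the union of the index pairs is \<open>Suc ` Z\<close>.
\<close>

lemma det_one_plus_expand:
  fixes c :: "nat \<Rightarrow> nat \<Rightarrow> int"
  shows "Determinant.det (Matrix.mat n n (\<lambda>(i, j). of_bool (i = j) + of_int (c i j) * xset {Suc i, Suc j})) =
    (\<Sum>Z\<in>Pow {0..<n}. of_int (Determinant.det (minor_mat n c Z)) * xset (Suc ` Z))"
proof -
  let ?P = "{\<pi>. \<pi> permutes {0..<n}}"
  let ?t = "\<lambda>\<pi> Z. (\<Prod>i\<in>Z. of_int (c i (\<pi> i)) * xset {Suc i, Suc (\<pi> i)}) * (\<Prod>i\<in>{0..<n} - Z. of_bool (i = \<pi> i)) :: setpoly"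
  let ?u = "\<lambda>\<pi> Z. \<Prod>i\<in>{0..<n}. if i \<in> Z then c i (\<pi> i) else of_bool (i = \<pi> i)"
  have perm: "\<pi> i < n" if "\<pi> permutes {0..<n}" "i < n" for \<pi> i
    using permutes_in_image[OF that(1), of i] that(2) by simp
  have summand: "?t \<pi> Z = of_int (?u \<pi> Z) * xset (Suc ` Z)" if \<pi>: "\<pi> permutes {0..<n}" and Z: "Z \<subseteq> {0..<n}" for \<pi> Z
  proof -
    have fZ: "finite Z" using Z finite_subset by blast
    have "?u \<pi> Z = (\<Prod>i\<in>Z. if i \<in> Z then c i (\<pi> i) else of_bool (i = \<pi> i)) *
        (\<Prod>i\<in>{0..<n} - Z. if i \<in> Z then c i (\<pi> i) else of_bool (i = \<pi> i))"
      using prod.subset_diff[OF Z, of "\<lambda>i. if i \<in> Z then c i (\<pi> i) else of_bool (i = \<pi> i)"] by (simp add: mult.commute)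
    then have u: "?u \<pi> Z = (\<Prod>i\<in>Z. c i (\<pi> i)) * (\<Prod>i\<in>{0..<n} - Z. of_bool (i = \<pi> i))" by simp
    show ?thesis
    proof (cases "\<forall>i\<in>{0..<n} - Z. \<pi> i = i")
      case True
      have "\<pi> i \<in> Z" if "i \<in> Z" for i
      proof (rule ccontr)
        assume "\<pi> i \<notin> Z"
        moreover have "\<pi> i \<in> {0..<n}" using \<pi> Z that by (meson permutes_in_image subsetD)
        ultimately have "\<pi> (\<pi> i) = \<pi> i" using True by blast
        then have "\<pi> i = i" using \<pi> by (meson injD permutes_inj)
        then show False using \<open>\<pi> i \<notin> Z\<close> that by simp
      qed
      then have "(\<Union>i\<in>Z. {Suc i, Suc (\<pi> i)}) = Suc ` Z" by auto
      moreover have "(\<Prod>i\<in>{0..<n} - Z. of_bool (i = \<pi> i)) = (1::setpoly)"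
        "(\<Prod>i\<in>{0..<n} - Z. of_bool (i = \<pi> i)) = (1::int)" using True by (auto intro!: prod.neutral)
      ultimately show ?thesis unfolding u prod_of_int_xset[OF fZ] by simp
    next
      case False
      then have "\<exists>i\<in>{0..<n} - Z. of_bool (i = \<pi> i) = (0::setpoly)" "\<exists>i\<in>{0..<n} - Z. of_bool (i = \<pi> i) = (0::int)" by force+
      then have "(\<Prod>i\<in>{0..<n} - Z. of_bool (i = \<pi> i)) = (0::setpoly)"
        "(\<Prod>i\<in>{0..<n} - Z. of_bool (i = \<pi> i)) = (0::int)"
        by (intro prod_zero; simp)+
      then show ?thesis unfolding u by simp
    qed
  qed
  have "Determinant.det (Matrix.mat n n (\<lambda>(i, j). of_bool (i = j) + of_int (c i j) * xset {Suc i, Suc j})) =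
     (\<Sum>\<pi>\<in>?P. signof \<pi> * (\<Prod>i\<in>{0..<n}. of_int (c i (\<pi> i)) * xset {Suc i, Suc (\<pi> i)} + of_bool (i = \<pi> i)))"
    by (subst det_def') (auto intro!: sum.cong prod.cong arg_cong2[where f="(*)"] simp: perm add.commute)
  also have "\<dots> = (\<Sum>\<pi>\<in>?P. \<Sum>Z\<in>Pow {0..<n}. signof \<pi> * ?t \<pi> Z)"
    by (subst prod_add) (simp_all add: sum_distrib_left)
  also have "\<dots> = (\<Sum>Z\<in>Pow {0..<n}. \<Sum>\<pi>\<in>?P. of_int (signof \<pi> * ?u \<pi> Z) * xset (Suc ` Z))"
    by (subst sum.swap) (intro sum.cong, auto simp: summand mult.assoc)
  also have "\<dots> = (\<Sum>Z\<in>Pow {0..<n}. of_int (\<Sum>\<pi>\<in>?P. signof \<pi> * ?u \<pi> Z) * xset (Suc ` Z))"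
    by (simp only: of_int_sum sum_distrib_right)
  also have "\<dots> = (\<Sum>Z\<in>Pow {0..<n}. of_int (Determinant.det (minor_mat n c Z)) * xset (Suc ` Z))"
  proof (intro sum.cong refl arg_cong2[where f="(*)"] arg_cong[where f=of_int])
    fix Z
    show "(\<Sum>\<pi>\<in>?P. signof \<pi> * ?u \<pi> Z) = Determinant.det (minor_mat n c Z)"
      unfolding minor_mat_def
      by (subst det_def') (auto intro!: sum.cong prod.cong arg_cong2[where f="(*)"] simp: perm)
  qed
  finally show ?thesis .
qed

lemma mod_2_sum_xset:
  fixes d :: "nat set \<Rightarrow> int"
  assumes "finite F"
  shows "mod_2 (\<Sum>X\<in>F. of_int (d X) * xset X) = (\<Sum>X\<in>{X\<in>F. odd (d X)}. xset X)"
proof (rule poly_mapping_eqI)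
  fix k :: union_set
  obtain A where k: "k = USet A" by (cases k)
  have single: "of_int z * xset X = Poly_Mapping.single (USet X) z" for z X
  proof -
    have "(of_int z :: setpoly) = Poly_Mapping.single 0 z" by (metis single_of_int of_int_eq_id id_apply)
    then show ?thesis by (simp only: xset_def mult_single add_0 mult_1_right)
  qed
  have "Poly_Mapping.lookup (\<Sum>X\<in>F. of_int (d X) * xset X) k = (\<Sum>X\<in>F. if X = A then d X else 0)"
    unfolding single by (simp only: lookup_sum lookup_single when_def k union_set.inject)
  then have l: "Poly_Mapping.lookup (\<Sum>X\<in>F. of_int (d X) * xset X) k = (if A \<in> F then d A else 0)"
    using assms by simp
  have "Poly_Mapping.lookup (\<Sum>X\<in>{X\<in>F. odd (d X)}. xset X) k = (\<Sum>X\<in>{X\<in>F. odd (d X)}. if X = A then 1 else 0)"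
    by (simp only: lookup_sum xset_def lookup_single when_def k union_set.inject)
  also have "\<dots> = (if A \<in> F \<and> odd (d A) then 1 else 0)" using assms by simp
  finally show "Poly_Mapping.lookup (mod_2 (\<Sum>X\<in>F. of_int (d X) * xset X)) k =
     Poly_Mapping.lookup (\<Sum>X\<in>{X\<in>F. odd (d X)}. xset X) k"
    unfolding mod_2_def by (simp add: Poly_Mapping.map.rep_eq l when_def odd_iff_mod_2_eq_one even_iff_mod_2_eq_zero)
qed

lemma at_ones_sum_xset:
  assumes "finite F"
  shows "at_ones (\<Sum>X\<in>F. xset X) = int (card F)"
proof -
  have l: "Poly_Mapping.lookup (\<Sum>X\<in>F. xset X) (USet A) = of_bool (A \<in> F)" for A
  proof -
    have "Poly_Mapping.lookup (\<Sum>X\<in>F. xset X) (USet A) = (\<Sum>X\<in>F. if X = A then 1 else 0)"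
      by (simp only: lookup_sum xset_def lookup_single when_def union_set.inject)
    then show ?thesis using assms by simp
  qed
  have "Poly_Mapping.keys (\<Sum>X\<in>F. xset X) = USet ` F"
  proof (rule Set.set_eqI)
    fix k show "k \<in> Poly_Mapping.keys (\<Sum>X\<in>F. xset X) \<longleftrightarrow> k \<in> USet ` F"
      by (cases k) (auto simp: in_keys_iff l)
  qed
  then have "at_ones (\<Sum>X\<in>F. xset X) = (\<Sum>k\<in>USet ` F. Poly_Mapping.lookup (\<Sum>X\<in>F. xset X) k)"
    by (simp only: at_ones_def)
  also have "\<dots> = (\<Sum>X\<in>F. 1)" by (subst sum.reindex) (auto simp: inj_on_def l)
  finally show ?thesis by simp
qed

lemma odd_iff_of_int_bit: "odd (d :: int) \<longleftrightarrow> (of_int d :: bit) \<noteq> 0"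
proof -
  have "(of_int d :: bit) = of_int (2 * (d div 2) + d mod 2)" by simp
  also have "\<dots> = of_int (d mod 2)" by (simp only: of_int_add of_int_mult) simp
  finally show ?thesis by (cases "even d") (auto simp: odd_iff_mod_2_eq_one)
qed

text \<open>
  Modulo 2 the determinant is that of a matrix over a field, where singular means having a kernel.
\<close>

lemma odd_det_minor_iff:
  fixes c :: "nat \<Rightarrow> nat \<Rightarrow> int"
  shows "odd (Determinant.det (minor_mat n c Z)) \<longleftrightarrow>
    (\<forall>w :: nat \<Rightarrow> bit. (\<forall>i<n. if i \<in> Z then (\<Sum>j<n. of_int (c i j) * w j) = 0 else w i = 0) \<longrightarrow> (\<forall>i<n. w i = 0))" (is "_ \<longleftrightarrow> ?trivial")
proof -
  define M :: "bit mat" where "M = minor_mat n (\<lambda>i j. of_int (c i j)) Z"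
  have M: "M \<in> carrier_mat n n" by (simp add: M_def minor_mat_def)
  have "map_mat of_int (minor_mat n c Z) = M"
    by (rule eq_matI) (auto simp: M_def minor_mat_def)
  then have "of_int (Determinant.det (minor_mat n c Z)) = Determinant.det M"
    using of_int_hom.hom_det[of "minor_mat n c Z", where 'a=bit] by simp
  then have "odd (Determinant.det (minor_mat n c Z)) \<longleftrightarrow> Determinant.det M \<noteq> 0"
    by (simp only: odd_iff_of_int_bit)
  also have "\<dots> \<longleftrightarrow> \<not> (\<exists>v. v \<in> carrier_vec n \<and> v \<noteq> 0\<^sub>v n \<and> M *\<^sub>v v = 0\<^sub>v n)"
    using det_0_iff_vec_prod_zero_field[OF M] by simp
  also have "\<dots> \<longleftrightarrow> ?trivial"
  proof -
    have row: "vec_index (M *\<^sub>v v) i = (if i \<in> Z then (\<Sum>j<n. of_int (c i j) * vec_index v j) else vec_index v i)"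
      if "i < n" "v \<in> carrier_vec n" for i v
    proof -
      have "vec_index (M *\<^sub>v v) i = (\<Sum>j\<in>{0..<n}. (if i \<in> Z then of_int (c i j) else of_bool (i = j)) * vec_index v j)"
        using that by (simp add: M_def minor_mat_def scalar_prod_def)
      also have "\<dots> = (if i \<in> Z then (\<Sum>j<n. of_int (c i j) * vec_index v j) else vec_index v i)"
      proof (cases "i \<in> Z")
        case False
        have "(\<Sum>j\<in>{0..<n}. of_bool (i = j) * vec_index v j) = (\<Sum>j\<in>{0..<n}. if i = j then vec_index v j else 0)"
          by (intro sum.cong) auto
        then show ?thesis using False that by simp
      qed (simp add: atLeast0LessThan)
      finally show ?thesis .
    qed
    have zero: "v = 0\<^sub>v n \<longleftrightarrow> (\<forall>i<n. vec_index v i = 0)" if "v \<in> carrier_vec n" for v :: "bit Matrix.vec"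
      using that by (auto intro!: eq_vecI)
    have prod: "M *\<^sub>v v = 0\<^sub>v n \<longleftrightarrow> (\<forall>i<n. if i \<in> Z then (\<Sum>j<n. of_int (c i j) * vec_index v j) = 0 else vec_index v i = 0)"
      if v: "v \<in> carrier_vec n" for v
    proof -
      have "M *\<^sub>v v \<in> carrier_vec n" using M v by simp
      then show ?thesis unfolding zero[OF \<open>M *\<^sub>v v \<in> carrier_vec n\<close>] using row[OF _ v] by auto
    qed
    show ?thesis
    proof
      assume L: "\<not> (\<exists>v. v \<in> carrier_vec n \<and> v \<noteq> 0\<^sub>v n \<and> M *\<^sub>v v = 0\<^sub>v n)"
      show ?trivial
      proof (intro allI impI)
        fix w :: "nat \<Rightarrow> bit" and i
        assume w: "\<forall>i<n. if i \<in> Z then (\<Sum>j<n. of_int (c i j) * w j) = 0 else w i = 0" and i: "i < n"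
        define v where "v = Matrix.vec n w"
        have v: "v \<in> carrier_vec n" by (simp add: v_def)
        have vi: "vec_index v j = w j" if "j < n" for j using that by (simp add: v_def)
        have s: "(\<Sum>j<n. of_int (c i j) * vec_index v j) = (\<Sum>j<n. of_int (c i j) * w j)" for i
          by (intro sum.cong) (auto simp: vi)
        have "M *\<^sub>v v = 0\<^sub>v n" unfolding prod[OF v] s using w vi by auto
        then have "v = 0\<^sub>v n" using L v by blast
        then show "w i = 0" using vi[OF i] i by simp
      qed
    next
      assume R: ?trivial
      show "\<not> (\<exists>v. v \<in> carrier_vec n \<and> v \<noteq> 0\<^sub>v n \<and> M *\<^sub>v v = 0\<^sub>v n)"
        using R[rule_format, of "vec_index v" for v] zero prod by blast
    qed
  qed
  finally show ?thesis .
qed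

text \<open>
  The positions between the two occurrences of \<open>i\<close> are grouped by their edge \<open>j\<close>; modulo 2 the number of
  positions in a group is 1 exactly if \<open>i\<close> and \<open>j\<close> cross.
\<close>

lemma sum_between_eq_crossing_sum:
  fixes \<sigma> :: "nat signed_cyclic_seq" and v :: "nat \<Rightarrow> bit"
  assumes d: "distinct (unsigned \<sigma>)" and s: "set (unsigned \<sigma>) = E \<times> {Occ_a, Occ_b}" and fin: "finite E"
    and i: "i \<in> E" and pos: "occurrence_positions \<sigma> E p q"
  shows "(\<Sum>k\<in>{p i<..<q i}. v (fst (\<sigma> ! k))) + (if opposite_signs \<sigma> i then v i else 0) =
    (\<Sum>j\<in>E. of_int (adjacency_sign \<sigma> i j) * v j)"
proof -
  have pq: "p i < q i" "q i < length \<sigma>" and lab: "\<And>k. k < length \<sigma> \<Longrightarrow> fst (\<sigma> ! k) = i \<longleftrightarrow> k = p i \<or> k = q i"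
    using pos i unfolding occurrence_positions_def by auto
  let ?S = "\<lambda>j. {k \<in> {p i<..<q i}. fst (\<sigma> ! k) = j}"
  have labE: "fst (\<sigma> ! k) \<in> E" if "k < length \<sigma>" for k
  proof -
    have "unsigned \<sigma> ! k \<in> set (unsigned \<sigma>)" using that by (intro nth_mem) (simp add: unsigned_def)
    then have "fst (unsigned \<sigma> ! k) \<in> E" unfolding s by auto
    then show ?thesis using that by (simp add: unsigned_def split: prod.splits)
  qed
  have "(\<Sum>k\<in>{p i<..<q i}. v (fst (\<sigma> ! k))) = (\<Sum>j\<in>E. \<Sum>k\<in>?S j. v (fst (\<sigma> ! k)))"
    using labE pq by (intro sum.group[symmetric]) (auto simp: fin)
  also have "\<dots> = (\<Sum>j\<in>E. of_nat (card (?S j)) * v j)"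
    by (intro sum.cong) simp_all
  also have "\<dots> = (\<Sum>j\<in>E. (if j = i then 0 else of_bool (crossing \<sigma> i j)) * v j)"
  proof (intro sum.cong refl arg_cong2[where f="(*)"])
    fix j assume j: "j \<in> E"
    show "(of_nat (card (?S j)) :: bit) = (if j = i then 0 else of_bool (crossing \<sigma> i j))"
    proof (cases "j = i")
      case True
      have "?S i = {}" using lab pq by auto
      then show ?thesis unfolding True by (simp only: card.empty of_nat_0 if_True simp_thms)
    next
      case False
      have "(of_nat (card (?S j)) :: bit) = of_bool (odd (card (?S j)))"
        using odd_iff_of_int_bit[of "int (card (?S j))"] by (auto simp: bit_not_zero_iff)
      then show ?thesis using crossing_iff_odd_between[OF d s i j _ pos] False by simp
    qed
  qed
  finally have between: "(\<Sum>k\<in>{p i<..<q i}. v (fst (\<sigma> ! k))) = (\<Sum>j\<in>E. (if j = i then 0 else of_bool (crossing \<sigma> i j)) * v j)" .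
  have "(\<Sum>j\<in>E. of_int (adjacency_sign \<sigma> i j) * v j) =
     (\<Sum>j\<in>E. (if j = i then 0 else of_bool (crossing \<sigma> i j)) * v j + (if j = i then of_bool (opposite_signs \<sigma> i) * v i else 0))"
    by (intro sum.cong) (auto simp: adjacency_sign_bit)
  also have "\<dots> = (\<Sum>j\<in>E. (if j = i then 0 else of_bool (crossing \<sigma> i j)) * v j) + of_bool (opposite_signs \<sigma> i) * v i"
    using fin i by (simp add: sum.distrib)
  finally show ?thesis using between by simp
qed

theorem quasi_tree_iff_odd_minor:
  fixes B :: "(nat, 'a::t2_space) ribbon_graph"
  assumes bq: "bouquet B" and E: "edges B = {1..n}" and \<sigma>: "signed_rotation B \<sigma>" and Z: "Z \<subseteq> {0..<n}"
  shows "quasi_tree (spanning_subgraph B (Suc ` Z)) \<longleftrightarrow>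
    odd (Determinant.det (minor_mat n (\<lambda>i j. adjacency_sign \<sigma> (Suc i) (Suc j)) Z))"
proof -
  have d: "distinct (unsigned \<sigma>)" and s: "set (unsigned \<sigma>) = {1..n} \<times> {Occ_a, Occ_b}"
    using \<sigma> by (auto simp: signed_rotation_def E)
  obtain p q where pos: "occurrence_positions \<sigma> {1..n} p q" using occurrence_positions_exist[OF d s] .
  have Y: "Suc ` Z \<subseteq> edges B" using Z by (auto simp: E)
  define K where "K v \<longleftrightarrow> (\<forall>e. e \<notin> Suc ` Z \<longrightarrow> v e = 0) \<and>
     (\<forall>e\<in>Suc ` Z. (\<Sum>j\<in>{1..n}. of_int (adjacency_sign \<sigma> e j) * v j) = 0)" for v :: "nat \<Rightarrow> bit"
  define L where "L w \<longleftrightarrow> (\<forall>i<n. if i \<in> Z then (\<Sum>j<n. of_int (adjacency_sign \<sigma> (Suc i) (Suc j)) * w j) = 0 else w i = 0)"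
    for w :: "nat \<Rightarrow> bit"
  have shift: "(\<Sum>j\<in>{1..n}. f j) = (\<Sum>j<n. f (Suc j))" for f :: "nat \<Rightarrow> bit"
    using sum.shift_bounds_Suc_ivl[of f 0 n] by (simp add: atLeastLessThanSuc_atLeastAtMost atLeast0LessThan)
  have "quasi_tree (spanning_subgraph B (Suc ` Z)) \<longleftrightarrow> (\<forall>v :: nat \<Rightarrow> bit. K v \<longrightarrow> (\<forall>e. v e = 0))"
  proof -
    have "(\<forall>e\<in>Suc ` Z. (\<Sum>k\<in>{p e<..<q e}. v (fst (\<sigma> ! k))) + (if opposite_signs \<sigma> e then v e else 0) = 0) \<longleftrightarrow>
      (\<forall>e\<in>Suc ` Z. (\<Sum>j\<in>{1..n}. of_int (adjacency_sign \<sigma> e j) * v j) = 0)" for v :: "nat \<Rightarrow> bit"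
    proof (intro ball_cong refl)
      fix e assume "e \<in> Suc ` Z"
      then have e: "e \<in> {1..n}" using Y E by auto
      show "(\<Sum>k\<in>{p e<..<q e}. v (fst (\<sigma> ! k))) + (if opposite_signs \<sigma> e then v e else 0) = 0 \<longleftrightarrow>
        (\<Sum>j\<in>{1..n}. of_int (adjacency_sign \<sigma> e j) * v j) = 0"
        by (simp only: sum_between_eq_crossing_sum[OF d s finite_atLeastAtMost e pos])
    qed
    then show ?thesis
      using quasi_tree_iff_kernel_trivial[OF bq \<sigma> Y] pos unfolding K_def E by simp
  qed
  also have "\<dots> \<longleftrightarrow> (\<forall>w :: nat \<Rightarrow> bit. L w \<longrightarrow> (\<forall>i<n. w i = 0))"
  proof
    assume K: "\<forall>v. K v \<longrightarrow> (\<forall>e. v e = 0)"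
    show "\<forall>w. L w \<longrightarrow> (\<forall>i<n. w i = 0)"
    proof (intro allI impI)
      fix w :: "nat \<Rightarrow> bit" and i assume w: "L w" and i: "i < n"
      define v where "v e = (if e \<in> {1..n} then w (e - 1) else 0)" for e
      have vS: "v (Suc j) = w j" if "j < n" for j using that by (simp add: v_def)
      have "K v" unfolding K_def shift
      proof (intro conjI allI impI ballI)
        fix e assume e: "e \<notin> Suc ` Z"
        show "v e = 0"
        proof (cases "e \<in> {1..n}")
          case True
          then have "e - 1 < n" "e - 1 \<notin> Z" using e by (auto simp: image_iff)
          then show ?thesis using w True by (simp add: L_def v_def)
        qed (auto simp: v_def)
      next
        fix e assume "e \<in> Suc ` Z"
        then obtain j where j: "j \<in> Z" "e = Suc j" by blast
        have "(\<Sum>k<n. of_int (adjacency_sign \<sigma> e (Suc k)) * v (Suc k)) = (\<Sum>k<n. of_int (adjacency_sign \<sigma> (Suc j) (Suc k)) * w k)"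
          using j by (intro sum.cong) (auto simp: vS)
        also have "\<dots> = 0" using w j Z by (auto simp: L_def)
        finally show "(\<Sum>k<n. of_int (adjacency_sign \<sigma> e (Suc k)) * v (Suc k)) = 0" .
      qed
      then have "v (Suc i) = 0" using K by blast
      then show "w i = 0" using vS[OF i] by simp
    qed
  next
    assume L: "\<forall>w. L w \<longrightarrow> (\<forall>i<n. w i = 0)"
    show "\<forall>v. K v \<longrightarrow> (\<forall>e. v e = 0)"
    proof (intro allI impI)
      fix v :: "nat \<Rightarrow> bit" and e assume v: "K v"
      have "L (\<lambda>i. v (Suc i))" using v unfolding K_def L_def shift by auto
      then have "\<forall>i<n. v (Suc i) = 0" using L by blast
      then show "v e = 0" using v Z unfolding K_def by (cases "e \<in> Suc ` Z") auto
    qed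
  qed
  also have "\<dots> \<longleftrightarrow> odd (Determinant.det (minor_mat n (\<lambda>i j. adjacency_sign \<sigma> (Suc i) (Suc j)) Z))"
    unfolding odd_det_minor_iff L_def ..
  finally show ?thesis .
qed

theorem theorem1p3:
  fixes n :: nat
    and B :: "(nat, 'a::t2_space) ribbon_graph"
    and \<sigma> :: "nat signed_cyclic_seq"
  assumes "bouquet B" and "edges B = {1..n}" and "signed_rotation B \<sigma>"
  shows "mod_2 (reduction (Determinant.det (1\<^sub>m n + skew_adjacency n \<sigma>)))
           = (\<Sum>X \<in> spanning_quasi_trees B. xset X)
       \<and> int (tau B) = at_ones (mod_2 (reduction (Determinant.det (1\<^sub>m n + skew_adjacency n \<sigma>))))"
proof -
  let ?D = "Determinant.det (1\<^sub>m n + skew_adjacency n \<sigma>)"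
  have Suc_image: "Suc ` {i. Suc i \<in> X} = X" if "X \<subseteq> {1..n}" for X
    using that by (auto simp: image_iff) (metis Suc_pred atLeastAtMost_iff le_simps(3) subsetD One_nat_def)
  define c where "c i j = adjacency_sign \<sigma> (Suc i) (Suc j)" for i j
  let ?det = "\<lambda>X. Determinant.det (minor_mat n c {i. Suc i \<in> X})"
  have "map_mat reduction (1\<^sub>m n + skew_adjacency n \<sigma>) =
    Matrix.mat n n (\<lambda>(i, j). of_bool (i = j) + of_int (c i j) * xset {Suc i, Suc j})"
    by (rule eq_matI)
      (auto simp: skew_adjacency_def c_def reduction_skew_entry reduction_add reduction_1)
  then have "reduction ?D =
    (\<Sum>Z\<in>Pow {0..<n}. of_int (Determinant.det (minor_mat n c Z)) * xset (Suc ` Z))"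
    by (simp only: det_one_plus_expand flip: reduction.hom_det)
  also have "\<dots> = (\<Sum>X\<in>Pow {1..n}. of_int (?det X) * xset X)"
  proof (rule sum.reindex_bij_witness[of _ "\<lambda>X. {i. Suc i \<in> X}" "image Suc"])
    fix X assume "X \<in> Pow {1..n}"
    then show "Suc ` {i. Suc i \<in> X} = X" by (simp add: Suc_image)
  qed (auto simp: inj_image_mem_iff)
  finally have det: "reduction ?D =
    (\<Sum>X\<in>Pow {1..n}. of_int (?det X) * xset X)" .
  have "{X \<in> Pow {1..n}. odd (?det X)} = spanning_quasi_trees B"
  proof (rule Set.set_eqI)
    fix X
    have "odd (?det X) \<longleftrightarrow> quasi_tree (spanning_subgraph B X)" if X: "X \<subseteq> {1..n}"
    proof -
      have "Suc ` {i. Suc i \<in> X} = X" using X by (rule Suc_image)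
      moreover have "{i. Suc i \<in> X} \<subseteq> {0..<n}" using X by auto
      ultimately show ?thesis
        using quasi_tree_iff_odd_minor[OF assms, of "{i. Suc i \<in> X}"] by (simp add: c_def[abs_def])
    qed
    then show "X \<in> {X \<in> Pow {1..n}. odd (?det X)} \<longleftrightarrow> X \<in> spanning_quasi_trees B"
      by (auto simp: spanning_quasi_trees_def assms(2))
  qed
  then have main: "mod_2 (reduction ?D) = (\<Sum>X\<in>spanning_quasi_trees B. xset X)"
    unfolding det by (subst mod_2_sum_xset) simp_all
  have "finite (spanning_quasi_trees B)"
    by (rule finite_subset[of _ "Pow {1..n}"]) (auto simp: spanning_quasi_trees_def assms(2))
  then show ?thesis unfolding main tau_def by (simp add: at_ones_sum_xset)
qed

end
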